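(* Fix a numbering $b_0,b_1,b_2$ of the branches of the triod $T$, and consider the regular patterns for which this numbering is canonical. (i) For every positive rational number $\frac pq<\frac12$ with $\frac pq\ne\frac13$, there exist three distinct unimodal triod twist patterns of rotation number $\frac pq$. (ii) There exists a unique unimodal triod twist pattern of rotation number $\frac13$. (iii) No unimodal triod twist pattern has rotation number greater than or equal to $\frac12$.
   Context: The triod is $T=\{z\in\mathbb{C}: z^3\in[0,1]\}$, with central (branching) point $a=0$; the branches of $T$ are the three components of $T\setminus\{a\}$. Branches are treated as distinguishable. For $x,y$ on the same branch, write $x>y$ if $x$ is farther from $a$ than $y$. Let $\mathcal{U}$ be the set of continuous maps $f:T\to T$ for which $a$ is the unique fixed point. A cycle is a periodic orbit $P\neq\{a\}$ of some $f\in\mathcal{U}$; $[P]$ is its convex hull in $T$. The $P$-linear map is the map that acts on $P$ as given, fixes $a$, is affine on each component of $[P]\setminus(P\cup\{a\})$ and constant on each component of $T\setminus[P]$. Cycles $P$ of $f$ and $Q$ of $g$ are equivalent if there is a homeomorphism $h:[P]\to[Q]$ with $h(P)=Q$ and $h\circ f=g\circ h$ on $P$, which fixes branches (points of each branch are sent into the same branch). The equivalence class of $P$ is its pattern, and $P$ exhibits that pattern. A pattern $A$ forces a pattern $B$ if every $f\in\mathcal{U}$ with a cycle of pattern $A$ also has a cycle of pattern $B$. A cycle and its pattern are primitive if each point of the cycle lies on a different branch. A pattern is regular if it does not force a primitive pattern of period $2$; a cycle is regular if its pattern is. For $u\in b_i$, $v\in b_j$ (indices mod $3$) put $d(u,v)=\frac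 k3$, where $k\in\{0,1,2\}$ and $j\equiv i+k \pmod 3$. For a cycle $P$ of $f$, a point $x\in P$ is green, black or red according as $d(x,f(x))=0,\frac13,\frac23$. If $P$ has period $n$, its rotation pair is $\left(\sum_{i=0}^{n-1}d(f^i(x),f^{i+1}(x)),\,n\right)$ for $x\in P$ (the first entry is an integer), and its rotation number is the quotient of the first entry by the second; these depend only on the pattern. The numbering is canonical for a regular cycle (or its pattern) if, for each $i$, the point of the cycle on $b_i$ closest to $a$ is black. All rotation numbers are computed with the fixed numbering. A triod twist is a regular pattern that does not force another pattern with the same rotation number. A map $f$ is monotone on $U\subset T$ if $f^{-1}(v)\cap U$ is connected for every $v\in f(U)$. A lap (segment of monotonicity) of $f$ is a maximal (with respect to inclusion) connected open subset of $T$ on which $f$ is monotone. A cycle $P$ and its pattern are unimodal if the $P$-linear map has at most two laps (i.e. at most one turning point). *)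

theory Defs
  imports "HOL-Analysis.Analysis"
begin

definition triod :: "complex set" where
  "triod = {z. \<exists>t\<in>{0..1}. z ^ 3 = complex_of_real t}"

definition branches :: "complex set set" where
  "branches = components (triod - {0})"

definition same_branch :: "complex \<Rightarrow> complex \<Rightarrow> bool" where
  "same_branch u v \<longleftrightarrow> (\<exists>B\<in>branches. u \<in> B \<and> v \<in> B)"

text \<open>The path metric of the triod: each closed branch is isometric to \<open>[0,1]\<close>.\<close>

definition triod_dist :: "complex \<Rightarrow> complex \<Rightarrow> real" where
  "triod_dist u v = (if same_branch u v then dist u v else norm u + norm v)"

text \<open>Functions are total on \<^typ>\<open>complex\<close>; only their values on \<^const>\<open>triod\<close> matter.\<close>

definition triod_maps :: "(complex \<Rightarrow> complex) set" where
  "triod_maps = {f. continuous_on triod f \<and> f ` triod \<subseteq> triod \<and> {x \<in> triod. f x = x} = {0}}"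

text \<open>A cycle is represented together with its map, as a pair \<open>(f, P)\<close>.
  Its period is \<open>card P\<close>.\<close>

definition periodic_orbit :: "(complex \<Rightarrow> complex) \<Rightarrow> complex set \<Rightarrow> bool" where
  "periodic_orbit f P \<longleftrightarrow>
     (\<exists>x\<in>triod. \<exists>n>0. (f ^^ n) x = x \<and> P = range (\<lambda>i. (f ^^ i) x))"

definition cycles :: "((complex \<Rightarrow> complex) \<times> complex set) set" where
  "cycles = {(f, P). f \<in> triod_maps \<and> periodic_orbit f P \<and> P \<noteq> {0}}"

text \<open>The intersection of all connected subsets of the triod containing \<open>P\<close>; since
  the triod is uniquely arcwise connected, it is the smallest of them.\<close>

definition triod_hull :: "complex set \<Rightarrow> complex set" where
  "triod_hull P = (\<lambda>S. connected S \<and> S \<subseteq> triod) hull P"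

definition cycle_equiv ::
  "(((complex \<Rightarrow> complex) \<times> complex set) \<times> ((complex \<Rightarrow> complex) \<times> complex set)) set" where
  "cycle_equiv = {((f, P), (g, Q)). (f, P) \<in> cycles \<and> (g, Q) \<in> cycles \<and>
     (\<exists>h k. homeomorphism (triod_hull P) (triod_hull Q) h k \<and> h ` P = Q \<and>
        (\<forall>x\<in>P. h (f x) = g (h x)) \<and>
        (\<forall>B\<in>branches. h ` (triod_hull P \<inter> B) \<subseteq> B))}"

definition patterns :: "((complex \<Rightarrow> complex) \<times> complex set) set set" where
  "patterns = cycles // cycle_equiv"

text \<open>A pattern \<open>A\<close> is a class of pairs \<open>(f, P)\<close>, so \<open>f\<close> has a cycle of pattern \<open>A\<close>
  exactly if \<open>(f, P) \<in> A\<close> for some \<open>P\<close>.\<close>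

definition forces ::
  "((complex \<Rightarrow> complex) \<times> complex set) set \<Rightarrow> ((complex \<Rightarrow> complex) \<times> complex set) set \<Rightarrow> bool" where
  "forces A B \<longleftrightarrow> (\<forall>f\<in>triod_maps. (\<exists>P. (f, P) \<in> A) \<longrightarrow> (\<exists>Q. (f, Q) \<in> B))"

definition primitive_cycle :: "complex set \<Rightarrow> bool" where
  "primitive_cycle P \<longleftrightarrow> (\<forall>x\<in>P. \<forall>y\<in>P. x \<noteq> y \<longrightarrow> \<not> same_branch x y)"

definition primitive_pattern_of_period ::
  "nat \<Rightarrow> ((complex \<Rightarrow> complex) \<times> complex set) set \<Rightarrow> bool" where
  "primitive_pattern_of_period n A \<longleftrightarrow> (\<exists>(f, P)\<in>A. primitive_cycle P \<and> card P = n)"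

definition regular_pattern :: "((complex \<Rightarrow> complex) \<times> complex set) set \<Rightarrow> bool" where
  "regular_pattern A \<longleftrightarrow> (\<forall>B\<in>patterns. primitive_pattern_of_period 2 B \<longrightarrow> \<not> forces A B)"

definition branch_numbering :: "(nat \<Rightarrow> complex set) \<Rightarrow> bool" where
  "branch_numbering b \<longleftrightarrow> bij_betw b {0, 1, 2} branches"

definition displacement :: "(nat \<Rightarrow> complex set) \<Rightarrow> complex \<Rightarrow> complex \<Rightarrow> rat" where
  "displacement b u v =
     of_nat (THE k. k < 3 \<and> (\<exists>i<3. u \<in> b i \<and> v \<in> b ((i + k) mod 3))) / 3"

definition rotation_pair ::
  "(nat \<Rightarrow> complex set) \<Rightarrow> (complex \<Rightarrow> complex) \<Rightarrow> complex set \<Rightarrow> complex \<Rightarrow> rat \<times> nat" where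
  "rotation_pair b f P x =
     (\<Sum>i<card P. displacement b ((f ^^ i) x) ((f ^^ Suc i) x), card P)"

text \<open>The rotation pair depends neither on the point of the cycle (see
  \<open>rotation_pair_eq_sum\<close> below) nor on the representative of the pattern.\<close>

definition has_rotation_number ::
  "(nat \<Rightarrow> complex set) \<Rightarrow> ((complex \<Rightarrow> complex) \<times> complex set) set \<Rightarrow> rat \<Rightarrow> bool" where
  "has_rotation_number b A r \<longleftrightarrow>
     (\<exists>(f, P)\<in>A. \<exists>x\<in>P. r = fst (rotation_pair b f P x) / of_nat (snd (rotation_pair b f P x)))"

definition black :: "(nat \<Rightarrow> complex set) \<Rightarrow> (complex \<Rightarrow> complex) \<Rightarrow> complex \<Rightarrow> bool" where
  "black b f x \<longleftrightarrow> displacement b x (f x) = 1 / 3"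

text \<open>A cycle missing a branch has no point closest to \<open>0\<close> there, so it has no canonical
  numbering (such a cycle is never regular).\<close>

definition canonical_for_cycle ::
  "(nat \<Rightarrow> complex set) \<Rightarrow> (complex \<Rightarrow> complex) \<Rightarrow> complex set \<Rightarrow> bool" where
  "canonical_for_cycle b f P \<longleftrightarrow>
     (\<forall>i<3. \<exists>x\<in>P \<inter> b i. (\<forall>y\<in>P \<inter> b i. norm x \<le> norm y) \<and> black b f x)"

definition canonical_for ::
  "(nat \<Rightarrow> complex set) \<Rightarrow> ((complex \<Rightarrow> complex) \<times> complex set) set \<Rightarrow> bool" where
  "canonical_for b A \<longleftrightarrow> (\<exists>(f, P)\<in>A. canonical_for_cycle b f P)"

definition triod_twist ::
  "(nat \<Rightarrow> complex set) \<Rightarrow> ((complex \<Rightarrow> complex) \<times> complex set) set \<Rightarrow> bool" where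
  "triod_twist b A \<longleftrightarrow> A \<in> patterns \<and> regular_pattern A \<and>
     \<not> (\<exists>B\<in>patterns. B \<noteq> A \<and> forces A B \<and>
          (\<exists>r. has_rotation_number b A r \<and> has_rotation_number b B r))"

text \<open>Every segment inside a branch is mapped at constant speed onto a
  geodesic of \<^const>\<open>triod_dist\<close>, which may pass through \<open>0\<close>.\<close>

definition affine_on_segment :: "(complex \<Rightarrow> complex) \<Rightarrow> complex set \<Rightarrow> bool" where
  "affine_on_segment g C \<longleftrightarrow> (\<forall>x\<in>C. \<forall>y\<in>C. \<forall>t\<in>{0..1}.
     triod_dist (g x) (g ((1 - t) *\<^sub>R x + t *\<^sub>R y)) = t * triod_dist (g x) (g y) \<and>
     triod_dist (g ((1 - t) *\<^sub>R x + t *\<^sub>R y)) (g y) = (1 - t) * triod_dist (g x) (g y))"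

text \<open>These conditions determine \<open>g\<close> on \<^const>\<open>triod\<close>.\<close>

definition is_linear_map_of ::
  "(complex \<Rightarrow> complex) \<Rightarrow> complex set \<Rightarrow> (complex \<Rightarrow> complex) \<Rightarrow> bool" where
  "is_linear_map_of f P g \<longleftrightarrow>
     continuous_on triod g \<and> g ` triod \<subseteq> triod \<and> (\<forall>x\<in>P. g x = f x) \<and> g 0 = 0 \<and>
     (\<forall>C\<in>components (triod_hull P - (P \<union> {0})). affine_on_segment g C) \<and>
     (\<forall>C\<in>components (triod - triod_hull P). g constant_on C)"

definition connected_fibres_on :: "(complex \<Rightarrow> complex) \<Rightarrow> complex set \<Rightarrow> bool" where
  "connected_fibres_on f U \<longleftrightarrow> (\<forall>v\<in>f ` U. connected (f -` {v} \<inter> U))"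

definition laps :: "(complex \<Rightarrow> complex) \<Rightarrow> complex set set" where
  "laps f =
     (let M = {U. openin (top_of_set triod) U \<and> connected U \<and> connected_fibres_on f U}
      in {U \<in> M. \<forall>V\<in>M. U \<subseteq> V \<longrightarrow> U = V})"

definition unimodal_cycle :: "(complex \<Rightarrow> complex) \<Rightarrow> complex set \<Rightarrow> bool" where
  "unimodal_cycle f P \<longleftrightarrow>
     (\<exists>g. is_linear_map_of f P g \<and> finite (laps g) \<and> card (laps g) \<le> 2)"

definition unimodal_pattern :: "((complex \<Rightarrow> complex) \<times> complex set) set \<Rightarrow> bool" where
  "unimodal_pattern A \<longleftrightarrow> (\<exists>(f, P)\<in>A. unimodal_cycle f P)"

definition unimodal_triod_twists ::
  "(nat \<Rightarrow> complex set) \<Rightarrow> rat \<Rightarrow> ((complex \<Rightarrow> complex) \<times> complex set) set set" where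
  "unimodal_triod_twists b r =
     {A. triod_twist b A \<and> canonical_for b A \<and> unimodal_pattern A \<and> has_rotation_number b A r}"

lemma periodic_orbit_minimal_period:
  assumes "periodic_orbit f P" "x \<in> P"
  shows "(f ^^ card P) x = x" "bij_betw (\<lambda>i. (f ^^ i) x) {..<card P} P"
proof -
  obtain x0 n where n: "n > 0" "(f ^^ n) x0 = x0" and P: "P = range (\<lambda>i. (f ^^ i) x0)"
    using assms(1) unfolding periodic_orbit_def by auto
  obtain j where x: "x = (f ^^ j) x0" using assms(2) P by auto
  have nx: "(f ^^ n) x = x"
    using n(2) unfolding x by (metis comp_apply add.commute funpow_add)
  define p where "p = (LEAST m. m > 0 \<and> (f ^^ m) x = x)"
  have p: "p > 0" "(f ^^ p) x = x"
    using LeastI[of "\<lambda>m. m > 0 \<and> (f ^^ m) x = x" n] n(1) nx unfolding p_def by auto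
  have pmin: "p \<le> m" if "m > 0" "(f ^^ m) x = x" for m
    unfolding p_def by (rule Least_le) (use that in auto)
  have orb: "(f ^^ i) x = (f ^^ (i mod p)) x" for i
    by (metis funpow_mod_eq p(2))
  have "P = range (\<lambda>i. (f ^^ i) x)"
  proof
    show "range (\<lambda>i. (f ^^ i) x) \<subseteq> P"
      unfolding P x by (auto simp: funpow_add[symmetric, THEN fun_cong, unfolded comp_apply])
    show "P \<subseteq> range (\<lambda>i. (f ^^ i) x)"
    proof
      fix z assume "z \<in> P"
      then obtain i where z: "z = (f ^^ i) x0" using P by auto
      have nk: "(f ^^ (n * k)) x0 = x0" for k
        by (metis funpow_mod_eq mod_mult_self1_is_0 n(2) funpow_0)
      have jn: "j \<le> n * j" using n(1) by simp
      have "(f ^^ (i + (n * j - j))) x = (f ^^ (i + (n * j - j) + j)) x0"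
        unfolding x by (simp add: funpow_add)
      also have "i + (n * j - j) + j = i + n * j" using jn by linarith
      also have "(f ^^ (i + n * j)) x0 = z" using nk z by (simp add: funpow_add)
      finally show "z \<in> range (\<lambda>i. (f ^^ i) x)" by blast
    qed
  qed
  also have "\<dots> = (\<lambda>i. (f ^^ i) x) ` {..<p}"
    using orb p(1) by (auto simp: image_iff) (metis lessThan_iff mod_less_divisor)
  finally have Pp: "P = (\<lambda>i. (f ^^ i) x) ` {..<p}" .
  have inj: "inj_on (\<lambda>i. (f ^^ i) x) {..<p}"
  proof (rule linorder_inj_onI)
    fix i k assume ik: "i < k" "i \<in> {..<p}" "k \<in> {..<p}"
    show "(f ^^ i) x \<noteq> (f ^^ k) x"
    proof
      assume e: "(f ^^ i) x = (f ^^ k) x"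
      have "(f ^^ (p - k + i)) x = (f ^^ (p - k)) ((f ^^ k) x)"
        using e by (simp add: funpow_add)
      also have "\<dots> = (f ^^ (p - k + k)) x" unfolding funpow_add by simp
      also have "\<dots> = x" using ik p by simp
      finally show False using pmin[of "p - k + i"] ik by simp
    qed
  qed auto
  have "card P = p" using card_image[OF inj] Pp by simp
  then show "(f ^^ card P) x = x" "bij_betw (\<lambda>i. (f ^^ i) x) {..<card P} P"
    using p inj Pp by (auto simp: bij_betw_def)
qed

lemma rotation_pair_eq_sum:
  assumes "periodic_orbit f P" "x \<in> P"
  shows "rotation_pair b f P x = (\<Sum>y\<in>P. displacement b y (f y), card P)"
  using sum.reindex_bij_betw[OF periodic_orbit_minimal_period(2)[OF assms],
      of "\<lambda>y. displacement b y (f y)"]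
  by (simp add: rotation_pair_def)

end

theory Submission
  imports Defs
begin

text \<open>
  Let the branch \<open>b 0\<close> carry points whose return map is the interval exchange
  \<open>n \<mapsto> n + K\<close> (\<open>n \<le> B\<close>, black) and \<open>n \<mapsto> n - B\<close> (\<open>n > B\<close>, green or red) of
  \<open>{1..B + K}\<close>, with \<open>B\<close> and \<open>K\<close> coprime. The corresponding piecewise linear map has one
  turning point, and a potential that grows along every orbit by at most the displacement minus
  the rotation number (up to scale and sign) shows that it has no other cycle with the same rotation number;
  hence its pattern is a twist. The choice of the branch with the turning point gives three patterns.

  Conversely, on a branch of a canonical cycle with a point that is not black, the linear map has a
  peak, and it has a second one if the branch has both green and red points; but two peaks separate
  three laps. So nonblack points share branch and colour, which bounds the rotation number by
  \<open>1/2\<close> and makes every point black if it is \<open>1/3\<close>. An all black cycle forces, by nested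
  intervals, a black cycle of period three, and all of these have the same pattern.
\<close>

section \<open>Branches as rays\<close>

text \<open>Forcing quantifies over all maps, but a pattern forced by the model's pattern is
  exhibited by the model map itself. Regularity and the twist property therefore reduce to a study
  of the cycles of one explicit map. The two nonblack colours serve the two ranges of rotation
  numbers: a black point of \<open>b 0\<close> returns after 3 steps with displacement 1, a green
  one after 1 step with displacement 0, a red one after 2 steps with displacement 1. The exchange
  makes \<open>B\<close> black and \<open>K\<close> nonblack returns, so the rotation number is
  \<open>B / (3B + K)\<close>, below 1/3, with green and \<open>(B + K) / (3B + 2K)\<close>, between
  1/3 and 1/2, with red. For \<open>K = 0\<close> every nonzero point of the model has period three,
  and uniqueness holds only up to equivalence. The three patterns differ in the one branch that
  carries nonblack points, and a cyclic shift of the numbering moves this branch while it preserves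
  all colours. In the converse direction the obstacle is that a lap is an open subset of the whole
  triod and may extend over several branches. Laps are therefore counted through points that lie in
  no set of monotonicity.\<close>

definition ray :: "complex \<Rightarrow> complex set" where
  "ray w = (\<lambda>s. s *\<^sub>R w) ` {0<..1}"

lemma triod_eq_rays: "triod = insert 0 (\<Union>w\<in>{w. w ^ 3 = 1}. ray w)"
proof (intro equalityI subsetI)
  fix z assume "z \<in> triod"
  then obtain t where t: "0 \<le> t" "t \<le> 1" "z ^ 3 = complex_of_real t"
    unfolding triod_def by auto
  show "z \<in> insert 0 (\<Union>w\<in>{w. w ^ 3 = 1}. ray w)"
  proof (cases "z = 0")
    case False
    have n: "norm z ^ 3 = t"
      using t by (metis abs_of_nonneg norm_of_real norm_power)
    have le: "norm z \<le> 1"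
      using n t(2) by (metis norm_ge_zero not_le one_less_power zero_less_numeral)
    have "t \<noteq> 0" using n False by auto
    then have "(z /\<^sub>R norm z) ^ 3 = 1"
      using t(3) n False by (simp add: scaleR_conv_of_real power_mult_distrib power_divide divide_simps flip: of_real_power)
    moreover have "z \<in> ray (z /\<^sub>R norm z)"
      unfolding ray_def using False le by (intro image_eqI[of _ _ "norm z"]) auto
    ultimately show ?thesis by blast
  qed simp
next
  fix z assume z: "z \<in> insert 0 (\<Union>w\<in>{w. w ^ 3 = 1}. ray w)"
  show "z \<in> triod"
  proof (cases "z = 0")
    case True
    then show ?thesis unfolding triod_def by (auto intro!: bexI[of _ 0])
  next
    case False
    then obtain w s where w: "w ^ 3 = 1" "0 < s" "s \<le> 1" "z = s *\<^sub>R w"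
      using z unfolding ray_def by auto
    have "z ^ 3 = complex_of_real (s ^ 3)"
      using w by (simp add: scaleR_conv_of_real power_mult_distrib)
    moreover have "s ^ 3 \<in> {0..1}" using w by (simp add: power_le_one)
    ultimately show ?thesis unfolding triod_def by blast
  qed
qed

lemma norm_cube_root: "w ^ 3 = 1 \<Longrightarrow> norm (w::complex) = 1"
  by (metis norm_ge_zero norm_one norm_power power_eq_1_iff zero_neq_numeral abs_of_nonneg)

lemma connected_ray: "connected (ray w)"
  unfolding ray_def by (intro connected_continuous_image continuous_intros convex_connected) auto

lemma zero_notin_ray: "w ^ 3 = 1 \<Longrightarrow> 0 \<notin> ray w"
  unfolding ray_def by auto

lemma ray_sgn: "w ^ 3 = 1 \<Longrightarrow> z \<in> ray w \<Longrightarrow> sgn z = w"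
  unfolding ray_def using norm_cube_root[of w] by (auto simp: sgn_div_norm)

text \<open>\<open>sgn\<close> is continuous away from 0 and takes only cube roots of unity as
  values on the punctured triod, so it is constant on a connected set.\<close>

lemma connected_in_ray:
  assumes "connected S" "S \<subseteq> triod - {0}" "z \<in> S" "w ^ 3 = 1" "z \<in> ray w"
  shows "S \<subseteq> ray w"
proof -
  have R: "\<exists>w. w ^ 3 = 1 \<and> y \<in> ray w" if "y \<in> S" for y
    using that assms(2) unfolding triod_eq_rays by auto
  have "sgn ` S \<subseteq> {w. w ^ 3 = 1}"
    using R ray_sgn by fastforce
  moreover have "finite {w::complex. w ^ 3 = 1}"
    using finite_roots_unity[of 3] by simp
  ultimately have fin: "finite (sgn ` S)" by (rule finite_subset)
  have "continuous_on S (sgn :: complex \<Rightarrow> complex)"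
    using assms(2) by (intro continuous_intros) auto
  then have "connected (sgn ` S)" using assms(1) by (rule connected_continuous_image)
  then obtain c where c: "sgn ` S \<subseteq> {c}"
    using fin connected_finite_iff_sing by (metis empty_subsetI order_refl)
  show ?thesis
  proof
    fix y assume y: "y \<in> S"
    then obtain v where v: "v ^ 3 = 1" "y \<in> ray v" using R by blast
    have "sgn y = c" "sgn z = c" using c y assms(3) by auto
    then have "v = w" using ray_sgn[OF v] ray_sgn[OF assms(4,5)] by simp
    then show "y \<in> ray w" using v by simp
  qed
qed

lemma branches_eq_rays: "branches = ray ` {w. w ^ 3 = 1}"
proof (intro equalityI subsetI)
  fix C assume "C \<in> branches"
  then have C: "C \<in> components (triod - {0})" by (simp add: branches_def)
  obtain z where z: "z \<in> C" using in_components_nonempty[OF C] by blast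
  have sub: "C \<subseteq> triod - {0}" using in_components_subset[OF C] .
  then obtain w where w: "w ^ 3 = 1" "z \<in> ray w" using z unfolding triod_eq_rays by auto
  have "C \<subseteq> ray w"
    using connected_in_ray[OF in_components_connected[OF C] sub z w] .
  moreover have "ray w \<subseteq> C"
    using C connected_ray w z
    by (intro components_maximal[OF C]) (auto simp: triod_eq_rays zero_notin_ray)
  ultimately show "C \<in> ray ` {w. w ^ 3 = 1}" using w by blast
next
  fix C assume "C \<in> ray ` {w. w ^ 3 = 1}"
  then obtain w where w: "w ^ 3 = 1" "C = ray w" by auto
  have sub: "ray w \<subseteq> triod - {0}" using w by (auto simp: triod_eq_rays zero_notin_ray)
  have "w \<in> ray w" unfolding ray_def by (intro image_eqI[of _ _ 1]) auto
  then obtain z where z: "z \<in> ray w" by blast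
  show "C \<in> branches" unfolding branches_def w(2) in_components_maximal
    using connected_ray sub z connected_in_ray[OF _ _ _ w(1)] by blast
qed

text \<open>For \<open>x = u * cnj v\<close>, a cube root of unity other than 1, the relations x^2 +
  x + 1 = 0 and cnj x = x^2 give 2 Re x = -1. The negative sign is what makes \<open>rad\<close>
  vanish on the other two branches.\<close>

lemma cube_roots_inner:
  fixes u v :: complex
  assumes "u ^ 3 = 1" "v ^ 3 = 1" "u \<noteq> v"
  shows "u \<bullet> v = - 1 / 2"
proof -
  define x where "x = u * cnj v"
  have nv: "v * cnj v = 1" using norm_cube_root[OF assms(2)] by (simp add: complex_norm_square[symmetric])
  have x3: "x ^ 3 = 1" unfolding x_def using assms by (simp add: power_mult_distrib flip: complex_cnj_power)
  have "x \<noteq> 1"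
  proof
    assume "x = 1"
    then have "u * (v * cnj v) = v" unfolding x_def by (simp add: algebra_simps)
    then show False using nv assms(3) by simp
  qed
  moreover have "(x - 1) * (x\<^sup>2 + x + 1) = x ^ 3 - 1"
    by (simp add: power2_eq_square power3_eq_cube algebra_simps)
  ultimately have q: "x\<^sup>2 + x + 1 = 0" using x3 by simp
  have nx: "x * cnj x = 1" using norm_cube_root[OF x3] by (simp add: complex_norm_square[symmetric])
  have "cnj x = x\<^sup>2"
    using x3 nx
    by (metis mult.left_commute mult.right_neutral power2_eq_square power3_eq_cube mult.assoc mult.commute)
  then have "cnj x + x + 1 = 0" using q by simp
  then have "Re x = - 1 / 2" by (simp add: complex_eq_iff)
  then show ?thesis unfolding x_def by (simp add: inner_complex_def)
qed

text \<open>The unit vectors \<open>e i\<close> accompany \<open>b\<close> to provide polar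
  coordinates. As a locale, the theory can be instantiated again with a shifted numbering.\<close>

locale numbered_triod =
  fixes b :: "nat \<Rightarrow> complex set" and e :: "nat \<Rightarrow> complex"
  assumes b_eq: "i < 3 \<Longrightarrow> b i = ray (e i)"
    and e_cube: "i < 3 \<Longrightarrow> e i ^ 3 = 1"
    and e_inj: "inj_on e {..<3}"
    and branches_eq: "branches = b ` {..<3}"

lemma numbered_triod_exists:
  assumes "branch_numbering b"
  obtains e where "numbered_triod b e"
proof -
  have bij: "bij_betw b {..<3} branches"
    using assms unfolding branch_numbering_def by (simp add: lessThan_Suc numeral_3_eq_3 insert_commute numeral_2_eq_2)
  have "\<exists>w. w ^ 3 = 1 \<and> b i = ray w" if "i < 3" for i
    using bij that unfolding branches_eq_rays bij_betw_def by blast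
  then obtain e where e: "\<And>i. i < 3 \<Longrightarrow> e i ^ 3 = 1 \<and> b i = ray (e i)" by metis
  have "inj_on e {..<3}"
    using bij e unfolding bij_betw_def inj_on_def by (metis lessThan_iff)
  then have "numbered_triod b e"
    using e bij by unfold_locales (auto simp: bij_betw_def)
  then show ?thesis using that by blast
qed

section \<open>Polar coordinates on the triod\<close>

context numbered_triod
begin

definition pt :: "nat \<Rightarrow> real \<Rightarrow> complex" where
  "pt i s = s *\<^sub>R e i"

text \<open>Positive part of the projection to \<open>e i\<close>. On the triod it is the norm on
  \<open>b i\<close> and 0 elsewhere, yet it is continuous on the whole plane, so continuity
  arguments need no case distinction at the branching point.\<close>

definition rad :: "nat \<Rightarrow> complex \<Rightarrow> real" where
  "rad i z = max 0 (z \<bullet> e i)"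

lemma norm_e [simp]: "i < 3 \<Longrightarrow> norm (e i) = 1"
  using e_cube norm_cube_root by blast

lemma inner_e: "i < 3 \<Longrightarrow> j < 3 \<Longrightarrow> i \<noteq> j \<Longrightarrow> e i \<bullet> e j = - 1 / 2"
  using cube_roots_inner e_cube e_inj by (metis inj_onD lessThan_iff)

lemma pt_0 [simp]: "pt i 0 = 0"
  by (simp add: pt_def)

lemma norm_pt [simp]: "i < 3 \<Longrightarrow> norm (pt i s) = \<bar>s\<bar>"
  by (simp add: pt_def)

lemma pt_eq_0_iff [simp]: "i < 3 \<Longrightarrow> pt i s = 0 \<longleftrightarrow> s = 0"
  by (metis norm_pt norm_eq_zero abs_eq_0)

lemma rad_pt: "i < 3 \<Longrightarrow> k < 3 \<Longrightarrow> 0 \<le> s \<Longrightarrow> rad k (pt i s) = (if k = i then s else 0)"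
  using inner_e[of i k] norm_e[of i] by (auto simp: rad_def pt_def dot_square_norm mult_nonneg_nonneg)

lemma rad_0 [simp]: "rad i 0 = 0"
  by (simp add: rad_def)

lemma rad_nonneg [simp]: "0 \<le> rad i z"
  by (simp add: rad_def)

lemma continuous_rad [continuous_intros]:
  "continuous_on S g \<Longrightarrow> continuous_on S (\<lambda>x. rad i (g x))"
  unfolding rad_def by (intro continuous_intros)

lemma continuous_pt [continuous_intros]:
  "continuous_on S g \<Longrightarrow> continuous_on S (\<lambda>x. pt i (g x))"
  unfolding pt_def by (intro continuous_intros)

lemma b_iff: "i < 3 \<Longrightarrow> z \<in> b i \<longleftrightarrow> (\<exists>s. 0 < s \<and> s \<le> 1 \<and> z = pt i s)"
  unfolding b_eq ray_def pt_def by auto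

lemma pt_eq_iff:
  "i < 3 \<Longrightarrow> k < 3 \<Longrightarrow> 0 \<le> s \<Longrightarrow> 0 \<le> t \<Longrightarrow> pt i s = pt k t \<longleftrightarrow> s = t \<and> (i = k \<or> s = 0)"
  using rad_pt[of i k s] rad_pt[of k k t] rad_pt[of i i s] rad_pt[of k i t]
  by (metis pt_0)

lemma pt_in_b_iff: "i < 3 \<Longrightarrow> k < 3 \<Longrightarrow> 0 \<le> s \<Longrightarrow> pt i s \<in> b k \<longleftrightarrow> i = k \<and> 0 < s \<and> s \<le> 1"
  by (auto simp: b_iff pt_eq_iff)

lemma triod_iff: "z \<in> triod \<longleftrightarrow> (\<exists>i<3. \<exists>s. 0 \<le> s \<and> s \<le> 1 \<and> z = pt i s)"
proof -
  have "ray ` {w. w ^ 3 = 1} = b ` {..<3}" using branches_eq branches_eq_rays by simp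
  then have "triod = insert 0 (\<Union> (b ` {..<3}))" unfolding triod_eq_rays by simp
  then have "z \<in> triod \<longleftrightarrow> z = 0 \<or> (\<exists>i<3. z \<in> b i)" by auto
  also have "\<dots> \<longleftrightarrow> (\<exists>i<3. \<exists>s. 0 \<le> s \<and> s \<le> 1 \<and> z = pt i s)"
    by (metis b_iff pt_0 order_le_less zero_le_one zero_less_numeral)
  finally show ?thesis .
qed

lemma triod_cases:
  assumes "z \<in> triod"
  obtains "z = 0" | i s where "i < 3" "0 < s" "s \<le> 1" "z = pt i s"
  using assms unfolding triod_iff by (metis pt_0 order_le_less)

lemma pt_in_triod: "i < 3 \<Longrightarrow> 0 \<le> s \<Longrightarrow> s \<le> 1 \<Longrightarrow> pt i s \<in> triod"
  unfolding triod_iff by blast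

lemma zero_in_triod [simp]: "0 \<in> triod"
  using pt_in_triod[of 0 0] by simp

lemma b_subset_triod: "i < 3 \<Longrightarrow> b i \<subseteq> triod"
  by (metis b_iff less_imp_le subsetI triod_iff)

lemma zero_notin_b [simp]: "i < 3 \<Longrightarrow> 0 \<notin> b i"
  by (auto simp: b_iff)

lemma b_disjoint: "i < 3 \<Longrightarrow> k < 3 \<Longrightarrow> z \<in> b i \<Longrightarrow> z \<in> b k \<Longrightarrow> i = k"
  by (auto simp: b_iff pt_eq_iff)

lemma in_some_b: "z \<in> triod \<Longrightarrow> z \<noteq> 0 \<Longrightarrow> \<exists>i<3. z \<in> b i"
  by (metis b_iff triod_cases)

lemma rad_in_b: "i < 3 \<Longrightarrow> z \<in> b i \<Longrightarrow> rad i z = norm z"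
  by (auto simp: b_iff rad_pt)

lemma pt_rad: "i < 3 \<Longrightarrow> z \<in> b i \<Longrightarrow> pt i (rad i z) = z"
  by (auto simp: b_iff rad_pt)

lemma pt_norm: "i < 3 \<Longrightarrow> z \<in> b i \<Longrightarrow> pt i (norm z) = z"
  by (auto simp: b_iff)

lemma rad_not_in_b: "i < 3 \<Longrightarrow> z \<in> triod \<Longrightarrow> z \<notin> b i \<Longrightarrow> rad i z = 0"
  by (erule triod_cases) (auto simp: rad_pt pt_in_b_iff)

lemma rad_pos_iff: "i < 3 \<Longrightarrow> z \<in> triod \<Longrightarrow> 0 < rad i z \<longleftrightarrow> z \<in> b i"
  by (metis rad_in_b rad_not_in_b less_irrefl zero_less_norm_iff zero_notin_b)

lemma rad_le_1: "i < 3 \<Longrightarrow> z \<in> triod \<Longrightarrow> rad i z \<le> 1"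
  by (erule triod_cases) (auto simp: rad_pt)

lemma eq_pt_of_rad: "i < 3 \<Longrightarrow> z \<in> triod \<Longrightarrow> rad i z = s \<Longrightarrow> 0 < s \<Longrightarrow> z = pt i s"
  by (metis pt_rad rad_pos_iff)

lemma norm_le_1: "z \<in> triod \<Longrightarrow> norm z \<le> 1"
  by (erule triod_cases) auto

lemma same_branch_iff: "same_branch u v \<longleftrightarrow> (\<exists>i<3. u \<in> b i \<and> v \<in> b i)"
  unfolding same_branch_def branches_eq by auto

lemma triod_dist_same:
  "i < 3 \<Longrightarrow> 0 \<le> s \<Longrightarrow> s \<le> 1 \<Longrightarrow> 0 \<le> t \<Longrightarrow> t \<le> 1 \<Longrightarrow> triod_dist (pt i s) (pt i t) = \<bar>s - t\<bar>"
  unfolding triod_dist_def same_branch_iff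
  by (auto simp: dist_norm pt_def pt_in_b_iff[unfolded pt_def] simp flip: scaleR_diff_left)

lemma triod_dist_other:
  "i < 3 \<Longrightarrow> k < 3 \<Longrightarrow> i \<noteq> k \<Longrightarrow> 0 \<le> s \<Longrightarrow> 0 \<le> t \<Longrightarrow> triod_dist (pt i s) (pt k t) = s + t"
  unfolding triod_dist_def same_branch_iff by (auto simp: pt_in_b_iff)

lemma triod_dist_eq_0: "u \<in> triod \<Longrightarrow> v \<in> triod \<Longrightarrow> triod_dist u v = 0 \<Longrightarrow> u = v"
  unfolding triod_dist_def by (auto split: if_splits simp: add_nonneg_eq_0_iff)

lemma triod_dist_refl: "u \<in> triod \<Longrightarrow> triod_dist u u = 0"
  unfolding triod_dist_def same_branch_iff using in_some_b by auto

lemma less_3_cases: "(i::nat) < 3 \<Longrightarrow> i = 0 \<or> i = 1 \<or> i = 2"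
  by linarith

lemma mod_3_add_cancel:
  assumes "(k::nat) < 3" "l < 3" "(i + l) mod 3 = (i + k) mod 3"
  shows "l = k"
  using less_3_cases[OF assms(1)] less_3_cases[OF assms(2)] assms(3)
  by (elim disjE; simp; presburger)

lemma mod_3_diff:
  assumes "(i::nat) < 3" "l < 3"
  shows "\<exists>k<3. (i + k) mod 3 = l"
proof (intro exI conjI)
  show "(l + 3 - i) mod 3 < 3" by simp
  show "(i + (l + 3 - i) mod 3) mod 3 = l"
    using less_3_cases[OF assms(1)] less_3_cases[OF assms(2)] by (elim disjE) simp_all
qed

lemma displacement_eq:
  assumes "i < 3" "k < 3" "u \<in> b i" "v \<in> b ((i + k) mod 3)"
  shows "displacement b u v = of_nat k / 3"
proof -
  have "(THE k. k < 3 \<and> (\<exists>i<3. u \<in> b i \<and> v \<in> b ((i + k) mod 3))) = k"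
  proof (rule the_equality)
    fix k' assume k': "k' < 3 \<and> (\<exists>i<3. u \<in> b i \<and> v \<in> b ((i + k') mod 3))"
    then obtain i' where i': "i' < 3" "u \<in> b i'" "v \<in> b ((i' + k') mod 3)" by blast
    have "i' = i" using b_disjoint[OF i'(1) assms(1) i'(2) assms(3)] .
    then have "(i + k') mod 3 = (i + k) mod 3"
      using b_disjoint[of "(i + k') mod 3" "(i + k) mod 3" v] i' assms by simp
    then show "k' = k" using mod_3_add_cancel k' assms by blast
  qed (use assms in auto)
  then show ?thesis unfolding displacement_def by simp
qed

lemma displacement_cases:
  assumes "i < 3" "u \<in> b i" "v \<in> triod" "v \<noteq> 0"
  obtains k where "k < 3" "v \<in> b ((i + k) mod 3)" "displacement b u v = of_nat k / 3"
proof -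
  obtain l where l: "l < 3" "v \<in> b l" using in_some_b assms by blast
  obtain k where "k < 3" "(i + k) mod 3 = l" using mod_3_diff assms l by blast
  then show ?thesis using that displacement_eq[of i k u v] assms l by metis
qed

section \<open>Connected subsets and hulls\<close>

lemma connected_b: "i < 3 \<Longrightarrow> connected (b i)"
  by (simp add: b_eq connected_ray)

lemma connected_subset_b:
  assumes "connected S" "S \<subseteq> triod" "0 \<notin> S" "i < 3" "z \<in> S" "z \<in> b i"
  shows "S \<subseteq> b i"
  using connected_in_ray[of S z "e i"] assms by (simp add: b_eq e_cube subset_Diff_insert)

text \<open>A positive value of \<open>rad i\<close> determines the point of the triod, so the
  intermediate value theorem for \<open>rad i\<close> yields the point itself, even if
  \<open>x\<close> lies off the branch.\<close>

lemma connected_between: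
  assumes "connected S" "S \<subseteq> triod" "i < 3" "x \<in> S" "y \<in> S" "rad i x \<le> s" "s \<le> rad i y" "0 < s"
  shows "pt i s \<in> S"
proof -
  have "connected (rad i ` S)"
    by (intro connected_continuous_image continuous_intros assms)
  then have "s \<in> rad i ` S"
    using assms unfolding connected_iff_interval by blast
  then obtain z where z: "z \<in> S" "rad i z = s" by auto
  then have "z = pt i s" using eq_pt_of_rad assms by blast
  then show ?thesis using z by simp
qed

lemma connected_radii:
  assumes "connected S" "S \<subseteq> triod" "i < 3" "pt i r \<in> S" "pt i t \<in> S" "0 \<le> r" "r \<le> s" "s \<le> t"
  shows "pt i s \<in> S"
  using connected_between[OF assms(1-5), of s] rad_pt[of i i] assms
  by (cases "s = 0") auto

text \<open>A connected set can leave a branch only through 0, and off the branch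
  \<open>rad i\<close> is 0, so all smaller radii are met.\<close>

lemma connected_through_0:
  assumes "connected S" "S \<subseteq> triod" "i < 3" "pt i t \<in> S" "y \<in> S" "y \<notin> b i" "0 \<le> s" "s \<le> t"
  shows "pt i s \<in> S"
proof (cases "s = 0")
  case True
  have "0 \<in> S"
  proof (rule ccontr)
    assume 0: "0 \<notin> S"
    have "pt i t \<noteq> 0" using 0 assms(4) by metis
    then have "pt i t \<in> b i"
      using assms norm_le_1[of "pt i t"] by (auto simp: pt_in_b_iff)
    then show False using connected_subset_b[OF assms(1,2) 0 assms(3,4)] assms by blast
  qed
  then show ?thesis using True by simp
next
  case False
  have "rad i y = 0" using rad_not_in_b assms by blast
  then show ?thesis using connected_between[OF assms(1-3) assms(5,4), of s] rad_pt[of i i t] False assms by auto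
qed

lemma connected_segment_pts: "connected {pt i s |s. s \<in> I}" if "is_interval I" for I
proof -
  have "{pt i s |s. s \<in> I} = pt i ` I" by auto
  then show ?thesis
    using that by (auto intro!: connected_continuous_image continuous_intros simp: is_interval_connected)
qed

text \<open>Among nonempty sets that avoid 0, these are the ones whose hull contains the branching
  point (\<open>zero_in_hull_iff\<close>); only then is the hull a union of segments issuing from
  0.\<close>

definition spans :: "complex set \<Rightarrow> bool" where
  "spans P \<longleftrightarrow> P \<subseteq> triod - {0} \<and> P \<noteq> {} \<and> (\<forall>i<3. \<not> P \<subseteq> b i)"

text \<open>The segments from 0 to the points of \<open>P\<close> share 0, so their union is
  connected. Each of them lies in every connected superset of \<open>P\<close>, because some point
  of \<open>P\<close> is off its branch and \<open>connected_through_0\<close> applies.\<close>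

lemma hull_eq:
  assumes "spans P"
  shows "triod_hull P = {pt i s |i s. i < 3 \<and> 0 \<le> s \<and> (\<exists>x\<in>P \<inter> b i. s \<le> norm x)}"
proof
  let ?H = "{pt i s |i s. i < 3 \<and> 0 \<le> s \<and> (\<exists>x\<in>P \<inter> b i. s \<le> norm x)}"
  define F where "F = {{pt i s |s. s \<in> {0..norm x}} |i (x::complex). i < 3 \<and> x \<in> P \<inter> b i}"
  have H: "?H = \<Union> F"
  proof (intro equalityI subsetI)
    fix z assume "z \<in> ?H"
    then obtain i s x where z: "z = pt i s" "i < 3" "0 \<le> s" "x \<in> P \<inter> b i" "s \<le> norm x" by blast
    have "{pt i s |s. s \<in> {0..norm x}} \<in> F" unfolding F_def using z(2,4) by blast
    moreover have "z \<in> {pt i s |s. s \<in> {0..norm x}}" using z by auto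
    ultimately show "z \<in> \<Union> F" by blast
  next
    fix z assume "z \<in> \<Union> F"
    then obtain i and x :: complex where "i < 3" "x \<in> P \<inter> b i" "z \<in> {pt i s |s. s \<in> {0..norm x}}"
      unfolding F_def by blast
    then show "z \<in> ?H" by auto
  qed
  have c: "connected ?H"
    unfolding H
  proof (rule connected_Union)
    have "0 \<in> S" if S: "S \<in> F" for S
    proof -
      obtain i and x :: complex where "S = {pt i s |s. s \<in> {0..norm x}}" using S unfolding F_def by blast
      moreover have "pt i 0 \<in> {pt i s |s. s \<in> {0..norm x}}" by (intro CollectI exI[of _ 0]) simp
      ultimately show ?thesis by simp
    qed
    then show "\<Inter> F \<noteq> {}" by blast
    show "connected S" if "S \<in> F" for S
      using that connected_segment_pts[OF is_interval_cc] unfolding F_def by blast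
  qed
  have sub: "?H \<subseteq> triod"
  proof
    fix z assume "z \<in> ?H"
    then obtain i s x where z: "z = pt i s" "i < 3" "0 \<le> s" "x \<in> b i" "s \<le> norm x" by blast
    then have "norm x \<le> 1" using norm_le_1 b_subset_triod by blast
    then show "z \<in> triod" using z by (auto intro: pt_in_triod)
  qed
  have "P \<subseteq> ?H"
  proof
    fix x assume x: "x \<in> P"
    then obtain i where i: "i < 3" "x \<in> b i" using assms in_some_b unfolding spans_def by blast
    then show "x \<in> ?H" using x pt_norm[OF i] by (auto intro!: exI[of _ i] exI[of _ "norm x"])
  qed
  then show "triod_hull P \<subseteq> ?H"
    unfolding triod_hull_def using c sub by (intro hull_minimal) auto
  show "?H \<subseteq> triod_hull P"
  proof
    fix z assume "z \<in> ?H"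
    then obtain i s x where z: "z = pt i s" "i < 3" "0 \<le> s" "x \<in> P" "x \<in> b i" "s \<le> norm x" by blast
    obtain y where y: "y \<in> P" "y \<notin> b i" using assms z(2) unfolding spans_def by blast
    have "z \<in> S" if "connected S" "S \<subseteq> triod" "P \<subseteq> S" for S
    proof -
      have "pt i (norm x) \<in> S" "y \<in> S" using that(3) z(4) y(1) pt_norm[OF z(2,5)] by auto
      then show ?thesis unfolding z(1) by (rule connected_through_0[OF that(1,2) z(2) _ _ y(2) z(3,6)])
    qed
    then show "z \<in> triod_hull P" unfolding triod_hull_def hull_def by auto
  qed
qed

lemma hull_subset_triod: "spans P \<Longrightarrow> triod_hull P \<subseteq> triod"
  unfolding hull_eq using norm_le_1 b_subset_triod pt_in_triod
  by (smt (verit) Int_iff mem_Collect_eq subset_iff)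

lemma subset_hull: "P \<subseteq> triod_hull P"
  unfolding triod_hull_def by (rule hull_subset)

lemma hull_in_triod: "P \<subseteq> S \<Longrightarrow> connected S \<Longrightarrow> S \<subseteq> triod \<Longrightarrow> triod_hull P \<subseteq> S"
  unfolding triod_hull_def by (intro hull_minimal) auto

lemma zero_in_hull: "spans P \<Longrightarrow> 0 \<in> triod_hull P"
proof -
  assume s: "spans P"
  then obtain x i where x: "x \<in> P" "i < 3" "x \<in> b i"
    using in_some_b unfolding spans_def by (metis Diff_iff all_not_in_conv insertCI subset_iff)
  then have "pt i 0 \<in> triod_hull P"
    unfolding hull_eq[OF s] mem_Collect_eq
    by (intro exI[of _ i] exI[of _ 0]) auto
  then show ?thesis by simp
qed

end

section \<open>Cycles and their equivalence\<close>

lemma periodic_orbit_range: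
  assumes "periodic_orbit f P" "x \<in> P"
  shows "P = range (\<lambda>i. (f ^^ i) x)"
proof -
  note m = periodic_orbit_minimal_period[OF assms]
  have P: "P = (\<lambda>i. (f ^^ i) x) ` {..<card P}" using m(2) by (simp add: bij_betw_def)
  have "card P > 0" using P assms(2) by (cases "card P = 0") auto
  then have "(f ^^ i) x \<in> P" for i
    using m(1) P by (metis (no_types, lifting) funpow_mod_eq image_eqI lessThan_iff mod_less_divisor)
  then show ?thesis using P by blast
qed

lemma periodic_orbit_unique:
  "periodic_orbit f P \<Longrightarrow> periodic_orbit f Q \<Longrightarrow> x \<in> P \<Longrightarrow> x \<in> Q \<Longrightarrow> P = Q"
  using periodic_orbit_range by metis

lemma periodic_orbit_bij:
  assumes "periodic_orbit f P"
  shows "finite P" "P \<noteq> {}" "bij_betw f P P"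
proof -
  obtain x where x: "x \<in> P" using assms unfolding periodic_orbit_def by blast
  note m = periodic_orbit_minimal_period[OF assms]
  note r = periodic_orbit_range[OF assms]
  show fin: "finite P" using bij_betw_finite[OF m(2)[OF x]] by simp
  show "P \<noteq> {}" using x by blast
  have n: "card P > 0" using fin x card_gt_0_iff by blast
  have "f ` P \<subseteq> P"
  proof (rule image_subsetI)
    fix y assume "y \<in> P"
    from r[OF this] show "f y \<in> P" using rangeI[of "\<lambda>i. (f ^^ i) y" 1] by simp
  qed
  moreover have "P \<subseteq> f ` P"
  proof
    fix y assume y: "y \<in> P"
    have "f ((f ^^ (card P - 1)) y) = y"
      using m(1)[OF y] n by (metis Suc_diff_1 comp_apply funpow.simps(2))
    moreover have "(f ^^ (card P - 1)) y \<in> P" using r[OF y] by blast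
    ultimately show "y \<in> f ` P" by (metis imageI)
  qed
  ultimately have "f ` P = P" by blast
  then show "bij_betw f P P"
    using fin by (simp add: bij_betw_def finite_surj_inj)
qed

lemma cyclesD:
  assumes "(f, P) \<in> cycles"
  shows "f \<in> triod_maps" "periodic_orbit f P" "finite P" "P \<noteq> {}" "bij_betw f P P"
    "P \<subseteq> triod - {0}" "\<And>x. x \<in> P \<Longrightarrow> f x \<in> P" "f 0 = 0" "continuous_on triod f" "f ` triod \<subseteq> triod"
    "\<And>x. x \<in> triod \<Longrightarrow> f x = x \<Longrightarrow> x = 0"
proof -
  show tm: "f \<in> triod_maps" and po: "periodic_orbit f P" using assms unfolding cycles_def by auto
  show "finite P" "P \<noteq> {}" and bij: "bij_betw f P P" using periodic_orbit_bij[OF po] by auto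
  show "f x \<in> P" if "x \<in> P" for x using bij that by (simp add: bij_betw_apply)
  show f0: "f 0 = 0" and "continuous_on triod f" and img: "f ` triod \<subseteq> triod"
    and "\<And>x. x \<in> triod \<Longrightarrow> f x = x \<Longrightarrow> x = 0"
    using tm unfolding triod_maps_def by auto
  have "P \<subseteq> triod"
  proof -
    obtain x where x: "x \<in> triod" "P = range (\<lambda>i. (f ^^ i) x)"
      using po unfolding periodic_orbit_def by auto
    have "(f ^^ i) x \<in> triod" for i by (induction i) (use x img in auto)
    then show ?thesis using x by auto
  qed
  moreover have "0 \<notin> P"
  proof
    assume "0 \<in> P"
    then have "P = range (\<lambda>i. (f ^^ i) 0)" using periodic_orbit_range po by blast
    moreover have "(f ^^ i) 0 = 0" for i by (induction i) (use f0 in auto)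
    ultimately have "P = {0}" by auto
    then show False using assms unfolding cycles_def by auto
  qed
  ultimately show "P \<subseteq> triod - {0}" by blast
qed

context numbered_triod
begin

lemma connected_triod: "connected triod"
proof -
  have "triod = (\<Union>i\<in>{..<3}. {pt i s |s. s \<in> {0..1}})"
    unfolding set_eq_iff triod_iff by auto
  moreover have "connected (\<Union>i\<in>{..<3::nat}. {pt i s |s. s \<in> {0..1}})"
  proof (rule connected_Union)
    show "connected S" if "S \<in> (\<lambda>i. {pt i s |s. s \<in> {0..1}}) ` {..<3::nat}" for S
      using that connected_segment_pts[OF is_interval_cc] by blast
    have "pt i 0 \<in> {pt i s |s. s \<in> {0..1}}" for i by (intro CollectI exI[of _ 0]) simp
    then have "0 \<in> \<Inter> ((\<lambda>i. {pt i s |s. s \<in> {0..1}}) ` {..<3::nat})" by simp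
    then show "\<Inter> ((\<lambda>i. {pt i s |s. s \<in> {0..1}}) ` {..<3::nat}) \<noteq> {}" by blast
  qed
  ultimately show ?thesis by simp
qed

lemma triod_hull_subset: "P \<subseteq> triod \<Longrightarrow> triod_hull P \<subseteq> triod"
  using hull_in_triod connected_triod by blast

lemma zero_in_hull_iff:
  assumes "P \<subseteq> triod - {0}" "P \<noteq> {}"
  shows "0 \<in> triod_hull P \<longleftrightarrow> spans P"
proof
  assume z: "0 \<in> triod_hull P"
  have "\<not> P \<subseteq> b i" if "i < 3" for i
    using hull_in_triod[OF _ connected_b[OF that] b_subset_triod[OF that]] z zero_notin_b[OF that] by blast
  then show "spans P" using assms unfolding spans_def by blast
qed (rule zero_in_hull)

text \<open>The relation inside \<open>cycle_equiv\<close> with its witnesses as arguments: every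
  invariant of a pattern is transported along a concrete \<open>h\<close>.\<close>

definition eqv :: "(complex \<Rightarrow> complex) \<Rightarrow> complex set \<Rightarrow> (complex \<Rightarrow> complex) \<Rightarrow> complex set
  \<Rightarrow> (complex \<Rightarrow> complex) \<Rightarrow> (complex \<Rightarrow> complex) \<Rightarrow> bool" where
  "eqv f P g Q h k \<longleftrightarrow> homeomorphism (triod_hull P) (triod_hull Q) h k \<and> h ` P = Q \<and>
     (\<forall>x\<in>P. h (f x) = g (h x)) \<and> (\<forall>i<3. \<forall>x\<in>triod_hull P. x \<in> b i \<longrightarrow> h x \<in> b i)"

lemma cycle_equiv_iff:
  "((f, P), (g, Q)) \<in> cycle_equiv \<longleftrightarrow> (f, P) \<in> cycles \<and> (g, Q) \<in> cycles \<and> (\<exists>h k. eqv f P g Q h k)"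
  unfolding cycle_equiv_def eqv_def branches_eq by (auto simp: image_subset_iff)

lemma eqv_bij: "eqv f P g Q h k \<Longrightarrow> bij_betw h P Q"
  unfolding eqv_def using subset_hull[of P]
  by (meson bij_betw_def bij_betw_subset homeomorphism_def inj_on_subset inj_on_inverseI)

lemma eqv_branch: "eqv f P g Q h k \<Longrightarrow> x \<in> P \<Longrightarrow> i < 3 \<Longrightarrow> x \<in> b i \<Longrightarrow> h x \<in> b i"
  unfolding eqv_def using subset_hull[of P] by blast

lemma eqv_branch_iff:
  "eqv f P g Q h k \<Longrightarrow> P \<subseteq> triod - {0} \<Longrightarrow> x \<in> P \<Longrightarrow> i < 3 \<Longrightarrow> h x \<in> b i \<longleftrightarrow> x \<in> b i"
  using eqv_branch b_disjoint in_some_b by (metis Diff_iff insertCI subset_iff)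

lemma eqv_spans:
  assumes "eqv f P g Q h k" "P \<subseteq> triod - {0}" "Q \<subseteq> triod - {0}"
  shows "spans Q \<longleftrightarrow> spans P"
proof -
  have Q: "Q = h ` P" using assms unfolding eqv_def by auto
  have "Q \<subseteq> b i \<longleftrightarrow> P \<subseteq> b i" if "i < 3" for i
    unfolding Q using eqv_branch_iff[OF assms(1,2) _ that] by auto
  then show ?thesis using assms Q unfolding spans_def by auto
qed

text \<open>If \<open>k 0\<close> lay on a branch, \<open>h\<close> would keep it there, whereas
  \<open>h (k 0) = 0\<close>.\<close>

lemma eqv_0:
  assumes "eqv f P g Q h k" "P \<subseteq> triod - {0}" "Q \<subseteq> triod - {0}" "spans P"
  shows "h 0 = 0" "k 0 = 0"
proof -
  have hom: "homeomorphism (triod_hull P) (triod_hull Q) h k" using assms unfolding eqv_def by auto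
  have 0: "0 \<in> triod_hull P" "0 \<in> triod_hull Q"
    using zero_in_hull assms eqv_spans[OF assms(1-3)] by auto
  have k0: "k 0 \<in> triod_hull P" "h (k 0) = 0" using hom 0 unfolding homeomorphism_def by auto
  have "k 0 \<in> triod" using k0 triod_hull_subset[of P] assms by blast
  then show "k 0 = 0"
    using in_some_b k0 assms(1) zero_notin_b unfolding eqv_def by metis
  then show "h 0 = 0" using k0 by simp
qed

text \<open>The work is in the branch condition, which is required of \<open>h\<close> only. A point
  \<open>y\<close> on a branch must not come from 0: \<open>k y = 0\<close> would make
  \<open>P\<close> spanning, hence \<open>h 0 = 0\<close> and \<open>y = 0\<close>.\<close>

lemma eqv_sym:
  assumes "eqv f P g Q h k" "(f, P) \<in> cycles" "(g, Q) \<in> cycles"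
  shows "eqv g Q f P k h"
proof -
  note P = cyclesD[OF assms(2)] and Q = cyclesD[OF assms(3)]
  have hom: "homeomorphism (triod_hull P) (triod_hull Q) h k" and im: "h ` P = Q"
    and com: "\<forall>x\<in>P. h (f x) = g (h x)" and br: "\<And>i x. i < 3 \<Longrightarrow> x \<in> triod_hull P \<Longrightarrow> x \<in> b i \<Longrightarrow> h x \<in> b i"
    using assms unfolding eqv_def by auto
  have kh: "k (h x) = x" if "x \<in> P" for x
    using hom that subset_hull[of P] unfolding homeomorphism_def by blast
  have kim: "k ` Q = P" using kh im by force
  moreover have "\<forall>x\<in>Q. k (g x) = f (k x)"
    using im com kh P(7) by (metis imageE)
  moreover have "k y \<in> b i" if "i < 3" "y \<in> triod_hull Q" "y \<in> b i" for i y
  proof -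
    have ky: "k y \<in> triod_hull P" "h (k y) = y" using hom that unfolding homeomorphism_def by auto
    then have kt: "k y \<in> triod" using triod_hull_subset[of P] P(6) by blast
    have "k y \<noteq> 0"
    proof
      assume 0: "k y = 0"
      then have "spans P" using zero_in_hull_iff P ky by metis
      then have "h 0 = 0" using eqv_0 assms P Q by blast
      then show False using 0 ky that zero_notin_b by metis
    qed
    then obtain l where l: "l < 3" "k y \<in> b l" using in_some_b kt by blast
    then have "y \<in> b l" using br ky by metis
    then show ?thesis using b_disjoint l that by metis
  qed
  ultimately show ?thesis
    using homeomorphism_symD[OF hom] unfolding eqv_def by blast
qed

lemma eqv_trans:
  assumes "eqv f P g Q h k" "eqv g Q f' R h' k'"
  shows "eqv f P f' R (h' \<circ> h) (k \<circ> k')"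
proof -
  have "homeomorphism (triod_hull P) (triod_hull R) (h' \<circ> h) (k \<circ> k')"
    using assms unfolding eqv_def by (blast intro: homeomorphism_compose)
  moreover have "h x \<in> triod_hull Q" if "x \<in> triod_hull P" for x
    using assms(1) that unfolding eqv_def homeomorphism_def by auto
  moreover have "(h' \<circ> h) ` P = R" using assms unfolding eqv_def by auto
  ultimately show ?thesis using assms unfolding eqv_def by auto
qed

lemma equiv_cycle_equiv: "equiv cycles cycle_equiv"
proof (rule equivI)
  show "cycle_equiv \<subseteq> cycles \<times> cycles" unfolding cycle_equiv_def by auto
  have "eqv f P f P id id" for f P
    unfolding eqv_def using homeomorphism_ident[of "triod_hull P"] by (simp add: id_def)
  then show "refl_on cycles cycle_equiv"
    by (intro refl_onI) (force simp: cycle_equiv_iff)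
  show "sym cycle_equiv"
    unfolding sym_def by (auto simp: cycle_equiv_iff) (meson eqv_sym)
  show "trans cycle_equiv"
    unfolding trans_def by (auto simp: cycle_equiv_iff) (meson eqv_trans)
qed

lemma pattern_class: "(f, P) \<in> cycles \<Longrightarrow> cycle_equiv `` {(f, P)} \<in> patterns"
  unfolding patterns_def by (rule quotientI)

lemma in_own_class: "(f, P) \<in> cycles \<Longrightarrow> (f, P) \<in> cycle_equiv `` {(f, P)}"
  using equiv_cycle_equiv by (rule equiv_class_self)

lemma pattern_cycle: "A \<in> patterns \<Longrightarrow> (f, P) \<in> A \<Longrightarrow> (f, P) \<in> cycles"
  unfolding patterns_def using in_quotient_imp_subset[OF equiv_cycle_equiv] by blast

lemma pattern_equiv:
  "A \<in> patterns \<Longrightarrow> (f, P) \<in> A \<Longrightarrow> (g, Q) \<in> A \<Longrightarrow> ((f, P), (g, Q)) \<in> cycle_equiv"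
  unfolding patterns_def using quotient_eq_iff[OF equiv_cycle_equiv] by blast

lemma pattern_closed:
  "A \<in> patterns \<Longrightarrow> (f, P) \<in> A \<Longrightarrow> ((f, P), (g, Q)) \<in> cycle_equiv \<Longrightarrow> (g, Q) \<in> A"
  unfolding patterns_def using in_quotient_imp_closed[OF equiv_cycle_equiv] by blast

lemma patterns_eq: "A \<in> patterns \<Longrightarrow> B \<in> patterns \<Longrightarrow> (f, P) \<in> A \<Longrightarrow> (f, P) \<in> B \<Longrightarrow> A = B"
  unfolding patterns_def using quotient_disj[OF equiv_cycle_equiv] by blast

section \<open>Invariants of a pattern: rotation number, colours, canonical numbering\<close>

definition rot :: "(complex \<Rightarrow> complex) \<Rightarrow> complex set \<Rightarrow> rat" where
  "rot f P = (\<Sum>y\<in>P. displacement b y (f y)) / of_nat (card P)"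

lemma eqv_displacement:
  assumes "eqv f P g Q h k" "(f, P) \<in> cycles" "x \<in> P"
  shows "displacement b (h x) (g (h x)) = displacement b x (f x)"
proof -
  note P = cyclesD[OF assms(2)]
  obtain i where i: "i < 3" "x \<in> b i" using in_some_b P(6) assms(3) by blast
  have fx: "f x \<in> P" "f x \<in> triod" "f x \<noteq> 0" using P assms(3) by auto
  obtain l where l: "l < 3" "f x \<in> b ((i + l) mod 3)" "displacement b x (f x) = of_nat l / 3"
    using displacement_cases[OF i fx(2,3)] by blast
  have "h x \<in> b i" "h (f x) \<in> b ((i + l) mod 3)"
    using eqv_branch[OF assms(1)] i assms(3) fx l by auto
  moreover have "h (f x) = g (h x)" using assms unfolding eqv_def by blast
  ultimately show ?thesis using displacement_eq i l by metis
qed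

lemma eqv_rot:
  assumes "eqv f P g Q h k" "(f, P) \<in> cycles"
  shows "rot g Q = rot f P"
proof -
  have "(\<Sum>y\<in>P. displacement b y (f y)) = (\<Sum>y\<in>P. displacement b (h y) (g (h y)))"
    using eqv_displacement[OF assms] by simp
  also have "\<dots> = (\<Sum>y\<in>Q. displacement b y (g y))"
    by (rule sum.reindex_bij_betw[OF eqv_bij[OF assms(1)], of "\<lambda>y. displacement b y (g y)"])
  finally show ?thesis using bij_betw_same_card[OF eqv_bij[OF assms(1)]] unfolding rot_def by simp
qed

text \<open>Equivalences preserve displacements and the sum over the orbit has no base point, so any
  single representative computes the rotation number.\<close>

lemma has_rotation_number_iff:
  assumes "A \<in> patterns" "(f, P) \<in> A"
  shows "has_rotation_number b A r \<longleftrightarrow> r = rot f P"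
proof -
  have eq: "fst (rotation_pair b g Q x) / of_nat (snd (rotation_pair b g Q x)) = rot f P"
    if "(g, Q) \<in> A" "x \<in> Q" for g Q x
  proof -
    have "(g, Q) \<in> cycles" using pattern_cycle assms(1) that by blast
    then have "periodic_orbit g Q" by (rule cyclesD)
    moreover have "rot g Q = rot f P"
      using pattern_equiv[OF assms that(1)] eqv_rot unfolding cycle_equiv_iff by metis
    ultimately show ?thesis using rotation_pair_eq_sum that unfolding rot_def by simp
  qed
  obtain x where "x \<in> P" using cyclesD(4) pattern_cycle[OF assms] by blast
  then have "\<exists>x\<in>P. rot f P = fst (rotation_pair b f P x) / of_nat (snd (rotation_pair b f P x))"
    using eq[OF assms(2)] by metis
  then have "\<exists>(g, Q)\<in>A. \<exists>x\<in>Q. rot f P = fst (rotation_pair b g Q x) / of_nat (snd (rotation_pair b g Q x))"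
    using assms(2) by blast
  moreover have "r = rot f P" if "has_rotation_number b A r"
    using that eq unfolding has_rotation_number_def by auto
  moreover have "has_rotation_number b A (rot f P)"
    unfolding has_rotation_number_def by fact
  ultimately show ?thesis by blast
qed

lemma black_iff:
  assumes "(f, P) \<in> cycles" "x \<in> P" "i < 3" "x \<in> b i"
  shows "black b f x \<longleftrightarrow> f x \<in> b ((i + 1) mod 3)"
proof -
  note P = cyclesD[OF assms(1)]
  have fx: "f x \<in> triod" "f x \<noteq> 0" using P assms(2) by auto
  obtain l where l: "l < 3" "f x \<in> b ((i + l) mod 3)" "displacement b x (f x) = of_nat l / 3"
    using displacement_cases[OF assms(3,4) fx] by blast
  have "black b f x \<longleftrightarrow> l = 1"
    unfolding black_def l(3) by auto
  also have "\<dots> \<longleftrightarrow> f x \<in> b ((i + 1) mod 3)"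
    using l b_disjoint[of "(i + l) mod 3" "(i + 1) mod 3" "f x"] mod_3_add_cancel[of 1 l i] by auto
  finally show ?thesis .
qed

lemma eqv_black:
  "eqv f P g Q h k \<Longrightarrow> (f, P) \<in> cycles \<Longrightarrow> x \<in> P \<Longrightarrow> black b g (h x) \<longleftrightarrow> black b f x"
  unfolding black_def by (simp add: eqv_displacement)

lemma canonical_spans:
  assumes "(f, P) \<in> cycles" "canonical_for_cycle b f P"
  shows "spans P"
proof -
  have "\<exists>x\<in>P. x \<in> b i" if "i < 3" for i using assms that unfolding canonical_for_cycle_def by blast
  then obtain x y where "x \<in> P" "x \<in> b 0" "y \<in> P" "y \<in> b 1" by (metis one_less_numeral_iff semiring_norm(77) zero_less_numeral)
  then have "\<not> P \<subseteq> b i" if "i < 3" for i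
    using that b_disjoint[of i 0 x] b_disjoint[of i 1 y] by auto
  then show ?thesis using cyclesD[OF assms(1)] unfolding spans_def by blast
qed

lemma hull_radius:
  assumes "spans P" "x \<in> P" "i < 3" "x \<in> b i" "0 \<le> s" "s \<le> norm x"
  shows "pt i s \<in> triod_hull P"
  unfolding hull_eq[OF assms(1)] using assms by blast

text \<open>Since \<open>h\<close> fixes 0, the image of the segment from 0 to the closest point
  \<open>x\<close> is connected and contains 0 and \<open>h x\<close>, hence every point of
  \<open>b i\<close> nearer than \<open>h x\<close>. A point of \<open>Q\<close> nearer than
  \<open>h x\<close> thus comes from a point of \<open>P\<close> on that segment, which can only be
  \<open>x\<close>.\<close>

lemma eqv_canonical:
  assumes "eqv f P g Q h k" "(f, P) \<in> cycles" "(g, Q) \<in> cycles" "canonical_for_cycle b f P"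
  shows "canonical_for_cycle b g Q"
  unfolding canonical_for_cycle_def
proof (intro allI impI)
  fix i :: nat assume i: "i < 3"
  note P = cyclesD[OF assms(2)] and Q = cyclesD[OF assms(3)]
  have sp: "spans P" using canonical_spans assms by blast
  have hom: "homeomorphism (triod_hull P) (triod_hull Q) h k" and im: "h ` P = Q"
    using assms unfolding eqv_def by auto
  obtain x where x: "x \<in> P" "x \<in> b i" "black b f x" "\<And>y. y \<in> P \<Longrightarrow> y \<in> b i \<Longrightarrow> norm x \<le> norm y"
    using assms(4) i unfolding canonical_for_cycle_def by blast
  have hx: "h x \<in> Q" "h x \<in> b i" "black b g (h x)"
    using im x eqv_branch[OF assms(1)] eqv_black[OF assms(1,2)] i by auto
  moreover have "norm (h x) \<le> norm y" if y: "y \<in> Q \<inter> b i" for y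
  proof (rule ccontr)
    assume less: "\<not> norm (h x) \<le> norm y"
    obtain z where z: "z \<in> P" "y = h z" using im y by blast
    have zb: "z \<in> b i" using eqv_branch_iff[OF assms(1) P(6) z(1) i] z y by blast
    let ?S = "{pt i s |s. s \<in> {0..norm x}}"
    have S: "?S \<subseteq> triod_hull P" using hull_radius[OF sp x(1) i x(2)] by auto
    have "connected (h ` ?S)"
      using hom S unfolding homeomorphism_def
      by (intro connected_continuous_image connected_segment_pts is_interval_cc)
        (auto intro: continuous_on_subset)
    moreover have "h ` ?S \<subseteq> triod"
      using hom S triod_hull_subset[of Q] Q(6) unfolding homeomorphism_def by blast
    moreover have "0 \<in> ?S" by (intro CollectI exI[of _ 0]) simp
    then have "pt i 0 \<in> h ` ?S" using eqv_0(1)[OF assms(1) P(6) Q(6) sp] by (simp add: rev_image_eqI)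
    moreover have "x \<in> ?S" using pt_norm[OF i x(2)] by (intro CollectI exI[of _ "norm x"]) simp
    then have "pt i (norm (h x)) \<in> h ` ?S" using pt_norm[OF i hx(2)] by simp
    ultimately have "pt i (norm y) \<in> h ` ?S"
      using less by (intro connected_radii[of "h ` ?S" i 0 "norm (h x)" "norm y"]) (auto simp: i)
    then have "h z \<in> h ` ?S" using pt_norm[OF i, of y] y z by simp
    moreover have "inj_on h (triod_hull P)" using hom unfolding homeomorphism_def by (metis inj_on_inverseI)
    ultimately have "z \<in> ?S" using S z(1) subset_hull[of P] by (meson inj_on_image_mem_iff subsetD)
    then have "norm z \<le> norm x" using i by auto
    then have "norm z = norm x" using x(4)[OF z(1) zb] by simp
    then have "z = x" using pt_norm[OF i] x(2) zb by metis
    then show False using less z by simp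
  qed
  ultimately show "\<exists>x\<in>Q \<inter> b i. (\<forall>y\<in>Q \<inter> b i. norm x \<le> norm y) \<and> black b g x" by blast
qed

lemma pattern_canonical:
  assumes "A \<in> patterns" "canonical_for b A" "(f, P) \<in> A"
  shows "canonical_for_cycle b f P"
proof -
  obtain g Q where "(g, Q) \<in> A" "canonical_for_cycle b g Q" using assms unfolding canonical_for_def by blast
  then show ?thesis using pattern_equiv[OF assms(1) _ assms(3)] eqv_canonical unfolding cycle_equiv_iff by blast
qed

lemma pattern_primitive:
  assumes "A \<in> patterns" "primitive_pattern_of_period n A" "(f, P) \<in> A"
  shows "primitive_cycle P \<and> card P = n"
proof -
  obtain g Q where g: "(g, Q) \<in> A" "primitive_cycle Q" "card Q = n"
    using assms unfolding primitive_pattern_of_period_def by blast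
  obtain h k where h: "eqv f P g Q h k" and f: "(f, P) \<in> cycles"
    using pattern_equiv[OF assms(1,3) g(1)] unfolding cycle_equiv_iff by blast
  note bij = eqv_bij[OF h]
  have "primitive_cycle P"
    unfolding primitive_cycle_def
  proof (intro ballI impI notI)
    fix x y assume xy: "x \<in> P" "y \<in> P" "x \<noteq> y" "same_branch x y"
    then have "same_branch (h x) (h y)" using eqv_branch[OF h] unfolding same_branch_iff by blast
    moreover have "h x \<in> Q" "h y \<in> Q" "h x \<noteq> h y" using bij xy unfolding bij_betw_def inj_on_def by auto
    ultimately show False using g(2) unfolding primitive_cycle_def by blast
  qed
  then show ?thesis using bij_betw_same_card[OF bij] g(3) by simp
qed

lemma pattern_black:
  assumes "A \<in> patterns" "(f, P) \<in> A" "(g, Q) \<in> A" "i < 3" "\<forall>x\<in>P \<inter> b i. black b f x"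
  shows "\<forall>x\<in>Q \<inter> b i. black b g x"
proof -
  obtain h k where h: "eqv f P g Q h k" and f: "(f, P) \<in> cycles"
    using pattern_equiv[OF assms(1,2,3)] unfolding cycle_equiv_iff by blast
  show ?thesis
  proof
    fix y assume y: "y \<in> Q \<inter> b i"
    then obtain x where x: "x \<in> P" "y = h x" using h unfolding eqv_def by blast
    then have "x \<in> b i" using eqv_branch_iff[OF h cyclesD(6)[OF f] x(1) assms(4)] y by blast
    then show "black b g y" using x assms(5) eqv_black[OF h f x(1)] by blast
  qed
qed

end

section \<open>Laps\<close>

definition mono_sets :: "(complex \<Rightarrow> complex) \<Rightarrow> complex set set" where
  "mono_sets g = {U. openin (top_of_set triod) U \<and> connected U \<and> connected_fibres_on g U}"

lemma laps_eq: "laps g = {U \<in> mono_sets g. \<forall>V\<in>mono_sets g. U \<subseteq> V \<longrightarrow> U = V}"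
  unfolding laps_def mono_sets_def by (simp add: Let_def)

lemma mono_sets_subset: "U \<in> mono_sets g \<Longrightarrow> U \<subseteq> triod"
  unfolding mono_sets_def using openin_imp_subset by blast

lemma mono_sets_connected: "U \<in> mono_sets g \<Longrightarrow> connected U"
  unfolding mono_sets_def by blast

lemma mono_sets_fibre: "U \<in> mono_sets g \<Longrightarrow> v \<in> g ` U \<Longrightarrow> connected (g -` {v} \<inter> U)"
  unfolding mono_sets_def connected_fibres_on_def by blast

text \<open>Zorn's lemma. In a chain, fix a member that attains a given value at \<open>y\<close>;
  the fibre in the union is the union of the fibres in the larger members, all of which contain
  \<open>y\<close>, so it is connected.\<close>

lemma lap_above:
  assumes "U \<in> mono_sets g" "x \<in> U"
  obtains L where "L \<in> laps g" "U \<subseteq> L"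
proof -
  define \<A> where "\<A> = {V \<in> mono_sets g. U \<subseteq> V}"
  have "\<exists>M\<in>\<A>. \<forall>V\<in>\<A>. M \<subseteq> V \<longrightarrow> V = M"
  proof (rule subset_Zorn_nonempty)
    show "\<A> \<noteq> {}" using assms unfolding \<A>_def by blast
    fix \<C> assume ne: "\<C> \<noteq> {}" and ch: "subset.chain \<A> \<C>"
    then have sub: "\<C> \<subseteq> mono_sets g" "\<And>V. V \<in> \<C> \<Longrightarrow> U \<subseteq> V"
      and lin: "\<And>V W. V \<in> \<C> \<Longrightarrow> W \<in> \<C> \<Longrightarrow> V \<subseteq> W \<or> W \<subseteq> V"
      unfolding \<A>_def subset_chain_def by auto
    have "openin (top_of_set triod) (\<Union>\<C>)"
      using sub by (intro openin_Union) (auto simp: mono_sets_def)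
    moreover have "connected (\<Union>\<C>)"
    proof (rule connected_Union)
      show "connected S" if "S \<in> \<C>" for S using sub that mono_sets_connected by blast
      have "x \<in> \<Inter>\<C>" using sub assms(2) by blast
      then show "\<Inter>\<C> \<noteq> {}" by blast
    qed
    moreover have "connected_fibres_on g (\<Union>\<C>)"
      unfolding connected_fibres_on_def
    proof
      fix v assume "v \<in> g ` \<Union>\<C>"
      then obtain y V where y: "y \<in> V" "V \<in> \<C>" "g y = v" by blast
      define F where "F = {g -` {v} \<inter> W |W. W \<in> \<C> \<and> V \<subseteq> W}"
      have "g -` {v} \<inter> \<Union>\<C> = \<Union>F"
      proof (intro equalityI subsetI)
        fix z assume z: "z \<in> g -` {v} \<inter> \<Union>\<C>"
        then obtain W where W: "W \<in> \<C>" "z \<in> W" by blast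
        then have "V \<union> W \<in> \<C>" using lin[OF y(2) W(1)] y(2) by (auto simp: Un_absorb1 Un_absorb2)
        then have "g -` {v} \<inter> (V \<union> W) \<in> F" unfolding F_def by blast
        then show "z \<in> \<Union>F" using z W(2) by blast
      qed (auto simp: F_def)
      moreover have "connected (\<Union>F)"
      proof (rule connected_Union)
        show "connected S" if S: "S \<in> F" for S
        proof -
          obtain W where W: "S = g -` {v} \<inter> W" "W \<in> \<C>" "V \<subseteq> W" using S unfolding F_def by blast
          then have "v \<in> g ` W" using y by blast
          then show ?thesis using W sub(1) mono_sets_fibre by blast
        qed
        have "y \<in> \<Inter>F" unfolding F_def using y by blast
        then show "\<Inter>F \<noteq> {}" by blast
      qed
      ultimately show "connected (g -` {v} \<inter> \<Union>\<C>)" by simp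
    qed
    ultimately show "\<Union>\<C> \<in> \<A>" using sub ne unfolding \<A>_def mono_sets_def by blast
  qed
  then obtain M where M: "M \<in> \<A>" "\<And>V. V \<in> \<A> \<Longrightarrow> M \<subseteq> V \<Longrightarrow> V = M" by blast
  then have "M \<in> laps g" "U \<subseteq> M" unfolding laps_eq \<A>_def by auto
  then show ?thesis using that by blast
qed

text \<open>Each \<open>c\<close> lies in some lap, and laps are connected and avoid
  \<open>u\<close> and \<open>v\<close>, so no lap contains two of the three. The separation
  hypotheses allow \<open>u\<close> and \<open>v\<close> to be peaks on one branch or on
  two.\<close>

lemma three_laps:
  assumes "finite (laps g)" "card (laps g) \<le> 2"
    and "u \<notin> \<Union>(mono_sets g)" "v \<notin> \<Union>(mono_sets g)"
    and "c1 \<in> \<Union>(mono_sets g)" "c2 \<in> \<Union>(mono_sets g)" "c3 \<in> \<Union>(mono_sets g)"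
    and sep12: "\<And>S. connected S \<Longrightarrow> S \<subseteq> triod \<Longrightarrow> c1 \<in> S \<Longrightarrow> c2 \<in> S \<Longrightarrow> u \<in> S \<or> v \<in> S"
    and sep13: "\<And>S. connected S \<Longrightarrow> S \<subseteq> triod \<Longrightarrow> c1 \<in> S \<Longrightarrow> c3 \<in> S \<Longrightarrow> u \<in> S \<or> v \<in> S"
    and sep23: "\<And>S. connected S \<Longrightarrow> S \<subseteq> triod \<Longrightarrow> c2 \<in> S \<Longrightarrow> c3 \<in> S \<Longrightarrow> u \<in> S \<or> v \<in> S"
  shows False
proof -
  have ex: "\<exists>L\<in>laps g. c \<in> L" if "c \<in> \<Union>(mono_sets g)" for c
    using that lap_above by (metis UnionE subsetD)
  obtain L1 L2 L3 where L: "L1 \<in> laps g" "c1 \<in> L1" "L2 \<in> laps g" "c2 \<in> L2" "L3 \<in> laps g" "c3 \<in> L3"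
    using ex assms(5-7) by meson
  have no: "connected L" "L \<subseteq> triod" "u \<notin> L" "v \<notin> L" if "L \<in> laps g" for L
  proof -
    have L: "L \<in> mono_sets g" using that by (simp add: laps_eq)
    show "connected L" "L \<subseteq> triod" using L by (rule mono_sets_connected, rule mono_sets_subset)
    show "u \<notin> L" "v \<notin> L" using L assms(3,4) by auto
  qed
  have "L1 \<noteq> L2" using no[OF L(1)] sep12[of L1] L(2,4) by auto
  moreover have "L1 \<noteq> L3" using no[OF L(1)] sep13[of L1] L(2,6) by auto
  moreover have "L2 \<noteq> L3" using no[OF L(3)] sep23[of L2] L(4,6) by auto
  ultimately have "card {L1, L2, L3} = 3" by simp
  moreover have "card {L1, L2, L3} \<le> card (laps g)" using assms(1) L by (intro card_mono) auto
  ultimately show False using assms(2) by simp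
qed

lemma affine_on_segmentD:
  assumes "affine_on_segment g C" "x \<in> C" "y \<in> C" "0 \<le> t" "t \<le> 1"
  shows "triod_dist (g x) (g ((1 - t) *\<^sub>R x + t *\<^sub>R y)) = t * triod_dist (g x) (g y)"
    and "triod_dist (g ((1 - t) *\<^sub>R x + t *\<^sub>R y)) (g y) = (1 - t) * triod_dist (g x) (g y)"
  using assms(1)[unfolded affine_on_segment_def, rule_format, OF assms(2,3), of t] assms(4,5) by auto

context numbered_triod
begin

text \<open>A level slightly below the peak is attained on both sides of it. If the fibre over that
  level were connected, it would contain the peak, which has a higher level.\<close>

lemma peak_not_in_mono_set:
  assumes g: "continuous_on triod g" "g ` triod \<subseteq> triod" and ik: "i < 3" "k < 3"
    and w: "0 < w" "w < 1" and U: "U \<in> mono_sets g" "pt i w \<in> U"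
    and left: "\<And>\<epsilon>. \<epsilon> > 0 \<Longrightarrow> \<exists>u. w - \<epsilon> < u \<and> u < w \<and> rad k (g (pt i u)) < rad k (g (pt i w))"
    and right: "\<And>\<epsilon>. \<epsilon> > 0 \<Longrightarrow> \<exists>u. w < u \<and> u < w + \<epsilon> \<and> rad k (g (pt i u)) < rad k (g (pt i w))"
  shows False
proof -
  define \<rho> where "\<rho> s = rad k (g (pt i s))" for s
  have cont: "continuous_on {0..1} \<rho>"
    unfolding \<rho>_def
    by (intro continuous_rad continuous_on_compose2[OF g(1)] continuous_intros)
       (auto intro: pt_in_triod ik)
  obtain T where T: "open T" "U = triod \<inter> T"
    using U unfolding mono_sets_def openin_open by auto
  then obtain \<epsilon> where \<epsilon>: "\<epsilon> > 0" "\<And>z. dist z (pt i w) < \<epsilon> \<Longrightarrow> z \<in> T"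
    using U(2) unfolding open_dist by blast
  have inU: "pt i s \<in> U" if "0 \<le> s" "s \<le> 1" "\<bar>s - w\<bar> < \<epsilon>" for s
  proof -
    have "dist (pt i s) (pt i w) = \<bar>s - w\<bar>"
      using norm_e[OF ik(1)] by (simp add: dist_norm pt_def flip: scaleR_diff_left)
    then show ?thesis using T \<epsilon> that pt_in_triod ik by auto
  qed
  define \<delta> where "\<delta> = min \<epsilon> (min w (1 - w))"
  have \<delta>: "\<delta> > 0" "\<delta> \<le> \<epsilon>" "\<delta> \<le> w" "\<delta> \<le> 1 - w" using \<epsilon> w unfolding \<delta>_def by auto
  obtain u where u: "w - \<delta> < u" "u < w" "\<rho> u < \<rho> w" using left[OF \<delta>(1)] unfolding \<rho>_def by blast
  obtain u' where u': "w < u'" "u' < w + \<delta>" "\<rho> u' < \<rho> w" using right[OF \<delta>(1)] unfolding \<rho>_def by blast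
  \<comment> \<open>Above both side values and below the peak value; as it is also positive,
    \<open>rad k = m\<close> pins the image down to \<open>pt k m\<close>.\<close>
  define m where "m = (max (\<rho> u) (\<rho> u') + \<rho> w) / 2"
  have m: "\<rho> u < m" "\<rho> u' < m" "m < \<rho> w" using u u' unfolding m_def by auto
  have "0 \<le> \<rho> u" unfolding \<rho>_def by simp
  then have m0: "0 < m" using m by linarith
  have "continuous_on {u..w} \<rho>" "continuous_on {w..u'} \<rho>"
    using u u' \<delta> w by (auto intro!: continuous_on_subset[OF cont])
  then obtain a a' where a: "u \<le> a" "a \<le> w" "\<rho> a = m" and a': "w \<le> a'" "a' \<le> u'" "\<rho> a' = m"
    using IVT'[of \<rho> u m w] IVT2'[of \<rho> u' m w] u u' m by (metis less_imp_le)
  have aU: "pt i a \<in> U" "pt i a' \<in> U" using a a' u u' \<delta> w by (auto intro!: inU)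
  have "g (pt i a) \<in> triod" "g (pt i a') \<in> triod" using aU g(2) mono_sets_subset[OF U(1)] by blast+
  then have "g (pt i a) = pt k m" "g (pt i a') = pt k m"
    using eq_pt_of_rad[OF ik(2) _ _ m0] a(3) a'(3) unfolding \<rho>_def by blast+
  then have F: "pt i a \<in> g -` {pt k m} \<inter> U" "pt i a' \<in> g -` {pt k m} \<inter> U" using aU by auto
  then have "pt k m \<in> g ` U" by force
  then have "connected (g -` {pt k m} \<inter> U)" using mono_sets_fibre U by blast
  then have "pt i w \<in> g -` {pt k m} \<inter> U"
    using F mono_sets_subset[OF U(1)] a a' u \<delta> ik by (intro connected_radii[of _ i a a' w]) auto
  then have "\<rho> w = m" unfolding \<rho>_def using rad_pt ik m0 by simp
  then show False using m by simp
qed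

text \<open>If two points of the segment have the same image, the constant speed between them is 0,
  so the fibre is even convex.\<close>

lemma affine_fibre_connected:
  assumes "affine_on_segment g {pt i s |s. s \<in> {l<..<r}}" "g ` triod \<subseteq> triod" "i < 3" "0 \<le> l" "r \<le> 1"
  shows "connected (g -` {v} \<inter> {pt i s |s. s \<in> {l<..<r}})"
proof -
  have "convex (g -` {v} \<inter> {pt i s |s. s \<in> {l<..<r}})"
    unfolding convex_alt
  proof (intro ballI allI impI)
    fix x y and t :: real
    assume x: "x \<in> g -` {v} \<inter> {pt i s |s. s \<in> {l<..<r}}"
      and y: "y \<in> g -` {v} \<inter> {pt i s |s. s \<in> {l<..<r}}" and t: "0 \<le> t \<and> t \<le> 1"
    obtain s s' where s: "x = pt i s" "s \<in> {l<..<r}" "y = pt i s'" "s' \<in> {l<..<r}" using x y by blast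
    let ?z = "(1 - t) *\<^sub>R x + t *\<^sub>R y"
    have z: "?z = pt i ((1 - t) * s + t * s')" unfolding s pt_def by (simp add: scaleR_add_left)
    have "convex {l<..<r}" by simp
    then have mem: "(1 - t) * s + t * s' \<in> {l<..<r}"
      using s t unfolding convex_alt by (metis real_scaleR_def)
    have "triod_dist (g x) (g ?z) = t * triod_dist (g x) (g y)"
      using affine_on_segmentD(1)[OF assms(1)] x y t by blast
    moreover have tri: "x \<in> triod" "?z \<in> triod"
      unfolding z using s mem assms by (auto intro!: pt_in_triod)
    moreover have "g x = v" "g y = v" using x y by auto
    ultimately have "triod_dist (g x) (g ?z) = 0" using triod_dist_refl[of "g x"] assms(2) by auto
    moreover have "g x \<in> triod" "g ?z \<in> triod" using tri assms(2) by (auto simp only: image_subset_iff)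
    ultimately have "g ?z = v" using triod_dist_eq_0 \<open>g x = v\<close> by metis
    then show "?z \<in> g -` {v} \<inter> {pt i s |s. s \<in> {l<..<r}}" using z mem by auto
  qed
  then show ?thesis by (rule convex_connected)
qed

end

section \<open>Linear maps of spanning cycles\<close>

locale spanning_linear_map = numbered_triod +
  fixes f :: "complex \<Rightarrow> complex" and P :: "complex set" and g :: "complex \<Rightarrow> complex"
  assumes cycle: "(f, P) \<in> cycles" and spans: "spans P" and linear: "is_linear_map_of f P g"
begin

lemmas P = cyclesD[OF cycle]

lemma g: "continuous_on triod g" "g ` triod \<subseteq> triod" "\<And>x. x \<in> P \<Longrightarrow> g x = f x" "g 0 = 0"
  using linear unfolding is_linear_map_of_def by auto

lemma affine_mono: "affine_on_segment g C \<Longrightarrow> D \<subseteq> C \<Longrightarrow> affine_on_segment g D"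
  unfolding affine_on_segment_def by blast

lemma affine_gap:
  assumes "i < 3" "x \<in> P" "x \<in> b i" "0 \<le> l" "l < r" "r \<le> norm x"
    and gap: "\<And>s. l < s \<Longrightarrow> s < r \<Longrightarrow> pt i s \<notin> P"
  shows "affine_on_segment g {pt i s |s. s \<in> {l<..<r}}"
proof -
  let ?J = "{pt i s |s. s \<in> {l<..<r}}"
  have J: "connected ?J" by (rule connected_segment_pts) (rule is_interval_oo)
  have "?J \<subseteq> triod_hull P - (P \<union> {0})"
    using assms hull_radius[OF spans assms(2,1,3)] by auto
  moreover have "pt i ((l + r) / 2) \<in> ?J" using assms by force
  ultimately obtain C where "C \<in> components (triod_hull P - (P \<union> {0}))" "?J \<subseteq> C"
    using exists_component_superset[OF _ _ J] by blast
  then show ?thesis using linear affine_mono unfolding is_linear_map_of_def by blast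
qed

text \<open>The speed on the gap is constant, so one pair of distinct points with a common image
  forces speed 0. In each case \<open>t\<close> expresses the vanishing distance between the images
  of the pair as a positive multiple of a distance that involves \<open>s\<close>.\<close>

lemma const_gap:
  assumes "affine_on_segment g {pt i s |s. s \<in> {l<..<r}}" "i < 3" "0 \<le> l" "r \<le> 1"
    and a: "l < a" "a < a'" "a' < r" "g (pt i a) = g (pt i a')" and s: "l < s" "s < r"
  shows "g (pt i s) = g (pt i a)"
proof -
  have aff: "triod_dist (g (pt i x)) (g (pt i z)) = t * triod_dist (g (pt i x)) (g (pt i y))"
    "triod_dist (g (pt i z)) (g (pt i y)) = (1 - t) * triod_dist (g (pt i x)) (g (pt i y))"
    if "l < x" "y < r" "x < y" "x \<le> z" "z \<le> y" and t: "t = (z - x) / (y - x)" for x y z t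
  proof -
    have mem: "pt i x \<in> {pt i s |s. s \<in> {l<..<r}}" "pt i y \<in> {pt i s |s. s \<in> {l<..<r}}" "0 \<le> t" "t \<le> 1"
      using that by auto
    moreover have "(1 - t) *\<^sub>R pt i x + t *\<^sub>R pt i y = pt i z"
    proof -
      have "t * (y - x) = z - x" using that by simp
      then have "(1 - t) * x + t * y = z" by (simp add: algebra_simps)
      then show ?thesis unfolding pt_def by (metis scaleR_add_left scaleR_scaleR)
    qed
    ultimately show "triod_dist (g (pt i x)) (g (pt i z)) = t * triod_dist (g (pt i x)) (g (pt i y))"
      "triod_dist (g (pt i z)) (g (pt i y)) = (1 - t) * triod_dist (g (pt i x)) (g (pt i y))"
      using affine_on_segmentD[OF assms(1) mem] by simp_all
  qed
  have tri: "g (pt i x) \<in> triod" if "l < x" "x < r" for x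
    using that assms g(2) by (meson image_subset_iff less_imp_le order_trans pt_in_triod)
  have D0: "triod_dist (g (pt i a)) (g (pt i a')) = 0" using triod_dist_refl tri a by auto
  consider "s < a" | "s = a" | "a < s" "s \<le> a'" | "a' < s" by linarith
  then show ?thesis
  proof cases
    case 1
    define t where "t = (a - s) / (a' - s)"
    have "t < 1" using 1 a unfolding t_def by simp
    moreover have "(1 - t) * triod_dist (g (pt i s)) (g (pt i a')) = 0"
      using aff(2)[of s a' a t] 1 a s D0 t_def by auto
    ultimately have "triod_dist (g (pt i s)) (g (pt i a')) = 0" by simp
    then show ?thesis using triod_dist_eq_0 tri a s by auto
  next
    case 3
    have "triod_dist (g (pt i a)) (g (pt i s)) = 0"
      using aff(1)[of a a' s] 3 a s D0 by auto
    then show ?thesis using triod_dist_eq_0 tri a s by fastforce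
  next
    case 4
    define t where "t = (a' - a) / (s - a)"
    have "t > 0" using 4 a unfolding t_def by simp
    moreover have "t * triod_dist (g (pt i a)) (g (pt i s)) = 0"
      using aff(1)[of a s a' t] 4 a s D0 t_def by auto
    ultimately have "triod_dist (g (pt i a)) (g (pt i s)) = 0" by simp
    then show ?thesis using triod_dist_eq_0 tri a s by fastforce
  qed simp
qed

text \<open>\<open>f\<close> is injective on \<open>P\<close> and omits 0 there, so consecutive
  points of \<open>P\<close> and 0 along a branch have distinct images. A linear map constant on
  part of a gap would be constant on all of it and, by continuity, equal at its two ends.\<close>

lemma no_plateau:
  assumes "i < 3" "x \<in> P" "x \<in> b i" "0 \<le> l" "l < r" "r \<le> norm x"
  obtains s s' where "l < s" "s < r" "l < s'" "s' < r" "g (pt i s) \<noteq> g (pt i s')"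
proof (rule ccontr)
  assume contra: "\<not> thesis"
  note witness = that
  have const: "g (pt i s) = g (pt i s')" if "l < s" "s < r" "l < s'" "s' < r" for s s'
    using contra witness[OF that] by blast
  have xle: "norm x \<le> 1" using P(6) assms(2) norm_le_1 by blast
  define X where "X = insert 0 (norm ` (P \<inter> b i))"
  have Xfin: "finite X" unfolding X_def using P(3) by simp
  have X_iff: "s \<in> X \<longleftrightarrow> pt i s \<in> insert 0 P" if s: "0 \<le> s" "s \<le> 1" for s
  proof
    assume "s \<in> X"
    then show "pt i s \<in> insert 0 P" unfolding X_def using pt_norm[OF assms(1)] by auto
  next
    assume sP: "pt i s \<in> insert 0 P"
    show "s \<in> X"
    proof (cases "s = 0")
      case False
      have "0 < s" using False s(1) by simp
      then have "pt i s \<in> b i" using pt_in_b_iff[OF assms(1) assms(1) s(1)] s(2) by simp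
      moreover have "pt i s \<noteq> 0" using False assms(1) by simp
      then have "pt i s \<in> P" using sP by simp
      moreover have "norm (pt i s) = s" using s(1) assms(1) by simp
      ultimately have "s \<in> norm ` (P \<inter> b i)" by (intro image_eqI[of _ _ "pt i s"]) simp_all
      then show ?thesis unfolding X_def by simp
    qed (simp add: X_def)
  qed
  have "infinite {l<..<r}" using assms by simp
  then obtain s0 where s0: "l < s0" "s0 < r" "s0 \<notin> X"
    using Xfin by (metis finite_subset greaterThanLessThan_iff subsetI)
  \<comment> \<open>\<open>p\<close> and \<open>p'\<close> are the neighbours of \<open>s0\<close>
    in \<open>X\<close>, that is, the ends of the gap that contains \<open>s0\<close>.\<close>
  define p where "p = Max {s \<in> X. s < s0}"
  define p' where "p' = Min {s \<in> X. s > s0}"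
  have pne: "{s \<in> X. s < s0} \<noteq> {}" "finite {s \<in> X. s < s0}" using Xfin s0 assms X_def by auto
  have xX: "norm x \<in> {s \<in> X. s > s0}" using assms s0 unfolding X_def by auto
  then have p'ne: "{s \<in> X. s > s0} \<noteq> {}" "finite {s \<in> X. s > s0}" using Xfin by auto
  have p: "p \<in> X" "p < s0" using Max_in[OF pne(2,1)] unfolding p_def by auto
  have p': "p' \<in> X" "s0 < p'" using Min_in[OF p'ne(2,1)] unfolding p'_def by auto
  have p'le: "p' \<le> norm x" unfolding p'_def using p'ne xX by (intro Min_le) auto
  have p0: "0 \<le> p" using p(1) unfolding X_def by auto
  have "s \<le> p \<or> p' \<le> s" if "s \<in> X" for s
  proof (cases "s < s0")
    case True
    then show ?thesis unfolding p_def using that pne by (intro disjI1 Max_ge) auto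
  next
    case False
    then have "s > s0" using that s0 by (metis linorder_neqE)
    then show ?thesis unfolding p'_def using that p'ne by (intro disjI2 Min_le) auto
  qed
  then have gap: "pt i s \<notin> P" if "p < s" "s < p'" for s
    using X_iff[of s] that p0 p'le xle by force
  have aff: "affine_on_segment g {pt i s |s. s \<in> {p<..<p'}}"
    using gap p p' p0 p'le by (intro affine_gap[OF assms(1-3)]) auto
  define a a' where "a = max l p / 2 + s0 / 2" and "a' = min r p' / 2 + s0 / 2"
  have a: "p < a" "l < a" "a < s0" "s0 < a'" "a' < p'" "a' < r"
    using s0 p p' unfolding a_def a'_def by (auto simp: max_def min_def)
  have aa: "g (pt i a) = g (pt i a')" using a s0 by (intro const) linarith+
  have p'1: "p' \<le> 1" using p'le xle by linarith
  have gc: "g (pt i s) = g (pt i a)" if s: "s \<in> {p<..<p'}" for s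
  proof (rule const_gap[OF aff assms(1) p0 p'1 a(1) _ a(5) aa])
    show "a < a'" using a by linarith
    show "p < s" "s < p'" using s by auto
  qed
  have "continuous_on (closure {p<..<p'}) (\<lambda>s. g (pt i s))"
    using p p' p0 p'le xle
    by (intro continuous_on_compose2[OF g(1)] continuous_intros) (auto intro!: pt_in_triod assms)
  then have cl: "g (pt i s) = g (pt i a)" if "s \<in> {p..p'}" for s
    using continuous_constant_on_closure[of "{p<..<p'}" "\<lambda>s. g (pt i s)" "g (pt i a)" s, OF _ gc] that p p' by auto
  have eq: "g (pt i p) = g (pt i p')" using cl[of p] cl[of p'] p p' by simp
  have memp: "pt i p \<in> insert 0 P" "pt i p' \<in> insert 0 P"
    using X_iff p p' p0 p'le xle by auto
  moreover have "pt i p' \<noteq> 0" using p p' p0 assms(1) by auto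
  ultimately have "pt i p' \<in> P" by blast
  have "g (pt i p') \<in> P" "g (pt i p') = f (pt i p')" using g(3) P(7) \<open>pt i p' \<in> P\<close> by auto
  moreover have "0 \<notin> P" using P(6) by blast
  moreover have "pt i p \<noteq> pt i p'" using p p' p0 assms(1) by (simp add: pt_eq_iff)
  ultimately show False
    using memp(1) eq g(3)[of "pt i p"] g(4) \<open>pt i p' \<in> P\<close> P(5)
    unfolding bij_betw_def inj_on_def by (metis insertE)
qed

text \<open>A maximum of \<open>rad k\<close> along the branch is interior because the end values
  are 0. By \<open>no_plateau\<close>, smaller values occur arbitrarily close on both sides, as
  \<open>peak_not_in_mono_set\<close> requires.\<close>

lemma peak_exists:
  assumes "i < 3" "k < 3" "x \<in> P" "x \<in> b i" "0 \<le> l" "l < s" "s < r" "r \<le> norm x"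
    and "rad k (g (pt i l)) = 0" "rad k (g (pt i r)) = 0" "0 < rad k (g (pt i s))"
  obtains w where "l < w" "w < r" "0 < rad k (g (pt i w))" "pt i w \<notin> \<Union>(mono_sets g)"
proof -
  define \<rho> where "\<rho> s = rad k (g (pt i s))" for s
  have r1: "r \<le> 1" using assms norm_le_1[of x] P(6) by fastforce
  have tri: "pt i u \<in> triod" "g (pt i u) \<in> triod" if "l \<le> u" "u \<le> r" for u
    using that pt_in_triod[of i u] r1 assms g(2) by auto
  have cont: "continuous_on {l..r} \<rho>"
    unfolding \<rho>_def
    by (intro continuous_rad continuous_on_compose2[OF g(1)] continuous_intros) (use tri in auto)
  obtain w where w: "w \<in> {l..r}" "\<And>u. u \<in> {l..r} \<Longrightarrow> \<rho> u \<le> \<rho> w"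
    using continuous_attains_sup[OF compact_Icc _ cont] assms by fastforce
  have pos: "0 < \<rho> w" using w(2)[of s] assms unfolding \<rho>_def by force
  then have lwr: "l < w" "w < r" using w(1) assms(9,10) unfolding \<rho>_def by (auto simp: order_le_less)
  have below: "\<exists>u. l' < u \<and> u < r' \<and> \<rho> u < \<rho> w" if l': "l \<le> l'" "l' < r'" "r' \<le> r" for l' r'
  proof (rule ccontr)
    assume "\<not> ?thesis"
    then have "\<rho> u = \<rho> w" if "l' < u" "u < r'" for u
      using w(2)[of u] that l' by fastforce
    then have "g (pt i u) = pt k (\<rho> w)" if "l' < u" "u < r'" for u
      using eq_pt_of_rad[OF assms(2) tri(2)] that l' pos unfolding \<rho>_def by force
    then show False using no_plateau[OF assms(1,3,4), of l' r'] l' assms by (metis order_trans)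
  qed
  have "pt i w \<notin> U" if U: "U \<in> mono_sets g" for U
  proof
    assume wU: "pt i w \<in> U"
    show False
    proof (rule peak_not_in_mono_set[OF g(1,2) assms(1,2) _ _ U wU])
      show "0 < w" "w < 1" using lwr assms r1 by auto
      show "\<exists>u. w - \<epsilon> < u \<and> u < w \<and> rad k (g (pt i u)) < rad k (g (pt i w))" if "\<epsilon> > 0" for \<epsilon>
        using below[of "max l (w - \<epsilon>)" w] lwr that unfolding \<rho>_def by auto
      show "\<exists>u. w < u \<and> u < w + \<epsilon> \<and> rad k (g (pt i u)) < rad k (g (pt i w))" if "\<epsilon> > 0" for \<epsilon>
        using below[of w "min r (w + \<epsilon>)"] lwr that unfolding \<rho>_def by auto
    qed
  qed
  then show ?thesis using that lwr pos unfolding \<rho>_def by blast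
qed

text \<open>Off finitely many radii a short open segment misses \<open>P\<close>. Inside the hull
  \<open>g\<close> is affine on it, beyond the hull constant, so it is a set of monotonicity. This
  supplies the points between peaks that \<open>three_laps\<close> asks for.\<close>

lemma covered_dense:
  assumes i: "i < 3" and lr: "0 \<le> l" "l < r" "r \<le> 1"
  obtains c where "l < c" "c < r" "pt i c \<in> \<Union>(mono_sets g)"
proof -
  define X where "X = insert l (insert r (norm ` P))"
  have Xfin: "finite X" unfolding X_def using P(3) by simp
  have "infinite {l<..<r}" using lr by simp
  then obtain c where c: "l < c" "c < r" "c \<notin> X"
    using Xfin by (metis finite_subset greaterThanLessThan_iff subsetI)
  obtain d where d: "d > 0" "\<And>s. s \<in> X \<Longrightarrow> d \<le> \<bar>c - s\<bar>"
    using finite_set_avoid[OF Xfin, of c] c(3) unfolding dist_real_def by metis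
  have "d \<le> \<bar>c - l\<bar>" "d \<le> \<bar>c - r\<bar>" using d(2) unfolding X_def by auto
  then have cd: "l \<le> c - d" "c + d \<le> r" using c by auto
  let ?J = "{pt i s |s. s \<in> {c - d<..<c + d}}"
  \<comment> \<open>Since \<open>c - d\<close> is nonnegative, bounds on \<open>rad i\<close> alone
    describe the segment within the triod, which makes it relatively open.\<close>
  have J: "?J = triod \<inter> {z. c - d < rad i z \<and> rad i z < c + d}"
  proof (intro equalityI subsetI)
    fix z assume "z \<in> ?J"
    then show "z \<in> triod \<inter> {z. c - d < rad i z \<and> rad i z < c + d}"
      using cd lr i by (auto simp: rad_pt intro!: pt_in_triod)
  next
    fix z assume "z \<in> triod \<inter> {z. c - d < rad i z \<and> rad i z < c + d}"
    then show "z \<in> ?J" using eq_pt_of_rad[OF i, of z "rad i z"] cd lr by auto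
  qed
  have "open {z. c - d < rad i z \<and> rad i z < c + d}"
    by (intro open_Collect_conj open_Collect_less continuous_intros)
  then have op: "openin (top_of_set triod) ?J" unfolding J by (simp add: openin_open_Int)
  have con: "connected ?J" by (rule connected_segment_pts) (rule is_interval_oo)
  have noP: "norm x \<le> c - d \<or> c + d \<le> norm x" if "x \<in> P" for x
    using d(2)[of "norm x"] that unfolding X_def by auto
  have Jne: "pt i c \<in> ?J" using d by force
  have "connected_fibres_on g ?J"
  proof (cases "\<exists>x\<in>P \<inter> b i. c < norm x")
    case True
    then obtain x where x: "x \<in> P" "x \<in> b i" "c < norm x" by blast
    then have "c + d \<le> norm x" using noP d by force
    moreover have "pt i s \<notin> P" if "c - d < s" "s < c + d" for s
      using noP[of "pt i s"] that i cd lr by auto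
    ultimately have "affine_on_segment g ?J"
      using affine_gap[OF i x(1,2), of "c - d" "c + d"] cd lr d by auto
    then show ?thesis
      unfolding connected_fibres_on_def using affine_fibre_connected g i cd lr by auto
  next
    case False
    have "?J \<subseteq> triod - triod_hull P"
    proof
      fix z assume z: "z \<in> ?J"
      then obtain s where s: "z = pt i s" "c - d < s" "s < c + d" by auto
      have "z \<notin> triod_hull P"
      proof
        assume "z \<in> triod_hull P"
        then obtain i' s' x where x: "z = pt i' s'" "i' < 3" "0 \<le> s'" "x \<in> P \<inter> b i'" "s' \<le> norm x"
          unfolding hull_eq[OF spans] by blast
        then have "i' = i" "s' = s" using s pt_eq_iff[of i' i s' s] i cd lr by auto
        then have "norm x \<le> c" "s \<le> norm x" using False x by (auto simp: not_less)
        then show False using noP[of x] x s d by auto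
      qed
      then show "z \<in> triod - triod_hull P" using z J by blast
    qed
    then obtain C where "C \<in> components (triod - triod_hull P)" "?J \<subseteq> C"
      using exists_component_superset[OF _ _ con] Jne by blast
    then have "g constant_on ?J"
      using linear constant_on_subset unfolding is_linear_map_of_def by blast
    then obtain v where v: "\<And>z. z \<in> ?J \<Longrightarrow> g z = v" unfolding constant_on_def by blast
    show ?thesis unfolding connected_fibres_on_def
    proof
      fix v' assume "v' \<in> g ` ?J"
      then have "v' = v" using v by blast
      then have "g -` {v'} \<inter> ?J = ?J" using v by blast
      then show "connected (g -` {v'} \<inter> ?J)" using con by simp
    qed
  qed
  then have "?J \<in> mono_sets g" unfolding mono_sets_def using op con by blast
  then show ?thesis using that c Jne by blast
qed

end

section \<open>Colours of a cycle whose linear map has at most two laps\<close>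

locale unimodal_linear_map = spanning_linear_map +
  assumes laps: "finite (laps g)" "card (laps g) \<le> 2" and canonical: "canonical_for_cycle b f P"
begin

text \<open>The two points cut off an inner, a middle and an outer piece; \<open>c1\<close>,
  \<open>c2\<close>, \<open>c3\<close> are taken from these.\<close>

lemma uncovered_same_branch:
  assumes i: "i < 3" and w: "0 < w" "w < w'" "w' < 1"
    and u: "pt i w \<notin> \<Union>(mono_sets g)" "pt i w' \<notin> \<Union>(mono_sets g)"
  shows False
proof -
  obtain c1 where c1: "0 < c1" "c1 < w" "pt i c1 \<in> \<Union>(mono_sets g)"
    using covered_dense[OF i, of 0 w] w by auto
  obtain c2 where c2: "w < c2" "c2 < w'" "pt i c2 \<in> \<Union>(mono_sets g)"
    using covered_dense[OF i, of w w'] w by auto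
  obtain c3 where c3: "w' < c3" "c3 < 1" "pt i c3 \<in> \<Union>(mono_sets g)"
    using covered_dense[OF i, of w' 1] w by auto
  show False
  proof (rule three_laps[OF laps u c1(3) c2(3) c3(3)])
    fix S assume S: "connected S" "S \<subseteq> triod"
    show "pt i w \<in> S \<or> pt i w' \<in> S" if "pt i c1 \<in> S" "pt i c2 \<in> S"
      using connected_radii[OF S i that, of w] c1 c2 w by auto
    show "pt i w \<in> S \<or> pt i w' \<in> S" if "pt i c1 \<in> S" "pt i c3 \<in> S"
      using connected_radii[OF S i that, of w] c1 c3 w by auto
    show "pt i w \<in> S \<or> pt i w' \<in> S" if "pt i c2 \<in> S" "pt i c3 \<in> S"
      using connected_radii[OF S i that, of w'] c2 c3 w by auto
  qed
qed

text \<open>Here the three pieces are the central one around 0, represented by \<open>c1\<close>,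
  and the outer ends of the two branches, represented by \<open>c2\<close> and
  \<open>c3\<close>.\<close>

lemma uncovered_other_branch:
  assumes i: "i < 3" "k < 3" "i \<noteq> k" and w: "0 < w" "w < 1" "0 < w'" "w' < 1"
    and u: "pt i w \<notin> \<Union>(mono_sets g)" "pt k w' \<notin> \<Union>(mono_sets g)"
  shows False
proof -
  obtain c1 where c1: "0 < c1" "c1 < w" "pt i c1 \<in> \<Union>(mono_sets g)"
    using covered_dense[OF i(1), of 0 w] w by auto
  obtain c2 where c2: "w < c2" "c2 < 1" "pt i c2 \<in> \<Union>(mono_sets g)"
    using covered_dense[OF i(1), of w 1] w by auto
  obtain c3 where c3: "w' < c3" "c3 < 1" "pt k c3 \<in> \<Union>(mono_sets g)"
    using covered_dense[OF i(2), of w' 1] w by auto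
  have nb: "pt i c1 \<notin> b k" "pt i c2 \<notin> b k" "pt k c3 \<notin> b i"
    using c1 c2 c3 w i by (auto simp: pt_in_b_iff)
  show False
  proof (rule three_laps[OF laps u c1(3) c2(3) c3(3)])
    fix S assume S: "connected S" "S \<subseteq> triod"
    show "pt i w \<in> S \<or> pt k w' \<in> S" if "pt i c1 \<in> S" "pt i c2 \<in> S"
      using connected_radii[OF S i(1) that, of w] c1 c2 w by auto
    show "pt i w \<in> S \<or> pt k w' \<in> S" if "pt i c1 \<in> S" "pt k c3 \<in> S"
      using connected_through_0[OF S i(2) that(2,1) nb(1), of w'] c3 w by auto
    show "pt i w \<in> S \<or> pt k w' \<in> S" if "pt i c2 \<in> S" "pt k c3 \<in> S"
      using connected_through_0[OF S i(1) that nb(3), of w] c2 w by auto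
  qed
qed

text \<open>Canonicity enters here: the point of the branch closest to 0 is black. So the radius of
  \<open>g\<close> on the next branch is 0 at 0, positive at that point, and 0 again at the nonblack
  \<open>x\<close>.\<close>

lemma nonblack_peak:
  assumes x: "x \<in> P" "\<not> black b f x" and i: "i < 3" "x \<in> b i"
  obtains w where "0 < w" "w < norm x" "0 < rad ((i + 1) mod 3) (g (pt i w))" "pt i w \<notin> \<Union>(mono_sets g)"
proof -
  obtain c where c: "c \<in> P" "c \<in> b i" "black b f c" "norm c \<le> norm x"
    using canonical i x unfolding canonical_for_cycle_def by blast
  let ?k = "(i + 1) mod 3"
  have "norm c \<noteq> norm x" using pt_norm[OF i(1) c(2)] pt_norm[OF i] x c by metis
  moreover have "0 < norm c" using c i by auto
  moreover have "f c \<in> b ?k" using black_iff[OF cycle c(1) i(1) c(2)] c by blast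
  then have "0 < rad ?k (g (pt i (norm c)))"
    using pt_norm[OF i(1) c(2)] g(3)[OF c(1)] rad_pos_iff[of ?k "f c"] P(6) P(7)[OF c(1)] by auto
  moreover have "f x \<notin> b ?k" using black_iff[OF cycle x(1) i] x by blast
  then have "rad ?k (g (pt i (norm x))) = 0"
    using pt_norm[OF i] g(3)[OF x(1)] P(6,7) x(1) rad_not_in_b[of ?k "f x"] by auto
  ultimately show ?thesis
    using peak_exists[OF i(1) _ x(1) i(2), of ?k 0 "norm c" "norm x"] c that g(4) by auto
qed

lemma norm_P_le_1: "x \<in> P \<Longrightarrow> norm x \<le> 1"
  using norm_le_1 P(6) by blast

lemma nonblack_same_branch:
  assumes "x \<in> P" "\<not> black b f x" "i < 3" "x \<in> b i" "y \<in> P" "\<not> black b f y" "k < 3" "y \<in> b k"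
  shows "i = k"
proof (rule ccontr)
  assume ne: "i \<noteq> k"
  obtain w where w: "0 < w" "w < norm x" "pt i w \<notin> \<Union>(mono_sets g)"
    using nonblack_peak assms(1-4) by metis
  obtain w' where w': "0 < w'" "w' < norm y" "pt k w' \<notin> \<Union>(mono_sets g)"
    using nonblack_peak assms(5-8) by metis
  show False
    using uncovered_other_branch[OF assms(3,7) ne _ _ _ _ w(3) w'(3)] w w' norm_P_le_1 assms(1,5)
    by (meson less_le_trans)
qed

text \<open>Before \<open>x\<close> there is a peak whose value lies on the next branch, hence off
  \<open>b k\<close>. If \<open>f y\<close> were off \<open>b k\<close> too, the radius on
  \<open>b k\<close> would rise from 0 at that peak to a positive value at \<open>x\<close> and
  return to 0 at \<open>y\<close>, which creates a second peak on the same branch.\<close>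

lemma nonblack_same_colour_aux:
  assumes "x \<in> P" "\<not> black b f x" "i < 3" "x \<in> b i" "y \<in> P" "y \<in> b i"
    and "norm x < norm y" and k: "k < 3" "f x \<in> b k"
  shows "f y \<in> b k"
proof (rule ccontr)
  assume ny: "f y \<notin> b k"
  let ?k = "(i + 1) mod 3"
  obtain w where w: "0 < w" "w < norm x" "0 < rad ?k (g (pt i w))" "pt i w \<notin> \<Union>(mono_sets g)"
    using nonblack_peak assms(1-4) by metis
  have wt: "g (pt i w) \<in> triod"
    using w norm_P_le_1[OF assms(1)] pt_in_triod[OF assms(3), of w] g(2) by auto
  then have "g (pt i w) \<in> b ?k" using rad_pos_iff w(3) by auto
  moreover have "k \<noteq> ?k" using black_iff[OF cycle assms(1,3,4)] assms(2) k by blast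
  ultimately have "rad k (g (pt i w)) = 0"
    using rad_not_in_b[OF k(1) wt] b_disjoint[OF k(1), of ?k] by auto
  moreover have "0 < rad k (g (pt i (norm x)))"
    using pt_norm[OF assms(3,4)] g(3)[OF assms(1)] rad_pos_iff P(6,7) assms(1) k by auto
  moreover have "rad k (g (pt i (norm y))) = 0"
    using pt_norm[OF assms(3,6)] g(3)[OF assms(5)] P(6,7) assms(5) rad_not_in_b[OF k(1) _ ny] by auto
  ultimately obtain w' where "w < w'" "w' < norm y" "pt i w' \<notin> \<Union>(mono_sets g)"
    using peak_exists[OF assms(3) k(1) assms(5,6), of w "norm x" "norm y"] w(1,2) assms(7)
    by (metis less_imp_le order_refl)
  then show False
    using uncovered_same_branch[OF assms(3) w(1) _ _ w(4), of w'] norm_P_le_1[OF assms(5)] by auto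
qed

lemma nonblack_same_colour:
  assumes "x \<in> P" "\<not> black b f x" "i < 3" "x \<in> b i" "y \<in> P" "\<not> black b f y" "y \<in> b i"
    and k: "k < 3" "f x \<in> b k"
  shows "f y \<in> b k"
proof -
  consider "norm x < norm y" | "norm y < norm x" | "x = y"
    using pt_norm[OF assms(3,4)] pt_norm[OF assms(3,7)] by (metis linorder_neqE)
  then show ?thesis
  proof cases
    case 1
    then show ?thesis using nonblack_same_colour_aux assms by blast
  next
    case 2
    obtain l where l: "l < 3" "f y \<in> b l" using in_some_b P(6,7) assms(5) by blast
    then have "f x \<in> b l" using nonblack_same_colour_aux[OF assms(5,6,3,7,1,4) 2] by blast
    then show ?thesis using l k b_disjoint by blast
  qed (use k in simp)
qed

end

section \<open>Colours and rotation numbers\<close>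

context unimodal_linear_map
begin

lemma P_cases:
  assumes "x \<in> P"
  obtains i k where "i < 3" "x \<in> b i" "k < 3" "f x \<in> b ((i + k) mod 3)"
    "displacement b x (f x) = of_nat k / 3" "black b f x \<longleftrightarrow> k = 1"
proof -
  obtain i where i: "i < 3" "x \<in> b i" using in_some_b P(6) assms by blast
  have fx: "f x \<in> triod" "f x \<noteq> 0" using P(6) P(7)[OF assms] by auto
  obtain k where k: "k < 3" "f x \<in> b ((i + k) mod 3)" "displacement b x (f x) = of_nat k / 3"
    using displacement_cases[OF i fx] by blast
  have "black b f x \<longleftrightarrow> k = 1" unfolding black_def k(3) by auto
  then show ?thesis using that i k by blast
qed

lemma sum_cobound:
  fixes c :: "complex \<Rightarrow> 'a :: ab_group_add"
  shows "(\<Sum>x\<in>P. c (f x) - c x) = 0"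
  using sum.reindex_bij_betw[OF P(5), of c] by (simp add: sum_subtractf)

lemma nonblack_branch: "\<exists>j<3. \<forall>i<3. i \<noteq> j \<longrightarrow> (\<forall>x\<in>P \<inter> b i. black b f x)"
proof (cases "\<exists>x\<in>P. \<not> black b f x")
  case True
  then obtain x j where "x \<in> P" "\<not> black b f x" "j < 3" "x \<in> b j"
    using in_some_b P(6) by blast
  then show ?thesis using nonblack_same_branch by blast
next
  case False
  then show ?thesis by (intro exI[of _ 0]) auto
qed

text \<open>The coboundary of the correction term makes every summand of
  \<open>\<Sum> (displacement - 1/2)\<close> nonpositive.\<close>

lemma rot_less_half: "rot f P < 1 / 2"
proof -
  obtain j where j: "j < 3" "\<And>i x. i < 3 \<Longrightarrow> i \<noteq> j \<Longrightarrow> x \<in> P \<Longrightarrow> x \<in> b i \<Longrightarrow> black b f x"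
    using nonblack_branch by blast
  define j1 j2 where "j1 = (j + 1) mod 3" and "j2 = (j + 2) mod 3"
  have j12: "j1 < 3" "j2 < 3" "j1 \<noteq> j" "j2 \<noteq> j" "j1 \<noteq> j2" "(j1 + 1) mod 3 = j2" "(j2 + 1) mod 3 = j"
    "j mod 3 = j"
    using less_3_cases[OF j(1)] unfolding j1_def j2_def by (elim disjE; hypsubst; simp)+
  have three: "i = j \<or> i = j1 \<or> i = j2" if "i < 3" for i
    using less_3_cases[OF j(1)] less_3_cases[OF that] unfolding j1_def j2_def by (elim disjE; hypsubst; simp)
  \<comment> \<open>The extremal itinerary alternates a red step from \<open>j\<close> to
    \<open>j2\<close> (surplus 1/6 over 1/2) with a black step back (deficit 1/6); the value -1/6 on
    \<open>j2\<close> evens these out to 0. Points on \<open>j1\<close> stay strictly negative, and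
    canonicity provides one.\<close>
  define c :: "complex \<Rightarrow> rat" where "c z = (if z \<in> b j2 then - 1 / 6 else 0)" for z
  define \<delta> where "\<delta> x = displacement b x (f x) - 1 / 2 + (c (f x) - c x)" for x
  have c: "c z = (if i = j2 then - 1 / 6 else 0)" if "i < 3" "z \<in> b i" for i z
    unfolding c_def using b_disjoint[of i j2 z] that j12 by auto
  have \<delta>: "\<delta> x \<le> 0" "x \<in> b j1 \<Longrightarrow> \<delta> x < 0" if x: "x \<in> P" for x
  proof -
    obtain i k where ik: "i < 3" "x \<in> b i" "k < 3" "f x \<in> b ((i + k) mod 3)"
      "displacement b x (f x) = of_nat k / 3" "black b f x \<longleftrightarrow> k = 1"
      using P_cases[OF x] by blast
    have eq: "\<delta> x = of_nat k / 3 - 1 / 2 + (if (i + k) mod 3 = j2 then - 1 / 6 else 0) - (if i = j2 then - 1 / 6 else 0)"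
      unfolding \<delta>_def ik(5) using c[of "(i + k) mod 3" "f x"] c[of i x] ik by auto
    have k1: "k = 1" if "i \<noteq> j" using j(2)[OF ik(1) that x ik(2)] ik(6) by blast
    have "\<delta> x \<le> 0 \<and> (i = j1 \<longrightarrow> \<delta> x < 0)"
      using three[OF ik(1)]
    proof (elim disjE)
      assume "i = j"
      moreover have "(j + k) mod 3 = j2 \<longleftrightarrow> k = 2"
        using mod_3_add_cancel[of 2 k j] ik(3) unfolding j2_def by auto
      ultimately show ?thesis using eq less_3_cases[OF ik(3)] j12 by auto
    next
      assume i: "i = j1"
      then have k: "k = 1" using k1 j12 by blast
      then show ?thesis using eq i j12 by simp
    next
      assume i: "i = j2"
      then have k: "k = 1" using k1 j12 by blast
      then show ?thesis using eq i j12 by simp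
    qed
    then show "\<delta> x \<le> 0" "x \<in> b j1 \<Longrightarrow> \<delta> x < 0" using b_disjoint ik(1,2) j12(1) by blast+
  qed
  obtain x1 where "x1 \<in> P" "x1 \<in> b j1" using canonical j12 unfolding canonical_for_cycle_def by blast
  then have "(\<Sum>x\<in>P. \<delta> x) < (\<Sum>x\<in>P. 0)"
    using \<delta> P(3) by (intro sum_strict_mono_ex1) auto
  moreover have "(\<Sum>x\<in>P. \<delta> x) = (\<Sum>x\<in>P. displacement b x (f x)) - of_nat (card P) / 2"
    unfolding \<delta>_def using sum_cobound[of c] by (simp add: sum.distrib sum_subtractf)
  moreover have "(of_nat (card P) :: rat) > 0" using P(3,4) by (simp add: card_gt_0_iff)
  ultimately show ?thesis unfolding rot_def by (simp add: field_simps)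
qed

text \<open>All nonblack points deviate from 1/3 by the same nonzero amount, so their deviations
  cannot cancel, while the deviations of the whole cycle sum to 0.\<close>

lemma all_black:
  assumes "rot f P = 1 / 3"
  shows "\<forall>x\<in>P. black b f x"
proof (rule ccontr)
  assume "\<not> ?thesis"
  then obtain x where x: "x \<in> P" "\<not> black b f x" by blast
  define \<delta> where "\<delta> = displacement b x (f x) - 1 / 3"
  have \<delta>0: "\<delta> \<noteq> 0" using x(2) unfolding \<delta>_def black_def by simp
  have d: "displacement b y (f y) - 1 / 3 = (if black b f y then 0 else \<delta>)" if y: "y \<in> P" for y
  proof (cases "black b f y")
    case True
    then show ?thesis unfolding black_def by simp
  next
    case False
    obtain i k where ik: "i < 3" "x \<in> b i" "k < 3" "f x \<in> b ((i + k) mod 3)"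
      "displacement b x (f x) = of_nat k / 3"
      using P_cases[OF x(1)] by blast
    obtain i' where i': "i' < 3" "y \<in> b i'" using in_some_b P(6) y by blast
    then have "i' = i" using nonblack_same_branch[OF x ik(1,2) y False] by simp
    then have "f y \<in> b ((i + k) mod 3)"
      using nonblack_same_colour[OF x ik(1,2) y False _ _ ik(4)] i' by simp
    then show ?thesis using displacement_eq ik i' \<open>i' = i\<close> False unfolding \<delta>_def by metis
  qed
  have "(of_nat (card P) :: rat) > 0" using P(3,4) by (simp add: card_gt_0_iff)
  then have "(\<Sum>y\<in>P. displacement b y (f y)) - of_nat (card P) * (1 / 3) = 0"
    using assms unfolding rot_def by (simp add: field_simps)
  then have "(\<Sum>y\<in>P. displacement b y (f y) - 1 / 3) = 0"
    by (simp add: sum_subtractf)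
  moreover have "(\<Sum>y\<in>P. displacement b y (f y) - 1 / 3) = (\<Sum>y\<in>P. if \<not> black b f y then \<delta> else 0)"
    using d by (intro sum.cong) auto
  moreover have "(\<Sum>y\<in>P. if \<not> black b f y then \<delta> else 0) = of_nat (card {y \<in> P. \<not> black b f y}) * \<delta>"
    using sum.inter_filter[OF P(3), of "\<lambda>_. \<delta>" "\<lambda>y. \<not> black b f y"] by simp
  moreover have "card {y \<in> P. \<not> black b f y} \<noteq> 0" using x P(3) by auto
  ultimately show False using \<delta>0 by simp
qed

end

section \<open>Black cycles of period three\<close>

text \<open>In the increasing case \<open>a'\<close> is the last point with value at most that at
  \<open>a\<close>, and \<open>b'\<close> the first later point with value at least that at
  \<open>b\<close>; the decreasing case follows by negation. The lower bound will keep a radius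
  positive and so a curve on its branch.\<close>

lemma continuous_subinterval:
  fixes \<phi> :: "real \<Rightarrow> real"
  assumes "a \<le> b" "continuous_on {a..b} \<phi>" "\<phi> a \<noteq> \<phi> b"
  obtains a' b' where "a \<le> a'" "a' < b'" "b' \<le> b" "\<phi> a' = \<phi> a" "\<phi> b' = \<phi> b"
    "\<And>s. a' \<le> s \<Longrightarrow> s \<le> b' \<Longrightarrow> min (\<phi> a) (\<phi> b) \<le> \<phi> s"
proof -
  have main: "\<exists>a' b'. a \<le> a' \<and> a' < b' \<and> b' \<le> b \<and> \<psi> a' = \<psi> a \<and> \<psi> b' = \<psi> b \<and>
      (\<forall>s\<in>{a'..b'}. \<psi> a \<le> \<psi> s \<and> \<psi> s \<le> \<psi> b)"
    if c: "continuous_on {a..b} \<psi>" and lt: "\<psi> a < \<psi> b" for \<psi> :: "real \<Rightarrow> real"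
  proof -
    have K: "compact ({a..b} \<inter> \<psi> -` {..\<psi> a})"
      by (simp add: compact_eq_bounded_closed bounded_Int continuous_closed_preimage[OF c])
    have "a \<in> {a..b} \<inter> \<psi> -` {..\<psi> a}" using assms by simp
    then have ne: "{a..b} \<inter> \<psi> -` {..\<psi> a} \<noteq> {}" by blast
    obtain a' where a': "a' \<in> {a..b}" "\<psi> a' \<le> \<psi> a"
      "\<And>s. s \<in> {a..b} \<Longrightarrow> \<psi> s \<le> \<psi> a \<Longrightarrow> s \<le> a'"
      using compact_attains_sup[OF K ne] by auto
    have "continuous_on {a'..b} \<psi>" using a' by (auto intro: continuous_on_subset[OF c])
    then obtain s where s: "a' \<le> s" "s \<le> b" "\<psi> s = \<psi> a"
      using IVT'[of \<psi> a' "\<psi> a" b] a' lt by auto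
    then have "s = a'" using a'(1) a'(3)[of s] by auto
    then have e1: "\<psi> a' = \<psi> a" using s by simp
    have c2: "continuous_on {a'..b} \<psi>" using a' by (auto intro: continuous_on_subset[OF c])
    have K2: "compact ({a'..b} \<inter> \<psi> -` {\<psi> b..})"
      by (simp add: compact_eq_bounded_closed bounded_Int continuous_closed_preimage[OF c2])
    have "b \<in> {a'..b} \<inter> \<psi> -` {\<psi> b..}" using a' by simp
    then have ne2: "{a'..b} \<inter> \<psi> -` {\<psi> b..} \<noteq> {}" by blast
    obtain b' where b': "b' \<in> {a'..b}" "\<psi> b' \<ge> \<psi> b"
      "\<And>s. s \<in> {a'..b} \<Longrightarrow> \<psi> s \<ge> \<psi> b \<Longrightarrow> b' \<le> s"
      using compact_attains_inf[OF K2 ne2] by auto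
    have "continuous_on {a'..b'} \<psi>" using b' by (auto intro: continuous_on_subset[OF c2])
    then obtain t where t: "a' \<le> t" "t \<le> b'" "\<psi> t = \<psi> b"
      using IVT'[of \<psi> a' "\<psi> b" b'] b' lt e1 by auto
    then have "t = b'" using b'(1) b'(3)[of t] by auto
    then have e2: "\<psi> b' = \<psi> b" using t by simp
    have ne: "a' \<noteq> b'" using e1 e2 lt by auto
    have "\<psi> a \<le> \<psi> s \<and> \<psi> s \<le> \<psi> b" if "s \<in> {a'..b'}" for s
      using a'(1) a'(3)[of s] b'(1) b'(3)[of s] that e1 e2 lt by force
    then show ?thesis using a' b' e1 e2 ne by (intro exI[of _ a'] exI[of _ b']) auto
  qed
  show ?thesis
  proof (cases "\<phi> a < \<phi> b")
    case True
    then obtain a' b' where "a \<le> a' \<and> a' < b' \<and> b' \<le> b \<and> \<phi> a' = \<phi> a \<and> \<phi> b' = \<phi> b"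
      "\<forall>s\<in>{a'..b'}. \<phi> a \<le> \<phi> s \<and> \<phi> s \<le> \<phi> b"
      using main[OF assms(2)] by blast
    moreover from this have "min (\<phi> a) (\<phi> b) \<le> \<phi> s" if "a' \<le> s" "s \<le> b'" for s
      using that by (simp add: min_le_iff_disj)
    ultimately show ?thesis using that[of a' b'] by blast
  next
    case False
    then have "- \<phi> a < - \<phi> b" using assms(3) by simp
    then obtain a' b' where "a \<le> a' \<and> a' < b' \<and> b' \<le> b \<and> - \<phi> a' = - \<phi> a \<and> - \<phi> b' = - \<phi> b"
      "\<forall>s\<in>{a'..b'}. - \<phi> a \<le> - \<phi> s \<and> - \<phi> s \<le> - \<phi> b"
      using main[of "\<lambda>s. - \<phi> s"] assms(2) continuous_on_minus by blast
    moreover from this have "min (\<phi> a) (\<phi> b) \<le> \<phi> s" if "a' \<le> s" "s \<le> b'" for s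
      using that by (simp add: min_le_iff_disj)
    ultimately show ?thesis using that[of a' b'] by simp
  qed
qed

text \<open>\<open>s\<close> is the last point that moves up, and \<open>t\<close>, its successor in
  \<open>X\<close>, moves down.\<close>

lemma finite_map_crossing:
  fixes X :: "'a :: linorder set"
  assumes "finite X" "X \<noteq> {}" "\<phi> ` X \<subseteq> X" "\<And>s. s \<in> X \<Longrightarrow> \<phi> s \<noteq> s"
  obtains s t where "s \<in> X" "t \<in> X" "s < t" "t \<le> \<phi> s" "\<phi> t \<le> s"
proof -
  let ?U = "{s \<in> X. s < \<phi> s}"
  have "Min X \<in> X" using assms by simp
  then have "\<phi> (Min X) \<in> X" "\<phi> (Min X) \<noteq> Min X" using assms(3,4) by blast+
  then have "Min X < \<phi> (Min X)" using Min_le[OF assms(1)] by (simp add: order_less_le)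
  then have "Min X \<in> ?U" using \<open>Min X \<in> X\<close> by simp
  then have U: "finite ?U" "?U \<noteq> {}" using assms(1) by auto
  define s where "s = Max ?U"
  have s: "s \<in> X" "s < \<phi> s" using Max_in[OF U] unfolding s_def by auto
  let ?V = "{t \<in> X. s < t}"
  have V: "finite ?V" "?V \<noteq> {}" using assms(1,3) s by auto
  define t where "t = Min ?V"
  have t: "t \<in> X" "s < t" using Min_in[OF V] unfolding t_def by auto
  have "t \<le> \<phi> s" unfolding t_def using V s assms(3) by (intro Min_le) auto
  moreover have "\<not> t < \<phi> t" using Max_ge[OF U(1), of t] t unfolding s_def by fastforce
  then have "\<phi> t < t" using assms(4)[OF t(1)] by auto
  then have "\<phi> t \<le> s" using Min_le[OF V(1), of "\<phi> t"] assms(3) t unfolding t_def by fastforce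
  ultimately show ?thesis using that s t by blast
qed

context numbered_triod
begin

text \<open>The primitive black cycles of period three, encoded by the radius of the one point on
  each branch.\<close>

definition black3 :: "(complex \<Rightarrow> complex) \<Rightarrow> (nat \<Rightarrow> real) \<Rightarrow> bool" where
  "black3 f u \<longleftrightarrow> f \<in> triod_maps \<and>
     (\<forall>i<3. 0 < u i \<and> u i \<le> 1 \<and> f (pt i (u i)) = pt ((i + 1) mod 3) (u ((i + 1) mod 3)))"

definition tripod :: "(nat \<Rightarrow> real) \<Rightarrow> complex set" where
  "tripod u = {pt i (u i) |i. i < 3}"

lemma black3D:
  assumes "black3 f u"
  shows "0 < u 0" "0 < u 1" "0 < u 2" "u 0 \<le> 1" "u 1 \<le> 1" "u 2 \<le> 1"
    "f (pt 0 (u 0)) = pt 1 (u 1)" "f (pt 1 (u 1)) = pt 2 (u 2)" "f (pt 2 (u 2)) = pt 0 (u 0)"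
    "f \<in> triod_maps"
proof -
  have *: "0 < u i \<and> u i \<le> 1 \<and> f (pt i (u i)) = pt ((i + 1) mod 3) (u ((i + 1) mod 3))" if "i < 3" for i
    using assms that unfolding black3_def by blast
  show "0 < u 0" "0 < u 1" "0 < u 2" "u 0 \<le> 1" "u 1 \<le> 1" "u 2 \<le> 1"
    "f (pt 0 (u 0)) = pt 1 (u 1)" "f (pt 1 (u 1)) = pt 2 (u 2)" "f (pt 2 (u 2)) = pt 0 (u 0)"
    using *[of 0] *[of 1] *[of 2] by (simp_all del: One_nat_def)
  show "f \<in> triod_maps" using assms unfolding black3_def by blast
qed

lemma black3I:
  assumes "f \<in> triod_maps" "0 < s0" "0 < s1" "0 < s2" "s0 \<le> 1" "s1 \<le> 1" "s2 \<le> 1"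
    "f (pt 0 s0) = pt 1 s1" "f (pt 1 s1) = pt 2 s2" "f (pt 2 s2) = pt 0 s0"
  obtains u where "black3 f u" "u 0 = s0" "u 1 = s1" "u 2 = s2"
proof
  let ?u = "\<lambda>i::nat. if i = 0 then s0 else if i = 1 then s1 else s2"
  have "0 < ?u i \<and> ?u i \<le> 1 \<and> f (pt i (?u i)) = pt ((i + 1) mod 3) (?u ((i + 1) mod 3))" if "i < 3" for i
    using less_3_cases[OF that] assms by (elim disjE) (simp_all del: One_nat_def)
  then show "black3 f ?u" unfolding black3_def using assms(1) by blast
qed auto

lemma tripod_eq: "tripod u = {pt 0 (u 0), pt 1 (u 1), pt 2 (u 2)}"
  unfolding tripod_def by (auto simp: numeral_2_eq_2 numeral_3_eq_3 less_Suc_eq)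

lemma black3_cycle:
  assumes "black3 f u"
  shows "(f, tripod u) \<in> cycles"
proof -
  note u = black3D[OF assms]
  let ?x = "pt 0 (u 0)"
  have f3: "(f ^^ 3) ?x = ?x" using u by (simp add: numeral_3_eq_3)
  have "range (\<lambda>i. (f ^^ i) ?x) = tripod u"
  proof
    show "range (\<lambda>i. (f ^^ i) ?x) \<subseteq> tripod u"
    proof (rule image_subsetI)
      fix i :: nat
      have "(f ^^ i) ?x = (f ^^ (i mod 3)) ?x" using f3 by (metis funpow_mod_eq)
      moreover have "(f ^^ j) ?x \<in> tripod u" if "j < 3" for j
        using less_3_cases[OF that] u unfolding tripod_eq by (elim disjE) (auto simp: numeral_2_eq_2)
      ultimately show "(f ^^ i) ?x \<in> tripod u" by simp
    qed
    have "(f ^^ 0) ?x = pt 0 (u 0)" "(f ^^ 1) ?x = pt 1 (u 1)" "(f ^^ 2) ?x = pt 2 (u 2)"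
      using u by (auto simp: numeral_2_eq_2)
    then show "tripod u \<subseteq> range (\<lambda>i. (f ^^ i) ?x)" unfolding tripod_eq by (metis empty_subsetI insert_subset rangeI)
  qed
  then have "periodic_orbit f (tripod u)"
    unfolding periodic_orbit_def using f3 pt_in_triod[of 0 "u 0"] u by (intro bexI[of _ ?x] exI[of _ 3]) auto
  moreover have "tripod u \<noteq> {0}"
    unfolding tripod_eq using u(1) pt_eq_0_iff[of 0 "u 0"] by (metis insertCI less_irrefl singletonD zero_less_numeral)
  ultimately show ?thesis unfolding cycles_def using u by auto
qed

lemma tripod_in_b:
  assumes "black3 f u" "i < 3"
  shows "tripod u \<inter> b i = {pt i (u i)}"
  using assms pt_in_b_iff unfolding black3_def tripod_def by (auto simp: less_imp_le)

lemma tripod_black: "black3 f u \<Longrightarrow> x \<in> tripod u \<Longrightarrow> black b f x"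
proof -
  assume u: "black3 f u" and x: "x \<in> tripod u"
  then obtain i where i: "i < 3" "x = pt i (u i)" unfolding tripod_def by blast
  then have "x \<in> b i" using tripod_in_b[OF u i(1)] by blast
  moreover have "f x \<in> b ((i + 1) mod 3)"
    using u i tripod_in_b[OF u, of "(i + 1) mod 3"] unfolding black3_def by auto
  ultimately show ?thesis using black_iff black3_cycle u x i(1) by blast
qed

lemma black3_canonical: "black3 f u \<Longrightarrow> canonical_for_cycle b f (tripod u)"
  unfolding canonical_for_cycle_def using tripod_in_b tripod_black by fastforce

lemma black3_rot: "black3 f u \<Longrightarrow> rot f (tripod u) = 1 / 3"
proof -
  assume u: "black3 f u"
  have "(\<Sum>y\<in>tripod u. displacement b y (f y)) = (\<Sum>y\<in>tripod u. 1 / 3)"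
    using tripod_black[OF u] unfolding black_def by (intro sum.cong) auto
  then have "(\<Sum>y\<in>tripod u. displacement b y (f y)) = of_nat (card (tripod u)) / 3" by simp
  moreover have "card (tripod u) > 0" using cyclesD(3,4)[OF black3_cycle[OF u]] by (simp add: card_gt_0_iff)
  ultimately show ?thesis unfolding rot_def by simp
qed

lemma black3_hull:
  assumes "black3 f u"
  shows "triod_hull (tripod u) = {pt i s |i s. i < 3 \<and> 0 \<le> s \<and> s \<le> u i}"
proof -
  have "spans (tripod u)" using canonical_spans black3_cycle black3_canonical assms by blast
  then have "triod_hull (tripod u) = {pt i s |i s. i < 3 \<and> 0 \<le> s \<and> (\<exists>x\<in>tripod u \<inter> b i. s \<le> norm x)}"
    by (rule hull_eq)
  moreover have "(\<exists>x\<in>tripod u \<inter> b i. s \<le> norm x) \<longleftrightarrow> s \<le> u i" if "i < 3" for i s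
    using assms that unfolding tripod_in_b[OF assms that] black3_def by auto
  ultimately show ?thesis by (smt (verit, best) Collect_cong)
qed

text \<open>Stretches branch \<open>i\<close> by the factor \<open>c i\<close>. On the triod at most
  one summand is nonzero, so this is a case distinction whose continuity is immediate.\<close>

definition rescale :: "(nat \<Rightarrow> real) \<Rightarrow> complex \<Rightarrow> complex" where
  "rescale c z = pt 0 (c 0 * rad 0 z) + pt 1 (c 1 * rad 1 z) + pt 2 (c 2 * rad 2 z)"

lemma rescale_pt:
  assumes "i < 3" "0 \<le> s"
  shows "rescale c (pt i s) = pt i (c i * s)"
  unfolding rescale_def using less_3_cases[OF assms(1)] assms(2) by (elim disjE) (simp_all add: rad_pt)

text \<open>The hull of such a cycle is a triod with legs of lengths \<open>u i\<close>; rescaling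
  the legs by \<open>v i / u i\<close> carries one cyclic permutation to the other.\<close>

lemma black3_equiv:
  assumes u: "black3 f u" and v: "black3 g v"
  shows "((f, tripod u), (g, tripod v)) \<in> cycle_equiv"
proof -
  define h where "h = rescale (\<lambda>i. v i / u i)"
  define k where "k = rescale (\<lambda>i. u i / v i)"
  have pos: "0 < u i" "0 < v i" if "i < 3" for i using u v that unfolding black3_def by auto
  have h: "h (pt i s) = pt i (v i / u i * s)" "k (pt i s) = pt i (u i / v i * s)" if "i < 3" "0 \<le> s" for i s
    unfolding h_def k_def using rescale_pt that by auto
  have hull: "z \<in> triod_hull (tripod u) \<longleftrightarrow> (\<exists>i<3. \<exists>s. 0 \<le> s \<and> s \<le> u i \<and> z = pt i s)"
    "z \<in> triod_hull (tripod v) \<longleftrightarrow> (\<exists>i<3. \<exists>s. 0 \<le> s \<and> s \<le> v i \<and> z = pt i s)" for z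
    unfolding black3_hull[OF u] black3_hull[OF v] by auto
  have bound: "0 \<le> v i / u i * s" "v i / u i * s \<le> v i" if "i < 3" "0 \<le> s" "s \<le> u i" for i s
    using that pos[of i] by (auto simp: divide_simps)
  have bound': "0 \<le> u i / v i * s" "u i / v i * s \<le> u i" if "i < 3" "0 \<le> s" "s \<le> v i" for i s
    using that pos[of i] by (auto simp: divide_simps)
  have hom: "homeomorphism (triod_hull (tripod u)) (triod_hull (tripod v)) h k"
  proof (rule homeomorphismI)
    show "continuous_on (triod_hull (tripod u)) h" "continuous_on (triod_hull (tripod v)) k"
      unfolding h_def k_def rescale_def by (intro continuous_intros)+
    show "h ` triod_hull (tripod u) \<subseteq> triod_hull (tripod v)"
    proof (rule image_subsetI)
      fix z assume "z \<in> triod_hull (tripod u)"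
      then obtain i s where z: "i < 3" "0 \<le> s" "s \<le> u i" "z = pt i s" unfolding hull by blast
      show "h z \<in> triod_hull (tripod v)"
        unfolding hull z(4) h(1)[OF z(1,2)] using z(1) bound[OF z(1-3)] by blast
    qed
    show "k ` triod_hull (tripod v) \<subseteq> triod_hull (tripod u)"
    proof (rule image_subsetI)
      fix z assume "z \<in> triod_hull (tripod v)"
      then obtain i s where z: "i < 3" "0 \<le> s" "s \<le> v i" "z = pt i s" unfolding hull by blast
      show "k z \<in> triod_hull (tripod u)"
        unfolding hull z(4) h(2)[OF z(1,2)] using z(1) bound'[OF z(1-3)] by blast
    qed
    fix z assume "z \<in> triod_hull (tripod u)"
    then obtain i s where z: "i < 3" "0 \<le> s" "s \<le> u i" "z = pt i s" unfolding hull by blast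
    then show "k (h z) = z" using h(1)[OF z(1,2)] h(2)[OF z(1) bound(1)[OF z(1,2,3)]] pos[of i] by simp
  next
    fix z assume "z \<in> triod_hull (tripod v)"
    then obtain i s where z: "i < 3" "0 \<le> s" "s \<le> v i" "z = pt i s" unfolding hull by blast
    then show "h (k z) = z" using h(2)[OF z(1,2)] h(1)[OF z(1) bound'(1)[OF z(1,2,3)]] pos[of i] by simp
  qed
  have hu: "h (pt i (u i)) = pt i (v i)" if "i < 3" for i using h(1)[OF that] pos[OF that] by simp
  have "h ` tripod u = tripod v" unfolding tripod_eq using hu by simp
  moreover have "\<forall>x\<in>tripod u. h (f x) = g (h x)"
    unfolding tripod_eq using hu black3D[OF u] black3D[OF v] by simp
  moreover have "h x \<in> b i" if i: "i < 3" "x \<in> triod_hull (tripod u)" "x \<in> b i" for i x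
  proof -
    obtain i' s where x: "i' < 3" "0 \<le> s" "s \<le> u i'" "x = pt i' s" using i(2) unfolding hull by blast
    then have "i' = i" "0 < s" using i pt_in_b_iff by auto
    have "0 < v i / u i * s" using pos[OF i(1)] \<open>0 < s\<close> by simp
    moreover have "v i \<le> 1" using v i(1) unfolding black3_def by blast
    then have "v i / u i * s \<le> 1" using bound(2)[OF i(1) x(2)] x(3) \<open>i' = i\<close> by force
    ultimately have "0 < v i / u i * s" "v i / u i * s \<le> 1" by blast+
    then show ?thesis using h(1)[OF i(1)] x \<open>i' = i\<close> pt_in_b_iff[OF i(1) i(1)] by simp
  qed
  ultimately show ?thesis
    using hom black3_cycle[OF u] black3_cycle[OF v] unfolding cycle_equiv_iff eqv_def by blast
qed

lemma curve_subinterval: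
  fixes a c :: real
  assumes "a \<le> c" "continuous_on {a..c} G" "G ` {a..c} \<subseteq> triod" "k < 3" "G a \<in> b k" "G c \<in> b k" "G a \<noteq> G c"
  obtains a' c' where "a \<le> a'" "a' < c'" "c' \<le> c" "G a' = G a" "G c' = G c"
    "\<And>s. a' \<le> s \<Longrightarrow> s \<le> c' \<Longrightarrow> G s \<in> b k"
proof -
  define \<phi> where "\<phi> s = rad k (G s)" for s
  have tri: "G s \<in> triod" if "a \<le> s" "s \<le> c" for s using assms(3) that by auto
  have pos: "0 < \<phi> a" "0 < \<phi> c"
    unfolding \<phi>_def
    using rad_pos_iff[OF assms(4) tri[of a]] rad_pos_iff[OF assms(4) tri[of c]] assms(1,5,6) by simp_all
  have pt: "pt k (\<phi> s) = G s" if "0 < \<phi> s" "a \<le> s" "s \<le> c" for s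
    using eq_pt_of_rad[OF assms(4) tri[OF that(2,3)]] that unfolding \<phi>_def by metis
  have ne: "\<phi> a \<noteq> \<phi> c" using pt[OF pos(1)] pt[OF pos(2)] assms(1,7) by auto
  have cont: "continuous_on {a..c} \<phi>" unfolding \<phi>_def by (intro continuous_rad assms)
  obtain a' c' where ac: "a \<le> a'" "a' < c'" "c' \<le> c" "\<phi> a' = \<phi> a" "\<phi> c' = \<phi> c"
    "\<And>s. a' \<le> s \<Longrightarrow> s \<le> c' \<Longrightarrow> min (\<phi> a) (\<phi> c) \<le> \<phi> s"
    using continuous_subinterval[OF assms(1) cont ne] by blast
  have "G a' = G a" "G c' = G c"
    using pt[of a'] pt[of a] pt[of c'] pt[of c] ac pos assms(1) by auto
  moreover have "G s \<in> b k" if "a' \<le> s" "s \<le> c'" for s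
  proof -
    have "0 < \<phi> s" using ac(6)[OF that] pos by linarith
    then show ?thesis unfolding \<phi>_def using rad_pos_iff[OF assms(4) tri[of s]] that ac by simp
  qed
  ultimately show ?thesis using that ac by blast
qed

text \<open>The third iterate acts on the finite set \<open>X\<close> of radii of \<open>P\<close>
  on \<open>b 0\<close>. If it has a fixed point there, the point has a black orbit of period three.
  Otherwise \<open>s\<close> and \<open>t\<close> move across each other, and a fixed point is
  sought between them. Two nested intervals ensure that its orbit visits \<open>b 1\<close> and
  \<open>b 2\<close>; they leave the images of the ends unchanged.\<close>

lemma all_black_black3:
  assumes cyc: "(f, P) \<in> cycles" and black: "\<And>x. x \<in> P \<Longrightarrow> black b f x"
  obtains u where "black3 f u"
proof -
  note P = cyclesD[OF cyc] and result = that
  have next_b: "f x \<in> P" "f x \<in> b ((i + 1) mod 3)" if "x \<in> P" "i < 3" "x \<in> b i" for x i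
    using black_iff[OF cyc that] black that P(7) by auto
  have step: "f x \<in> P \<and> f x \<in> b 1" if "x \<in> P" "x \<in> b 0" for x using next_b[of x 0] that by simp
  have step1: "f x \<in> P \<and> f x \<in> b 2" if "x \<in> P" "x \<in> b 1" for x using next_b[of x 1] that by (simp add: numeral_2_eq_2)
  have step2: "f x \<in> P \<and> f x \<in> b 0" if "x \<in> P" "x \<in> b 2" for x using next_b[of x 2] that by simp
  have fin: "f y \<in> triod" if "y \<in> triod" for y using P(10) that by blast
  define X where "X = {s. pt 0 s \<in> P \<inter> b 0}"
  have X_b: "pt 0 s \<in> P" "pt 0 s \<in> b 0" "0 < s" "s \<le> 1" if "s \<in> X" for s
  proof -
    show "pt 0 s \<in> P" "pt 0 s \<in> b 0" using that unfolding X_def by auto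
    then obtain t where t: "0 < t" "t \<le> 1" "pt 0 s = pt 0 t" using b_iff[of 0] by auto
    have "e 0 \<noteq> 0" using norm_e[of 0] by force
    then have "s = t" using t(3) unfolding pt_def by simp
    then show "0 < s" "s \<le> 1" using t by auto
  qed
  have norm_X: "norm x \<in> X" if "x \<in> P" "x \<in> b 0" for x
    unfolding X_def using pt_norm[of 0 x] that by simp
  have "X \<subseteq> norm ` P"
  proof
    fix s assume s: "s \<in> X"
    have "s = norm (pt 0 s)" using X_b(3)[OF s] by simp
    then show "s \<in> norm ` P" using X_b(1)[OF s] by blast
  qed
  then have Xfin: "finite X" using P(3) finite_subset by blast
  obtain x0 where x0: "x0 \<in> P" using P(4) by blast
  obtain i0 where i0: "i0 < 3" "x0 \<in> b i0" using in_some_b P(6) x0 by blast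
  have "\<exists>x\<in>P. x \<in> b 0"
    using less_3_cases[OF i0(1)] step[OF x0] step1 step2 x0 i0(2) by blast
  then have Xne: "X \<noteq> {}" using norm_X by blast
  define \<phi> where "\<phi> s = norm (f (f (f (pt 0 s))))" for s
  have F: "f (f (f (pt 0 s))) \<in> P" "f (f (f (pt 0 s))) \<in> b 0" if "s \<in> X" for s
    using step[OF X_b(1,2)[OF that]] step1 step2 by blast+
  then have pF: "f (f (f (pt 0 s))) = pt 0 (\<phi> s)" if "s \<in> X" for s
    unfolding \<phi>_def using pt_norm[of 0] that by simp
  have \<phi>X: "\<phi> ` X \<subseteq> X" unfolding \<phi>_def using F norm_X by blast
  have finish: thesis if s: "0 < s" "s \<le> 1" "f (pt 0 s) \<in> b 1" "f (f (pt 0 s)) \<in> b 2" "f (f (f (pt 0 s))) = pt 0 s" for s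
  proof -
    obtain s1 where s1: "0 < s1" "s1 \<le> 1" "f (pt 0 s) = pt 1 s1" using s(3) b_iff[of 1] by auto
    obtain s2 where s2: "0 < s2" "s2 \<le> 1" "f (f (pt 0 s)) = pt 2 s2" using s(4) b_iff[of 2] by auto
    show thesis using black3I[OF P(1) s(1) s1(1) s2(1) s(2) s1(2) s2(2)] s(5) s1(3) s2(3) result by metis
  qed
  show thesis
  proof (cases "\<exists>s\<in>X. \<phi> s = s")
    case True
    then obtain s where s: "s \<in> X" "\<phi> s = s" by blast
    show thesis
      using finish[OF X_b(3,4)[OF s(1)]] step[OF X_b(1,2)[OF s(1)]] step1 pF[OF s(1)] s(2) by metis
  next
    case False
    then obtain s t where st: "s \<in> X" "t \<in> X" "s < t" "t \<le> \<phi> s" "\<phi> t \<le> s"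
      using finite_map_crossing[OF Xfin Xne \<phi>X] by metis
    have s01: "0 < s" "t \<le> 1" using X_b st by auto
    have tri: "pt 0 r \<in> triod" if "s \<le> r" "r \<le> t" for r using that s01 by (intro pt_in_triod) auto
    have inj: "f x \<noteq> f y" if "x \<in> P" "y \<in> P" "x \<noteq> y" for x y
      using P(5) that unfolding bij_betw_def inj_on_def by blast
    have ne0: "pt 0 s \<noteq> pt 0 t" using st(3) s01 pt_eq_iff[of 0 0 s t] by simp
    note s1 = step[OF X_b(1,2)[OF st(1)]] and t1 = step[OF X_b(1,2)[OF st(2)]]
    have s2: "f (f (pt 0 s)) \<in> P \<and> f (f (pt 0 s)) \<in> b 2" using step1 s1 by blast
    have t2: "f (f (pt 0 t)) \<in> P \<and> f (f (pt 0 t)) \<in> b 2" using step1 t1 by blast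
    have ne1: "f (pt 0 s) \<noteq> f (pt 0 t)" using inj X_b(1) st(1,2) ne0 by blast
    have ne2: "f (f (pt 0 s)) \<noteq> f (f (pt 0 t))" using inj s1 t1 ne1 by blast
    have c0: "continuous_on {s..t} (\<lambda>r. pt 0 r)" by (intro continuous_intros)
    have c1: "continuous_on {s..t} (\<lambda>r. f (pt 0 r))"
      by (rule continuous_on_compose2[OF P(9) c0]) (use tri in auto)
    have c2: "continuous_on {s..t} (\<lambda>r. f (f (pt 0 r)))"
      by (rule continuous_on_compose2[OF P(9) c1]) (use tri fin in auto)
    have c3: "continuous_on {s..t} (\<lambda>r. f (f (f (pt 0 r))))"
      by (rule continuous_on_compose2[OF P(9) c2]) (use tri fin in auto)
    obtain a c where ac: "s \<le> a" "a < c" "c \<le> t" "f (pt 0 a) = f (pt 0 s)" "f (pt 0 c) = f (pt 0 t)"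
      "\<And>r. a \<le> r \<Longrightarrow> r \<le> c \<Longrightarrow> f (pt 0 r) \<in> b 1"
      by (rule curve_subinterval[of s t "\<lambda>r. f (pt 0 r)" 1]) (use st c1 tri fin s1 t1 ne1 in auto)
    have c2': "continuous_on {a..c} (\<lambda>r. f (f (pt 0 r)))"
      by (rule continuous_on_subset[OF c2]) (use ac in auto)
    obtain a' c' where ac': "a \<le> a'" "a' < c'" "c' \<le> c" "f (f (pt 0 a')) = f (f (pt 0 s))" "f (f (pt 0 c')) = f (f (pt 0 t))"
      "\<And>r. a' \<le> r \<Longrightarrow> r \<le> c' \<Longrightarrow> f (f (pt 0 r)) \<in> b 2"
      by (rule curve_subinterval[of a c "\<lambda>r. f (f (pt 0 r))" 2]) (use ac c2' tri fin s2 t2 ne2 in auto)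
    \<comment> \<open>The third iterate at \<open>a'\<close> and \<open>c'\<close> still has radius
      \<open>\<phi> s\<close> and \<open>\<phi> t\<close>. So \<open>\<psi>\<close> is nonnegative
      at \<open>a'\<close> (as t <= \<open>\<phi> s\<close>) and nonpositive at \<open>c'\<close>
      (as \<open>\<phi> t\<close> <= s), and a zero is fixed by the third iterate.\<close>
    define \<psi> where "\<psi> r = rad 0 (f (f (f (pt 0 r)))) - r" for r
    have "continuous_on {a'..c'} \<psi>"
      unfolding \<psi>_def
      by (intro continuous_on_diff continuous_rad continuous_on_id continuous_on_subset[OF c3])
         (use ac ac' in auto)
    moreover have "\<psi> a' = \<phi> s - a'" "\<psi> c' = \<phi> t - c'"
      unfolding \<psi>_def ac'(4,5) pF[OF st(1)] pF[OF st(2)] by (simp_all add: rad_pt \<phi>_def)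
    then have "0 \<le> \<psi> a'" "\<psi> c' \<le> 0" using st ac ac' by auto
    ultimately obtain r where r: "a' \<le> r" "r \<le> c'" "\<psi> r = 0" using IVT2'[of \<psi> c' 0 a'] ac' by auto
    have rt: "s \<le> r" "r \<le> t" "0 < r" "r \<le> 1" using r ac ac' s01 by auto
    have "f (f (f (pt 0 r))) \<in> triod" using tri fin rt by blast
    moreover have "rad 0 (f (f (f (pt 0 r)))) = r" using r(3) unfolding \<psi>_def by simp
    ultimately have "f (f (f (pt 0 r))) = pt 0 r" using rt(3) by (intro eq_pt_of_rad) simp_all
    moreover have "f (pt 0 r) \<in> b 1" using r ac' by (intro ac(6)) linarith+
    ultimately show thesis using finish[OF rt(3,4)] ac'(6)[OF r(1,2)] by blast
  qed
qed

section \<open>Consequences for twists: the bound 1/2 and uniqueness at 1/3\<close>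

lemma twistD:
  assumes "A \<in> unimodal_triod_twists b r"
  obtains f P g where "(f, P) \<in> A" "unimodal_linear_map b e f P g" "rot f P = r"
proof -
  have A: "A \<in> patterns" "canonical_for b A" "unimodal_pattern A" "has_rotation_number b A r"
    using assms unfolding unimodal_triod_twists_def triod_twist_def mem_Collect_eq by blast+
  obtain f P where fP: "(f, P) \<in> A" "unimodal_cycle f P" using A(3) unfolding unimodal_pattern_def by blast
  obtain g where g: "is_linear_map_of f P g" "finite (laps g)" "card (laps g) \<le> 2"
    using fP(2) unfolding unimodal_cycle_def by blast
  have cyc: "(f, P) \<in> cycles" using pattern_cycle A fP by blast
  have can: "canonical_for_cycle b f P" using pattern_canonical A fP by blast
  have "unimodal_linear_map b e f P g"
    using cyc can g canonical_spans[OF cyc can] by unfold_locales auto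
  moreover have "rot f P = r" using has_rotation_number_iff[OF A(1) fP(1)] A(4) by simp
  ultimately show ?thesis using that fP by blast
qed

lemma twist_less_half: "A \<in> unimodal_triod_twists b r \<Longrightarrow> r < 1 / 2"
  using twistD unimodal_linear_map.rot_less_half by metis

text \<open>Every map that exhibits \<open>A\<close> has an all black cycle, hence a black cycle of
  period three, and these share one pattern. So \<open>A\<close> forces a pattern with its own
  rotation number, and a twist can do this only if the two coincide.\<close>

lemma twist_third_unique:
  assumes A: "A \<in> unimodal_triod_twists b (1 / 3)" and u: "black3 f u"
  shows "A = cycle_equiv `` {(f, tripod u)}"
proof -
  let ?B = "cycle_equiv `` {(f, tripod u)}"
  have tw: "triod_twist b A" and Ap: "A \<in> patterns"
    using A unfolding unimodal_triod_twists_def triod_twist_def mem_Collect_eq by blast+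
  have Bp: "?B \<in> patterns" "(f, tripod u) \<in> ?B"
    using pattern_class in_own_class black3_cycle[OF u] by auto
  obtain f1 P1 g1 where f1: "(f1, P1) \<in> A" "unimodal_linear_map b e f1 P1 g1" "rot f1 P1 = 1 / 3"
    using twistD[OF A] by blast
  then have bl1: "\<forall>x\<in>P1. black b f1 x" using unimodal_linear_map.all_black by blast
  have "forces A ?B"
    unfolding forces_def
  proof (intro ballI impI)
    fix f2 assume "f2 \<in> triod_maps" "\<exists>P. (f2, P) \<in> A"
    then obtain P2 where P2: "(f2, P2) \<in> A" by blast
    have cyc: "(f2, P2) \<in> cycles" using pattern_cycle Ap P2 by blast
    have "black b f2 x" if x: "x \<in> P2" for x
    proof -
      obtain i where i: "i < 3" "x \<in> b i" using in_some_b cyclesD(6)[OF cyc] x by blast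
      then show ?thesis using pattern_black[OF Ap f1(1) P2 i(1)] bl1 x by blast
    qed
    then obtain v where "black3 f2 v" using all_black_black3[OF cyc] by blast
    then have "(f2, tripod v) \<in> ?B" using black3_equiv[OF u] by auto
    then show "\<exists>Q. (f2, Q) \<in> ?B" by blast
  qed
  moreover have "has_rotation_number b ?B (1 / 3)"
    using has_rotation_number_iff[OF Bp] black3_rot[OF u] by simp
  moreover have "has_rotation_number b A (1 / 3)"
    using A unfolding unimodal_triod_twists_def by blast
  ultimately show ?thesis using tw Bp unfolding triod_twist_def by blast
qed

end

section \<open>A piecewise linear model\<close>

text \<open>Rotation by \<open>K\<close> modulo \<open>B + K\<close>, with residues represented by
  1, ..., \<open>B + K\<close> so that each piece is a translation.\<close>

definition exchange :: "nat \<Rightarrow> nat \<Rightarrow> nat \<Rightarrow> nat" where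
  "exchange B K n = (if n \<le> B then n + K else n - B)"

lemma exchange_range: "1 \<le> n \<Longrightarrow> n \<le> B + K \<Longrightarrow> 1 \<le> exchange B K n \<and> exchange B K n \<le> B + K"
  unfolding exchange_def by auto

lemma exchange_pow_range:
  "1 \<le> n \<Longrightarrow> n \<le> B + K \<Longrightarrow> 1 \<le> (exchange B K ^^ m) n \<and> (exchange B K ^^ m) n \<le> B + K"
  by (induction m) (use exchange_range in auto)

lemma exchange_mod:
  assumes "1 \<le> n" "n \<le> B + K"
  shows "exchange B K n mod (B + K) = (n + K) mod (B + K)"
proof (cases "n \<le> B")
  case False
  then have "n + K = exchange B K n + (B + K)" unfolding exchange_def by simp
  then show ?thesis by (metis mod_add_self2)
qed (simp add: exchange_def)

lemma exchange_pow_mod: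
  assumes "1 \<le> n" "n \<le> B + K"
  shows "(exchange B K ^^ m) n mod (B + K) = (n + m * K) mod (B + K)"
proof (induction m)
  case (Suc m)
  have "(exchange B K ^^ Suc m) n mod (B + K) = ((exchange B K ^^ m) n + K) mod (B + K)"
    using exchange_mod[of "(exchange B K ^^ m) n" B K] exchange_pow_range[OF assms, of m] by simp
  also have "\<dots> = (n + m * K + K) mod (B + K)" using Suc by (metis mod_add_left_eq)
  finally show ?case by (simp add: ac_simps)
qed simp

text \<open>\<open>K\<close> is invertible modulo \<open>B + K\<close>; the number of steps from
  \<open>n\<close> to \<open>l\<close> is the inverse times their difference. For
  \<open>K = 0\<close> coprimality leaves only \<open>B = 1\<close>.\<close>

lemma exchange_transitive:
  assumes "coprime B K" "1 \<le> B" "1 \<le> n" "n \<le> B + K" "1 \<le> l" "l \<le> B + K"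
  obtains m where "(exchange B K ^^ m) n = l"
proof (cases "K = 0")
  case True
  then have "B = 1" using assms(1) by simp
  then have "n = l" using True assms by simp
  then show ?thesis using that[of 0] by simp
next
  case False
  let ?N = "B + K"
  have "gcd K ?N = 1" using assms(1) by (metis coprime_iff_gcd_eq_1 gcd.commute gcd_add1)
  then obtain x y where xy: "K * x = ?N * y + 1" using bezout_nat[OF False, of ?N] by auto
  \<comment> \<open>The difference of \<open>l\<close> and \<open>n\<close> modulo
    \<open>?N\<close>; adding \<open>?N\<close> prevents truncated subtraction.\<close>
  define d where "d = l + ?N - n"
  have d: "n + d = l + ?N" using assms(4) unfolding d_def by simp
  define m where "m = x * d"
  have "n + m * K = n + (?N * y + 1) * d" unfolding m_def xy[symmetric] by (simp add: ac_simps)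
  also have "\<dots> = n + d + ?N * (y * d)" by (simp add: algebra_simps)
  also have "\<dots> = l + ?N * (1 + y * d)" unfolding d by (simp add: algebra_simps)
  finally have "(n + m * K) mod ?N = l mod ?N" by (metis mod_mult_self2)
  then have eq: "(exchange B K ^^ m) n mod ?N = l mod ?N" using exchange_pow_mod[OF assms(3,4)] by simp
  have r: "1 \<le> (exchange B K ^^ m) n" "(exchange B K ^^ m) n \<le> ?N"
    using exchange_pow_range[OF assms(3,4)] by auto
  have "s = t" if "s mod ?N = t mod ?N" "1 \<le> s" "s \<le> ?N" "1 \<le> t" "t \<le> ?N" for s t
    using that by (cases "s = ?N"; cases "t = ?N") auto
  then show ?thesis using that eq r assms(5,6) by blast
qed

text \<open>\<open>j\<close> is the branch that receives the nonblack points of \<open>b 0\<close>: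
  0 makes them green, 2 red. The case \<open>K = 0\<close>, which forces \<open>B = 1\<close>, is
  kept because it gives the rotation number 1/3.\<close>

locale twist_model = numbered_triod +
  fixes B K j :: nat
  assumes B1: "1 \<le> B" and coprime_BK: "coprime B K" and j: "j = 0 \<or> j = 2"
begin

abbreviation "N \<equiv> B + K"

definition node :: "nat \<Rightarrow> real \<Rightarrow> complex" where
  "node i x = pt i (x / real N)"

text \<open>A signed coordinate on two branches joined at 0, positive on \<open>k\<close> and
  negative on \<open>l\<close>, so that one real function describes a path through the branching
  point.\<close>

definition arm :: "nat \<Rightarrow> nat \<Rightarrow> real \<Rightarrow> complex" where
  "arm k l x = node k (max 0 x) + node l (max 0 (- x))"

text \<open>On nonnegative arguments the graph is the diagonal up to the turning point (B, B), a
  steep piece down to (B + 1, -1), and from there the line B - x. Positive values are placed on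
  \<open>b 1\<close>, negative ones on \<open>b j\<close>.\<close>

definition U :: "real \<Rightarrow> real" where
  "U x = min x (max (real B - (real B + 1) * (x - real B)) (real B - x))"

text \<open>On nonnegative arguments: a steep piece from (0, 0) to (1, K + 1), translation by
  \<open>K\<close> up to \<open>B\<close>, and the constant \<open>N\<close> past the last point of
  the cycle on \<open>b 1\<close>.\<close>

definition V :: "real \<Rightarrow> real" where
  "V x = min (min ((real K + 1) * x) (x + real K)) (real N)"

text \<open>On the triod at most one \<open>rad\<close> is nonzero and all summands vanish at 0, so
  the sum selects the formula of the branch and is evidently continuous.\<close>

definition F :: "complex \<Rightarrow> complex" where
  "F z = arm 1 j (U (real N * rad 0 z)) + node 2 (V (real N * rad 1 z)) + node 0 (real N * rad 2 z)"

lemma N_pos: "0 < real N" and j3: "j < 3" and j_ne_1: "j \<noteq> 1"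
  using B1 j by auto

lemma node_0 [simp]: "node i 0 = 0"
  by (simp add: node_def)

lemma arm_nonneg: "0 \<le> x \<Longrightarrow> arm k l x = node k x"
  by (simp add: arm_def max_def)

lemma arm_nonpos: "x \<le> 0 \<Longrightarrow> arm k l x = node l (- x)"
  by (simp add: arm_def max_def)

lemma rad_node: "i < 3 \<Longrightarrow> k < 3 \<Longrightarrow> 0 \<le> x \<Longrightarrow> rad k (node i x) = (if k = i then x / real N else 0)"
  unfolding node_def by (intro rad_pt) auto

lemma node_eq_iff:
  "i < 3 \<Longrightarrow> k < 3 \<Longrightarrow> 0 \<le> x \<Longrightarrow> 0 \<le> y \<Longrightarrow> node i x = node k y \<longleftrightarrow> x = y \<and> (i = k \<or> x = 0)"
  unfolding node_def using N_pos by (subst pt_eq_iff) auto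

lemma node_in_b_iff: "i < 3 \<Longrightarrow> k < 3 \<Longrightarrow> 0 \<le> x \<Longrightarrow> node i x \<in> b k \<longleftrightarrow> i = k \<and> 0 < x \<and> x \<le> real N"
  unfolding node_def using N_pos by (subst pt_in_b_iff) (auto simp: divide_simps)

lemma node_in_triod: "i < 3 \<Longrightarrow> 0 \<le> x \<Longrightarrow> x \<le> real N \<Longrightarrow> node i x \<in> triod"
  unfolding node_def using N_pos by (intro pt_in_triod) auto

lemma norm_node: "i < 3 \<Longrightarrow> 0 \<le> x \<Longrightarrow> norm (node i x) = x / real N"
  unfolding node_def using N_pos by simp

lemma pt_node: "pt i s = node i (real N * s)"
  unfolding node_def using N_pos by simp

lemma b_node: "i < 3 \<Longrightarrow> z \<in> b i \<Longrightarrow> \<exists>x. 0 < x \<and> x \<le> real N \<and> z = node i x"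
proof -
  assume i: "i < 3" "z \<in> b i"
  then obtain s where s: "0 < s" "s \<le> 1" "z = pt i s" using b_iff by blast
  then show ?thesis using N_pos by (intro exI[of _ "real N * s"]) (auto simp: pt_node)
qed

lemma triod_node: "z \<in> triod \<Longrightarrow> \<exists>i<3. \<exists>x. 0 \<le> x \<and> x \<le> real N \<and> z = node i x"
proof -
  assume "z \<in> triod"
  then obtain i s where s: "i < 3" "0 \<le> s" "s \<le> 1" "z = pt i s" using triod_iff by blast
  then show ?thesis using N_pos by (intro exI[of _ i] conjI exI[of _ "real N * s"]) (auto simp: pt_node)
qed

lemma U_inner: "x \<le> real B \<Longrightarrow> U x = x"
proof -
  assume x: "x \<le> real B"
  have "0 \<le> (real B + 1) * (real B - x)" using x by simp
  then have "x \<le> real B - (real B + 1) * (x - real B)" using x by (simp add: algebra_simps)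
  then show ?thesis unfolding U_def by simp
qed

lemma U_middle:
  assumes "real B \<le> x" "x \<le> real B + 1"
  shows "U x = real B - (real B + 1) * (x - real B)"
proof -
  have "0 \<le> real B * (real B + 1 - x)" using assms by simp
  then have "real B - x \<le> real B - (real B + 1) * (x - real B)" by (simp add: algebra_simps)
  moreover have "0 \<le> (real B + 2) * (x - real B)" using assms by simp
  then have "real B - (real B + 1) * (x - real B) \<le> x" by (simp add: algebra_simps)
  ultimately show ?thesis unfolding U_def by simp
qed

lemma U_outer:
  assumes "real B + 1 \<le> x"
  shows "U x = real B - x"
proof -
  have "0 \<le> real B * (x - (real B + 1))" using assms by simp
  then have "real B - (real B + 1) * (x - real B) \<le> real B - x" by (simp add: algebra_simps)
  then show ?thesis unfolding U_def using assms by simp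
qed

lemma U_le: "U x \<le> x"
  unfolding U_def by simp

text \<open>The steep piece starts on the diagonal and leaves it at once. Together with
  \<open>U_ge_eq_imp\<close> this locates the points without excess.\<close>

lemma U_eq_imp:
  assumes "U x = x" "0 < x"
  shows "x \<le> real B"
proof (rule ccontr)
  assume x: "\<not> x \<le> real B"
  show False
  proof (cases "x \<le> real B + 1")
    case True
    then have "0 < (real B + 2) * (x - real B)" using x by simp
    then show False using U_middle[of x] True x assms by (simp add: algebra_simps)
  next
    case False
    then show False using U_outer[of x] assms by simp
  qed
qed

lemma U_ge: "real B \<le> x \<Longrightarrow> real B - x \<le> U x"
  unfolding U_def by simp

lemma U_ge_eq_imp:
  assumes "U x = real B - x" "U x < 0"
  shows "real B + 1 \<le> x"
proof (rule ccontr)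
  assume x: "\<not> real B + 1 \<le> x"
  show False
  proof (cases "x \<le> real B")
    case True
    then show False using U_inner assms by force
  next
    case False
    then have "0 < real B * (real B + 1 - x)" using x B1 by simp
    then show False using U_middle[of x] False x assms by (simp add: algebra_simps)
  qed
qed

lemma U_neg_imp: "U x < 0 \<Longrightarrow> 0 \<le> x \<Longrightarrow> real B < x"
  using U_inner[of x] by (cases "x \<le> real B") auto

lemma U_less_B: "x \<noteq> real B \<Longrightarrow> U x < real B"
proof (cases "x \<le> real B")
  case False
  then have "0 < (real B + 1) * (x - real B)" by simp
  then have "max (real B - (real B + 1) * (x - real B)) (real B - x) < real B" using False B1 by simp
  then show ?thesis unfolding U_def by (rule min.strict_coboundedI2)
qed (use U_inner in simp)

lemma U_le_B: "U x \<le> real B"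
  using U_less_B[of x] U_inner[of x] by (cases "x = real B") auto

lemma U_ge_K: "0 \<le> x \<Longrightarrow> x \<le> real N \<Longrightarrow> - real K \<le> U x"
  using U_ge[of x] U_inner[of x] by (cases "x \<le> real B") auto

lemma U_strict_antimono:
  assumes "real B \<le> x" "x < y"
  shows "U y < U x"
proof -
  have m: "(real B + 1) * x < (real B + 1) * y" using assms by simp
  have U: "U z = max (real B - (real B + 1) * (z - real B)) (real B - z)" if "real B \<le> z" for z
  proof (cases "z \<le> real B + 1")
    case True
    have "0 \<le> real B * (real B + 1 - z)" using True by simp
    then show ?thesis using U_middle[OF that True] by (simp add: algebra_simps)
  next
    case False
    then have "0 \<le> real B * (z - (real B + 1))" by simp
    then show ?thesis using U_outer[of z] False by (simp add: algebra_simps)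
  qed
  show ?thesis using U[of x] U[of y] assms m by (simp add: algebra_simps max_def)
qed

lemma U_0 [simp]: "U 0 = 0"
  using U_inner by simp

lemma V_0 [simp]: "V 0 = 0"
  unfolding V_def by simp

lemma V_le_1: "0 \<le> x \<Longrightarrow> x \<le> 1 \<Longrightarrow> V x = (real K + 1) * x"
proof -
  assume x: "0 \<le> x" "x \<le> 1"
  then have "real K * x \<le> real K" by (simp add: mult_left_le)
  then show ?thesis unfolding V_def using x B1 by (simp add: algebra_simps)
qed

lemma V_ge_1: "1 \<le> x \<Longrightarrow> x \<le> real B \<Longrightarrow> V x = x + real K"
proof -
  assume x: "1 \<le> x" "x \<le> real B"
  then have "real K * 1 \<le> real K * x" by (intro mult_left_mono) auto
  then show ?thesis unfolding V_def using x by (simp add: algebra_simps)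
qed

lemma V_ge_B: "real B \<le> x \<Longrightarrow> V x = real N"
proof -
  assume x: "real B \<le> x"
  then have "real K * 1 \<le> real K * x" using B1 by (intro mult_left_mono) auto
  then show ?thesis unfolding V_def using x by (simp add: algebra_simps)
qed

lemma V_le: "V x \<le> x + real K" and V_le_N: "V x \<le> real N"
  unfolding V_def by simp_all

lemma V_eq_imp: "V x = x + real K \<Longrightarrow> 1 \<le> K \<Longrightarrow> 1 \<le> x \<and> x \<le> real B"
proof -
  assume x: "V x = x + real K" "1 \<le> K"
  then have "x + real K \<le> (real K + 1) * x" "x + real K \<le> real N" unfolding V_def by linarith+
  then have "real K * 1 \<le> real K * x" "x \<le> real B" by (auto simp: algebra_simps)
  then show ?thesis using x(2) by (simp add: mult_le_cancel_left_pos)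
qed

lemma V_pos: "0 < x \<Longrightarrow> 0 < V x"
  unfolding V_def using B1 by simp

lemma V_nonneg: "0 \<le> x \<Longrightarrow> 0 \<le> V x"
  using V_pos[of x] by (cases "x = 0") auto

lemma V_mono: "x \<le> y \<Longrightarrow> V x \<le> V y"
  unfolding V_def by (intro min.mono mult_left_mono add_right_mono order_refl) auto

lemma F_node_0: "0 \<le> x \<Longrightarrow> F (node 0 x) = arm 1 j (U x)"
  unfolding F_def using N_pos by (simp add: rad_node)

lemma F_node_1: "0 \<le> x \<Longrightarrow> F (node 1 x) = node 2 (V x)"
  unfolding F_def using N_pos by (simp add: rad_node arm_def)

lemma F_node_2: "0 \<le> x \<Longrightarrow> F (node 2 x) = node 0 x"
  unfolding F_def using N_pos by (simp add: rad_node arm_def)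

lemma F_0: "F 0 = 0"
  using F_node_2[of 0] by simp

lemma F_image: "F ` triod \<subseteq> triod"
proof (rule image_subsetI)
  fix z assume "z \<in> triod"
  then obtain i x where x: "i < 3" "0 \<le> x" "x \<le> real N" "z = node i x" using triod_node by blast
  have "arm 1 j (U x) \<in> triod"
    using U_le_B[of x] U_ge_K[of x] x
    by (cases "0 \<le> U x") (auto simp: arm_nonneg arm_nonpos j3 intro!: node_in_triod)
  moreover have "node 2 (V x) \<in> triod"
    using V_nonneg V_le_N x by (intro node_in_triod) auto
  moreover have "node 0 x \<in> triod" using x by (intro node_in_triod) auto
  ultimately show "F z \<in> triod"
    using less_3_cases[OF x(1)] x F_node_0 F_node_1 F_node_2 by metis
qed

lemma continuous_F: "continuous_on S F"
  unfolding F_def arm_def node_def U_def V_def by (intro continuous_intros) (use N_pos in auto)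

lemma F_fixed:
  assumes "z \<in> triod" "F z = z"
  shows "z = 0"
proof (rule ccontr)
  assume "z \<noteq> 0"
  then obtain i where "i < 3" "z \<in> b i" using assms in_some_b by blast
  then obtain x where x: "i < 3" "0 < x" "x \<le> real N" "z = node i x" using b_node by blast
  show False
    using less_3_cases[OF x(1)]
  proof (elim disjE)
    assume i: "i = 0"
    then have *: "arm 1 j (U x) = node 0 x" using assms x F_node_0 by simp
    show False
    proof (cases "0 \<le> U x")
      case True
      then show False using * x by (simp add: arm_nonneg node_eq_iff)
    next
      case False
      then have "- U x = x" using * x j3 by (simp add: arm_nonpos node_eq_iff)
      then show False using U_ge[of x] U_neg_imp[of x] False x B1 by simp
    qed
  next
    assume i: "i = 1"
    then show False using assms x F_node_1[of x] V_nonneg[of x] by (simp add: node_eq_iff)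
  next
    assume i: "i = 2"
    then show False using assms x F_node_2[of x] by (simp add: node_eq_iff)
  qed
qed

lemma F_triod_maps: "F \<in> triod_maps"
  unfolding triod_maps_def using continuous_F F_image F_fixed F_0 by auto

section \<open>The cycle of the model\<close>

text \<open>Branch 2 receives K + 1, ..., N from \<open>b 1\<close>, and in the red case also 1,
  ..., K from the nonblack points of \<open>b 0\<close>. This makes 3B + K points with green and 3B
  + 2K with red.\<close>

definition in_P :: "nat \<Rightarrow> nat \<Rightarrow> bool" where
  "in_P i n \<longleftrightarrow> i = 0 \<and> 1 \<le> n \<and> n \<le> N \<or> i = 1 \<and> 1 \<le> n \<and> n \<le> B \<or>
     i = 2 \<and> (if j = 0 then K + 1 else 1) \<le> n \<and> n \<le> N"

definition P :: "complex set" where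
  "P = {node i (real n) |i n. in_P i n}"

lemma in_P_bounds: "in_P i n \<Longrightarrow> i < 3 \<and> 1 \<le> n \<and> n \<le> N"
  unfolding in_P_def by (auto split: if_splits)

lemma F_P_0: "1 \<le> n \<Longrightarrow> n \<le> B \<Longrightarrow> F (node 0 (real n)) = node 1 (real n)"
  using F_node_0[of "real n"] U_inner[of "real n"] by (simp add: arm_nonneg)

lemma F_P_0': "B + 1 \<le> n \<Longrightarrow> F (node 0 (real n)) = node j (real (n - B))"
  using F_node_0[of "real n"] U_outer[of "real n"] by (simp add: arm_nonpos)

lemma F_P_1: "1 \<le> n \<Longrightarrow> n \<le> B \<Longrightarrow> F (node 1 (real n)) = node 2 (real (n + K))"
  using F_node_1[of "real n"] V_ge_1[of "real n"] by simp

lemma F_P_2: "F (node 2 (real n)) = node 0 (real n)"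
  using F_node_2 by simp

lemma P_node: "in_P i n \<Longrightarrow> node i (real n) \<in> P"
  unfolding P_def by blast

lemma F_in_P: "z \<in> P \<Longrightarrow> F z \<in> P"
proof -
  assume "z \<in> P"
  then obtain i n where z: "z = node i (real n)" "in_P i n" unfolding P_def by blast
  consider "i = 0" "1 \<le> n" "n \<le> B" | "i = 0" "B + 1 \<le> n" "n \<le> N" | "i = 1" "1 \<le> n" "n \<le> B"
    | "i = 2" "1 \<le> n" "n \<le> N"
    using z(2) unfolding in_P_def by (cases "n \<le> B") (auto split: if_splits)
  then show ?thesis
  proof cases
    case 1
    then show ?thesis using z F_P_0 P_node[of 1 n] unfolding in_P_def by simp
  next
    case 2
    then have "in_P j (n - B)" using j unfolding in_P_def by auto
    then show ?thesis using z(1) 2(1) F_P_0'[OF 2(2)] P_node by metis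
  next
    case 3
    then have "in_P 2 (n + K)" unfolding in_P_def by auto
    then show ?thesis using z 3 F_P_1[of n] P_node[of 2 "n + K"] by simp
  next
    case 4
    then have "in_P 0 n" unfolding in_P_def by auto
    then show ?thesis using z 4 F_P_2[of n] P_node[of 0 n] by simp
  qed
qed

lemma exchange_step:
  assumes R: "\<And>z. z \<in> R \<Longrightarrow> F z \<in> R" and n: "1 \<le> n" "n \<le> N" "node 0 (real n) \<in> R"
  shows "node 0 (real (exchange B K n)) \<in> R"
proof (cases "n \<le> B")
  case True
  have "F (F (F (node 0 (real n)))) \<in> R" using R n(3) by blast
  then show ?thesis using F_P_0[OF n(1) True] F_P_1[OF n(1) True] F_P_2[of "n + K"] True
    unfolding exchange_def by simp
next
  case False
  then have *: "F (node 0 (real n)) = node j (real (n - B))" by (intro F_P_0') simp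
  show ?thesis
  proof (cases "j = 0")
    case True
    then show ?thesis using R[OF n(3)] * False unfolding exchange_def by simp
  next
    case j0: False
    then have "F (F (node 0 (real n))) = node 0 (real (n - B))" using * j F_P_2[of "n - B"] by simp
    then show ?thesis using R[OF R[OF n(3)]] False unfolding exchange_def by simp
  qed
qed

text \<open>Transitivity of the exchange reaches every node of \<open>P\<close> on
  \<open>b 0\<close>, and the remaining points of \<open>P\<close> are forward images of those.
  Stated for all invariant sets, it yields both that \<open>P\<close> is a single orbit and that the
  orbit closes up.\<close>

lemma P_subset:
  assumes R: "\<And>z. z \<in> R \<Longrightarrow> F z \<in> R" and n: "1 \<le> n" "n \<le> N" "node 0 (real n) \<in> R"
  shows "P \<subseteq> R"
proof -
  have pow: "node 0 (real ((exchange B K ^^ m) n)) \<in> R" for m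
  proof (induction m)
    case (Suc m)
    then show ?case
      using exchange_step[OF R, of "(exchange B K ^^ m) n"] exchange_pow_range[OF n(1,2), of m] by simp
  qed (use n in simp)
  have R0: "node 0 (real l) \<in> R" if "1 \<le> l" "l \<le> N" for l
    using exchange_transitive[OF coprime_BK B1 n(1,2) that] pow by metis
  have R1: "node 1 (real l) \<in> R" if "1 \<le> l" "l \<le> B" for l
    using R[OF R0[of l]] F_P_0[of l] that by simp
  show ?thesis
  proof
    fix z assume "z \<in> P"
    then obtain i l where z: "z = node i (real l)" "in_P i l" unfolding P_def by blast
    consider "i = 0" "1 \<le> l" "l \<le> N" | "i = 1" "1 \<le> l" "l \<le> B" | "i = 2" "K + 1 \<le> l" "l \<le> N"
      | "i = 2" "j = 2" "1 \<le> l" "l \<le> K"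
      using z(2) j unfolding in_P_def by (cases "K + 1 \<le> l") (auto split: if_splits)
    then show "z \<in> R"
    proof cases
      case 3
      then have "F (node 1 (real (l - K))) = node 2 (real l)" using F_P_1[of "l - K"] by simp
      then show ?thesis using R[OF R1[of "l - K"]] 3 z by simp
    next
      case 4
      then have "F (node 0 (real (B + l))) = node 2 (real l)" using F_P_0'[of "B + l"] by simp
      then show ?thesis using R[OF R0[of "B + l"]] 4 z by simp
    qed (use R0 R1 z in auto)
  qed
qed

lemma cycle_P: "(F, P) \<in> cycles"
proof -
  let ?x = "node 0 (real 1)"
  have x: "?x \<in> P" using P_node[of 0 1] B1 unfolding in_P_def by simp
  \<comment> \<open>Only positive iterates are collected, so \<open>?x \<in> R\<close> says that
    \<open>?x\<close> is periodic.\<close>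
  define R where "R = {(F ^^ m) ?x |m. 0 < m}"
  have R: "F z \<in> R" if zR: "z \<in> R" for z
  proof -
    obtain m where "z = (F ^^ m) ?x" using zR unfolding R_def by blast
    then have "F z = (F ^^ Suc m) ?x" by simp
    then show ?thesis unfolding R_def by blast
  qed
  have "?x \<in> R"
  proof -
    have "F ?x \<in> R" unfolding R_def by (intro CollectI exI[of _ 1]) simp
    then have F3: "F (F (F ?x)) \<in> R" using R by blast
    have "F (F (F ?x)) = node 0 (real (1 + K))"
      using F_P_0[of 1] F_P_1[of 1] F_P_2[of "1 + K"] B1 by simp
    then have "node 0 (real (1 + K)) \<in> R" using F3 by simp
    then have "P \<subseteq> R" using P_subset[OF R, of "1 + K"] B1 by simp
    then show ?thesis using x by blast
  qed
  then obtain m where m: "0 < m" "(F ^^ m) ?x = ?x" unfolding R_def by auto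
  have "(F ^^ i) ?x \<in> P" for i by (induction i) (use x F_in_P in auto)
  moreover have "P \<subseteq> range (\<lambda>i. (F ^^ i) ?x)"
  proof -
    have "P \<subseteq> R" using P_subset[OF R, of 1] \<open>?x \<in> R\<close> B1 by simp
    then show ?thesis unfolding R_def by blast
  qed
  ultimately have "P = range (\<lambda>i. (F ^^ i) ?x)" by blast
  moreover have "?x \<in> triod" using B1 by (intro node_in_triod) auto
  ultimately have "periodic_orbit F P" unfolding periodic_orbit_def using m by blast
  moreover have "?x \<noteq> 0" using node_eq_iff[of 0 0 1 0] by simp
  then have "P \<noteq> {0}" using x by blast
  ultimately show ?thesis unfolding cycles_def using F_triod_maps by blast
qed

lemma black_node_0: "1 \<le> n \<Longrightarrow> n \<le> B \<Longrightarrow> black b F (node 0 (real n))"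
  using black_iff[OF cycle_P P_node[of 0 n], of 0] F_P_0[of n] by (simp add: in_P_def node_in_b_iff)

lemma black_other: "z \<in> P \<Longrightarrow> i < 3 \<Longrightarrow> i \<noteq> 0 \<Longrightarrow> z \<in> b i \<Longrightarrow> black b F z"
proof -
  assume z: "z \<in> P" and i: "i < 3" "i \<noteq> 0" "z \<in> b i"
  then obtain k n where k: "z = node k (real n)" "in_P k n" unfolding P_def by blast
  have n: "k < 3" "1 \<le> n" "n \<le> N" using in_P_bounds k by auto
  then have "k = i" using i(1,3) k(1) by (simp add: node_in_b_iff)
  consider "i = 1" "n \<le> B" | "i = 2" using less_3_cases[OF i(1)] i(2) k(2) \<open>k = i\<close> unfolding in_P_def by auto
  then show ?thesis
  proof cases
    case 1
    then have "F z = node 2 (real (n + K))" using k \<open>k = i\<close> F_P_1[of n] n by simp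
    then have "F z \<in> b 2" using node_in_b_iff[of 2 2 "real (n + K)"] 1 n by simp
    then show ?thesis using black_iff[OF cycle_P z i(1,3)] 1 by (simp add: numeral_2_eq_2)
  next
    case 2
    then have "F z = node 0 (real n)" using k \<open>k = i\<close> F_P_2[of n] by simp
    then have "F z \<in> b 0" using node_in_b_iff[of 0 0 "real n"] n by simp
    then show ?thesis using black_iff[OF cycle_P z i(1,3)] 2 by simp
  qed
qed

lemma nonblack_node_0: "1 \<le> K \<Longrightarrow> node 0 (real N) \<in> P \<inter> b 0 \<and> \<not> black b F (node 0 (real N))"
proof -
  assume K: "1 \<le> K"
  have P0: "node 0 (real N) \<in> P" using P_node[of 0 N] B1 unfolding in_P_def by simp
  have b0: "node 0 (real N) \<in> b 0" using node_in_b_iff[of 0 0 "real N"] N_pos by simp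
  have "F (node 0 (real N)) = node j (real K)" using F_P_0'[of N] K by simp
  then have "F (node 0 (real N)) \<notin> b 1" using node_in_b_iff[of j 1 "real K"] j3 j_ne_1 by simp
  then show ?thesis using P0 b0 black_iff[OF cycle_P P0 _ b0] by simp
qed

lemma canonical_P: "canonical_for_cycle b F P"
  unfolding canonical_for_cycle_def
proof (intro allI impI)
  fix i :: nat assume i: "i < 3"
  \<comment> \<open>The lowest node on each branch; in the green case nothing is sent to 1, ..., K
    on branch 2.\<close>
  define m where "m = (if i = 2 \<and> j = 0 then K + 1 else 1)"
  have m: "in_P i m" "1 \<le> m" "m \<le> N"
    using less_3_cases[OF i] B1 unfolding in_P_def m_def by (auto split: if_splits)
  have mb: "node i (real m) \<in> b i" using node_in_b_iff[OF i i, of "real m"] m by simp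
  have "norm (node i (real m)) \<le> norm y" if y: "y \<in> P \<inter> b i" for y
  proof -
    obtain k n where k: "y = node k (real n)" "in_P k n" using y unfolding P_def by blast
    then have n: "k < 3" "1 \<le> n" "n \<le> N" using in_P_bounds by auto
    then have "k = i" using k(1) y node_in_b_iff[of k i "real n"] i by simp
    then have "m \<le> n" using k(2) n(2) unfolding m_def in_P_def by auto
    then show ?thesis using k \<open>k = i\<close> i N_pos by (simp add: norm_node divide_right_mono)
  qed
  moreover have "black b F (node i (real m))"
  proof (cases "i = 0")
    case True
    then show ?thesis using black_node_0[of m] B1 unfolding m_def by simp
  next
    case False
    then show ?thesis using black_other[OF P_node[OF m(1)] i _ mb] by simp
  qed
  ultimately show "\<exists>x\<in>P \<inter> b i. (\<forall>y\<in>P \<inter> b i. norm x \<le> norm y) \<and> black b F x"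
    using P_node[OF m(1)] mb by blast
qed

lemma spans_P: "spans P"
  using canonical_spans cycle_P canonical_P by blast

section \<open>Linearity of the model map\<close>

lemma triod_dist_arm:
  assumes "k < 3" "l < 3" "k \<noteq> l" "\<bar>x\<bar> \<le> real N" "\<bar>y\<bar> \<le> real N"
  shows "triod_dist (arm k l x) (arm k l y) = \<bar>x - y\<bar> / real N"
proof -
  have same: "triod_dist (node i s) (node i t) = \<bar>s - t\<bar> / real N"
    if "i < 3" "0 \<le> s" "s \<le> real N" "0 \<le> t" "t \<le> real N" for i s t
    unfolding node_def using that N_pos
    by (subst triod_dist_same) (auto simp flip: diff_divide_distrib)
  have other: "triod_dist (node i s) (node i' t) = (s + t) / real N"
    if "i < 3" "i' < 3" "i \<noteq> i'" "0 \<le> s" "0 \<le> t" for i i' s t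
    unfolding node_def using that N_pos by (subst triod_dist_other) (auto simp: add_divide_distrib)
  consider "0 \<le> x" "0 \<le> y" | "0 \<le> x" "y \<le> 0" | "x \<le> 0" "0 \<le> y" | "x \<le> 0" "y \<le> 0" by linarith
  then show ?thesis
  proof cases
    case 1
    then show ?thesis using assms same[of k x y] by (simp add: arm_nonneg)
  next
    case 2
    then show ?thesis using assms other[of k l x "- y"] by (simp add: arm_nonneg arm_nonpos)
  next
    case 3
    then show ?thesis using assms other[of l k "- x" y] by (simp add: arm_nonneg arm_nonpos)
  next
    case 4
    then show ?thesis
      using assms same[of l "- x" "- y"] abs_minus_commute[of x y] by (simp add: arm_nonpos)
  qed
qed

text \<open>\<open>arm\<close> is isometric up to the factor \<open>N\<close>, so a real affine
  formula in the signed coordinate has constant speed even where the image crosses 0.\<close>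

lemma affine_on_arm:
  assumes i: "i < 3" and kl: "k < 3" "l < 3" "k \<noteq> l" and ac: "0 \<le> a" "0 \<le> c" and t: "0 \<le> t" "t \<le> 1"
    and F: "\<And>x. min a c \<le> x \<Longrightarrow> x \<le> max a c \<Longrightarrow> F (node i x) = arm k l (\<alpha> * x + \<beta>) \<and> \<bar>\<alpha> * x + \<beta>\<bar> \<le> real N"
  defines "z \<equiv> (1 - t) *\<^sub>R node i a + t *\<^sub>R node i c"
  shows "triod_dist (F (node i a)) (F z) = t * triod_dist (F (node i a)) (F (node i c))"
    and "triod_dist (F z) (F (node i c)) = (1 - t) * triod_dist (F (node i a)) (F (node i c))"
proof -
  define s where "s = (1 - t) * a + t * c"
  have z: "z = node i s"
    unfolding z_def s_def node_def pt_def by (simp add: scaleR_add_left add_divide_distrib)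
  have "0 \<le> (1 - t) * (a - min a c)" "0 \<le> t * (c - min a c)" "0 \<le> (1 - t) * (max a c - a)" "0 \<le> t * (max a c - c)"
    using t by auto
  then have s: "min a c \<le> s" "s \<le> max a c" unfolding s_def by (simp_all add: algebra_simps)
  have sa: "s - a = t * (c - a)" and sc: "s - c = (1 - t) * (a - c)"
    unfolding s_def by (simp_all add: algebra_simps)
  have Fa: "F (node i a) = arm k l (\<alpha> * a + \<beta>)" "\<bar>\<alpha> * a + \<beta>\<bar> \<le> real N"
    and Fc: "F (node i c) = arm k l (\<alpha> * c + \<beta>)" "\<bar>\<alpha> * c + \<beta>\<bar> \<le> real N"
    and Fs: "F (node i s) = arm k l (\<alpha> * s + \<beta>)" "\<bar>\<alpha> * s + \<beta>\<bar> \<le> real N"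
    using F[of a] F[of c] F[of s] s by auto
  have d: "triod_dist (arm k l (\<alpha> * x + \<beta>)) (arm k l (\<alpha> * y + \<beta>)) = \<bar>\<alpha>\<bar> * \<bar>x - y\<bar> / real N"
    if "\<bar>\<alpha> * x + \<beta>\<bar> \<le> real N" "\<bar>\<alpha> * y + \<beta>\<bar> \<le> real N" for x y
    using triod_dist_arm[OF kl that] by (simp flip: right_diff_distrib abs_mult)
  have "\<bar>a - s\<bar> = t * \<bar>a - c\<bar>" using sa t by (metis abs_minus_commute abs_mult abs_of_nonneg)
  then show "triod_dist (F (node i a)) (F z) = t * triod_dist (F (node i a)) (F (node i c))"
    unfolding z Fa(1) Fs(1) Fc(1) using d[OF Fa(2) Fs(2)] d[OF Fa(2) Fc(2)] by simp
  have "\<bar>s - c\<bar> = (1 - t) * \<bar>a - c\<bar>" using sc t by (simp add: abs_mult)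
  then show "triod_dist (F z) (F (node i c)) = (1 - t) * triod_dist (F (node i a)) (F (node i c))"
    unfolding z Fa(1) Fs(1) Fc(1) using d[OF Fs(2) Fc(2)] d[OF Fa(2) Fc(2)] by simp
qed

lemma hull_node_0: "0 \<le> x \<Longrightarrow> x \<le> real N \<Longrightarrow> node 0 x \<in> triod_hull P"
  and hull_node_2: "0 \<le> x \<Longrightarrow> x \<le> real N \<Longrightarrow> node 2 x \<in> triod_hull P"
  and hull_node_1: "0 \<le> x \<Longrightarrow> x \<le> real B \<Longrightarrow> node 1 x \<in> triod_hull P"
proof -
  have *: "node i x \<in> triod_hull P" if "i < 3" "in_P i n" "0 \<le> x" "x \<le> real n" for i n x
    unfolding node_def
    using that in_P_bounds[OF that(2)] N_pos
    by (intro hull_radius[OF spans_P P_node[OF that(2)] that(1)])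
       (auto simp: node_in_b_iff norm_node divide_right_mono)
  show "0 \<le> x \<Longrightarrow> x \<le> real N \<Longrightarrow> node 0 x \<in> triod_hull P"
    using *[of 0 N x] B1 unfolding in_P_def by simp
  show "0 \<le> x \<Longrightarrow> x \<le> real N \<Longrightarrow> node 2 x \<in> triod_hull P"
    using *[of 2 N x] B1 unfolding in_P_def by auto
  show "0 \<le> x \<Longrightarrow> x \<le> real B \<Longrightarrow> node 1 x \<in> triod_hull P"
    using *[of 1 B x] B1 unfolding in_P_def by simp
qed

lemma hull_node_1_imp: "0 \<le> x \<Longrightarrow> node 1 x \<in> triod_hull P \<Longrightarrow> x \<le> real B"
proof -
  assume x: "0 \<le> x" "node 1 x \<in> triod_hull P"
  then obtain i s y where y: "node 1 x = pt i s" "i < 3" "0 \<le> s" "y \<in> P \<inter> b i" "s \<le> norm y"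
    unfolding hull_eq[OF spans_P] by blast
  obtain k n where k: "y = node k (real n)" "in_P k n" using y(4) unfolding P_def by blast
  have n: "k < 3" "1 \<le> n" using in_P_bounds k by auto
  have ki: "k = i" using y(2,4) k n node_in_b_iff[of k i "real n"] by simp
  have "x = real N * s \<and> (i = 1 \<or> x = 0)"
    using y(1) x(1) y(2,3) N_pos unfolding pt_node by (subst (asm) node_eq_iff) auto
  then consider "x = 0" | "i = 1" "x = real N * s" by blast
  then show ?thesis
  proof cases
    case 2
    then have "n \<le> B" using k(2) ki unfolding in_P_def by simp
    moreover have "s \<le> real n / real N" using y(5) k n by (simp add: norm_node)
    then have "x \<le> real n" using 2 N_pos by (simp add: field_simps)
    ultimately show ?thesis by simp
  qed simp
qed

text \<open>The breakpoints of the profiles are at points of \<open>P\<close>: \<open>B\<close> and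
  \<open>B + 1\<close> on \<open>b 0\<close> (the latter exceeds \<open>N\<close> if
  \<open>K = 0\<close>), 1 and \<open>B\<close> on \<open>b 1\<close>, where the hull ends at
  \<open>B\<close>. Hence one affine formula is valid on each component.\<close>

lemma linear_F: "is_linear_map_of F P F"
  unfolding is_linear_map_of_def
proof (intro conjI ballI)
  show "continuous_on triod F" by (rule continuous_F)
  show "F ` triod \<subseteq> triod" by (rule F_image)
  show "F 0 = 0" by (rule F_0)
  show "F constant_on C" if C: "C \<in> components (triod - triod_hull P)" for C
  proof -
    have "C \<subseteq> triod - triod_hull P" using in_components_subset[OF C] .
    have "F z = node 2 (real N)" if "z \<in> C" for z
    proof -
      have z: "z \<in> triod" "z \<notin> triod_hull P" using that \<open>C \<subseteq> triod - triod_hull P\<close> by auto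
      then obtain i x where x: "i < 3" "0 \<le> x" "x \<le> real N" "z = node i x" using triod_node by blast
      have "i = 1" using less_3_cases[OF x(1)] hull_node_0[OF x(2,3)] hull_node_2[OF x(2,3)] z(2) x(4) by auto
      then have "real B \<le> x" using hull_node_1[of x] x z(2) by force
      then show ?thesis using x \<open>i = 1\<close> F_node_1[of x] V_ge_B by simp
    qed
    then show ?thesis unfolding constant_on_def by blast
  qed
  show "affine_on_segment F C" if C: "C \<in> components (triod_hull P - (P \<union> {0}))" for C
  proof -
    have sub: "C \<subseteq> triod_hull P - (P \<union> {0})" using in_components_subset[OF C] .
    have con: "connected C" using in_components_connected[OF C] .
    have tri: "C \<subseteq> triod" using sub hull_subset_triod[OF spans_P] by blast
    have no: "node i x \<notin> C" if "in_P i n" "x = real n" for i n x using sub P_node that by blast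
    show ?thesis
      unfolding affine_on_segment_def
    proof (intro ballI)
      fix x y and t :: real assume xy: "x \<in> C" "y \<in> C" and "t \<in> {0..1}"
      then have t: "0 \<le> t" "t \<le> 1" by auto
      obtain i where i: "i < 3" "x \<in> b i" using in_some_b[of x] xy(1) sub tri by blast
      have "C \<subseteq> b i" using connected_subset_b[OF con tri _ i(1) xy(1) i(2)] sub by blast
      then obtain a c where a: "0 < a" "a \<le> real N" "x = node i a" and c: "0 < c" "c \<le> real N" "y = node i c"
        using b_node[OF i(1)] xy by blast
      have bounds: "0 \<le> x" "x \<le> real N" if "min a c \<le> x" "x \<le> max a c" for x
        using that a c by (auto simp: min_le_iff_disj le_max_iff_disj)
      \<comment> \<open>A node between \<open>x\<close> and \<open>y\<close> would belong to the
        connected set \<open>C\<close>, which avoids \<open>P\<close>.\<close>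
      have barrier: "a < real n \<longleftrightarrow> c < real n" if n: "in_P i n" for n
      proof (rule ccontr)
        assume ne: "\<not> ?thesis"
        have nn: "0 < real n" using in_P_bounds[OF n] by simp
        have "a / real N \<le> real n / real N \<and> real n / real N \<le> c / real N \<or>
            c / real N \<le> real n / real N \<and> real n / real N \<le> a / real N"
          using ne by (auto simp: divide_right_mono)
        then have "node i (real n) \<in> C"
          using connected_radii[OF con tri i(1), of "a / real N" "c / real N" "real n / real N"]
            connected_radii[OF con tri i(1), of "c / real N" "a / real N" "real n / real N"] xy a c
          unfolding node_def by auto
        then show False using no[OF n] by blast
      qed
      have "\<exists>k<3. \<exists>l<3. k \<noteq> l \<and> (\<exists>\<alpha> \<beta>. \<forall>x. min a c \<le> x \<and> x \<le> max a c \<longrightarrow>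
          F (node i x) = arm k l (\<alpha> * x + \<beta>) \<and> \<bar>\<alpha> * x + \<beta>\<bar> \<le> real N)"
        using less_3_cases[OF i(1)]
      proof (elim disjE)
        assume i0: "i = 0"
        have Ub: "\<bar>U x\<bar> \<le> real N" if "min a c \<le> x" "x \<le> max a c" for x
          using U_le_B[of x] U_ge_K[of x] bounds[OF that] by (simp add: abs_le_iff)
        have B: "a < real B \<longleftrightarrow> c < real B" using barrier[of B] i0 B1 unfolding in_P_def by simp
        have BK: "a < real (B + 1) \<longleftrightarrow> c < real (B + 1)"
        proof (cases "K = 0")
          case False
          then show ?thesis using barrier[of "B + 1"] i0 unfolding in_P_def by simp
        next
          case True
          then show ?thesis using a c by simp
        qed
        consider "max a c \<le> real B" | "real B \<le> min a c" "max a c \<le> real B + 1" | "real B + 1 \<le> min a c"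
          using B BK by fastforce
        then have "\<exists>\<alpha> \<beta>. \<forall>x. min a c \<le> x \<and> x \<le> max a c \<longrightarrow> U x = \<alpha> * x + \<beta>"
        proof cases
          case 1
          then show ?thesis using U_inner by (intro exI[of _ 1] exI[of _ 0]) auto
        next
          case 2
          then show ?thesis using U_middle
            by (intro exI[of _ "- (real B + 1)"] exI[of _ "real B + (real B + 1) * real B"])
               (auto simp: algebra_simps)
        next
          case 3
          then show ?thesis using U_outer by (intro exI[of _ "-1"] exI[of _ "real B"]) auto
        qed
        then obtain \<alpha> \<beta> where ab: "\<And>x. min a c \<le> x \<Longrightarrow> x \<le> max a c \<Longrightarrow> U x = \<alpha> * x + \<beta>" by blast
        have "F (node i x) = arm 1 j (\<alpha> * x + \<beta>) \<and> \<bar>\<alpha> * x + \<beta>\<bar> \<le> real N"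
          if x: "min a c \<le> x" "x \<le> max a c" for x
        proof -
          have "0 \<le> x" using bounds[OF x] by blast
          then show ?thesis using ab[OF x] Ub[OF x] F_node_0[of x] i0 by simp
        qed
        then show ?thesis using j3 j_ne_1
          by (intro exI[of _ 1] exI[of _ j] conjI exI[of _ \<alpha>] exI[of _ \<beta>]) auto
      next
        assume i1: "i = 1"
        have "a \<le> real B" "c \<le> real B" using hull_node_1_imp[of a] hull_node_1_imp[of c] a c xy sub i1 by auto
        moreover have "a < real 1 \<longleftrightarrow> c < real 1" using barrier[of 1] i1 B1 unfolding in_P_def by simp
        ultimately consider "max a c \<le> 1" | "1 \<le> min a c" "max a c \<le> real B" by fastforce
        then have "\<exists>\<alpha> \<beta>. \<forall>x. min a c \<le> x \<and> x \<le> max a c \<longrightarrow> V x = \<alpha> * x + \<beta>"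
        proof cases
          case 1
          then show ?thesis using V_le_1 a c by (intro exI[of _ "real K + 1"] exI[of _ 0]) auto
        next
          case 2
          then show ?thesis using V_ge_1 by (intro exI[of _ 1] exI[of _ "real K"]) auto
        qed
        then obtain \<alpha> \<beta> where ab: "\<And>x. min a c \<le> x \<Longrightarrow> x \<le> max a c \<Longrightarrow> V x = \<alpha> * x + \<beta>" by blast
        have "F (node i x) = arm 2 0 (\<alpha> * x + \<beta>) \<and> \<bar>\<alpha> * x + \<beta>\<bar> \<le> real N"
          if x: "min a c \<le> x" "x \<le> max a c" for x
        proof -
          have "0 \<le> x" using bounds[OF x] by blast
          then show ?thesis using ab[OF x] V_nonneg[of x] V_le_N[of x] F_node_1[of x] i1 by (simp add: arm_nonneg)
        qed
        then show ?thesis by (intro exI[of _ 2] exI[of _ 0] conjI exI[of _ \<alpha>] exI[of _ \<beta>]) auto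
      next
        assume i2: "i = 2"
        have "F (node i x) = arm 0 1 (1 * x + 0) \<and> \<bar>1 * x + 0\<bar> \<le> real N"
          if x: "min a c \<le> x" "x \<le> max a c" for x
        proof -
          have "0 \<le> x" "x \<le> real N" using bounds[OF x] by blast+
          then show ?thesis using F_node_2[of x] i2 by (simp add: arm_nonneg)
        qed
        then show ?thesis by (intro exI[of _ 0] exI[of _ 1] conjI exI[of _ "1 :: real"] exI[of _ "0 :: real"]) auto
      qed
      then obtain k l \<alpha> \<beta> where "k < 3" "l < 3" "k \<noteq> l"
        and Fx: "\<And>x. min a c \<le> x \<Longrightarrow> x \<le> max a c \<Longrightarrow>
          F (node i x) = arm k l (\<alpha> * x + \<beta>) \<and> \<bar>\<alpha> * x + \<beta>\<bar> \<le> real N" by blast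
      then show "triod_dist (F x) (F ((1 - t) *\<^sub>R x + t *\<^sub>R y)) = t * triod_dist (F x) (F y) \<and>
        triod_dist (F ((1 - t) *\<^sub>R x + t *\<^sub>R y)) (F y) = (1 - t) * triod_dist (F x) (F y)"
        using affine_on_arm[OF i(1) _ _ _ less_imp_le[OF a(1)] less_imp_le[OF c(1)] t Fx] a(3) c(3) by blast
    qed
  qed
qed simp

section \<open>Laps of the model map\<close>

text \<open>Up to the turning point \<open>F\<close> permutes the branches cyclically and is
  injective except on the plateau of \<open>V\<close> on \<open>b 1\<close>. A fibre is thus at most
  a point or a segment of that plateau, and the last hypothesis keeps this segment in
  \<open>W\<close>.\<close>

lemma inner_fibre_convex:
  assumes W: "W \<subseteq> triod" "\<And>z. z \<in> W \<Longrightarrow> real N * rad 0 z \<le> real B"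
    and W1: "\<And>z. z \<in> triod \<Longrightarrow> rad 0 z = 0 \<Longrightarrow> z \<in> W"
  shows "convex (F -` {v} \<inter> W)"
  unfolding convex_alt
proof (intro ballI allI impI)
  fix x y and t :: real
  assume x: "x \<in> F -` {v} \<inter> W" and y: "y \<in> F -` {v} \<inter> W" and t: "0 \<le> t \<and> t \<le> 1"
  have form: "\<exists>i x. i < 3 \<and> 0 \<le> x \<and> x \<le> real N \<and> z = node i x \<and>
      F z = (if i = 0 then node 1 x else if i = 1 then node 2 (V x) else node 0 x)" if z: "z \<in> W" for z
  proof -
    obtain i x where x: "i < 3" "0 \<le> x" "x \<le> real N" "z = node i x" using triod_node W z by blast
    have "x \<le> real B" if "i = 0" using W(2)[OF z] that x N_pos by (simp add: rad_node)
    then have "F (node 0 x) = node 1 x" if "i = 0" using that F_node_0[OF x(2)] U_inner[of x] x(2) by (simp add: arm_nonneg)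
    then have "F z = (if i = 0 then node 1 x else if i = 1 then node 2 (V x) else node 0 x)"
      using less_3_cases[OF x(1)] F_node_1[OF x(2)] F_node_2[OF x(2)] x(4) by (elim disjE) simp_all
    then show ?thesis using x by blast
  qed
  obtain i a where a: "i < 3" "0 \<le> a" "a \<le> real N" "x = node i a"
      "F x = (if i = 0 then node 1 a else if i = 1 then node 2 (V a) else node 0 a)"
    using form x by blast
  obtain k c where c: "k < 3" "0 \<le> c" "c \<le> real N" "y = node k c"
      "F y = (if k = 0 then node 1 c else if k = 1 then node 2 (V c) else node 0 c)"
    using form y by blast
  have FF: "F x = F y" using x y by simp
  consider "x = y" | "i = 1" "k = 1" "V a = V c"
    using less_3_cases[OF a(1)] less_3_cases[OF c(1)] FF a c V_nonneg[OF a(2)] V_nonneg[OF c(2)] V_pos[of a] V_pos[of c]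
    by (elim disjE) (auto simp: node_eq_iff order_le_less)
  then show "(1 - t) *\<^sub>R x + t *\<^sub>R y \<in> F -` {v} \<inter> W"
  proof cases
    case 1
    then have "(1 - t) *\<^sub>R x + t *\<^sub>R y = x" by (simp flip: scaleR_add_left)
    then show ?thesis using x by simp
  next
    case 2
    define s where "s = (1 - t) * a + t * c"
    have z: "(1 - t) *\<^sub>R x + t *\<^sub>R y = node 1 s"
      unfolding s_def a(4) c(4) 2 node_def pt_def by (simp add: scaleR_add_left add_divide_distrib)
    have "0 \<le> (1 - t) * (a - min a c)" "0 \<le> t * (c - min a c)" "0 \<le> (1 - t) * (max a c - a)" "0 \<le> t * (max a c - c)"
      using t by auto
    then have s: "min a c \<le> s" "s \<le> max a c" unfolding s_def by (simp_all add: algebra_simps)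
    then have s0: "0 \<le> s" "s \<le> real N" using a c by auto
    have "V s = V a" using V_mono[OF s(1)] V_mono[OF s(2)] 2(3) by (auto simp: min_def max_def split: if_splits)
    then have "F (node 1 s) = v" using F_node_1[OF s0(1)] a(5) 2(1) x by simp
    moreover have "node 1 s \<in> W" using W1[of "node 1 s"] node_in_triod[of 1 s] s0 by (simp add: rad_node)
    ultimately show ?thesis using z by simp
  qed
qed

lemma connected_radial:
  assumes "W \<subseteq> triod" "0 \<in> W" "\<And>i s t. i < 3 \<Longrightarrow> pt i s \<in> W \<Longrightarrow> 0 \<le> t \<Longrightarrow> t \<le> s \<Longrightarrow> pt i t \<in> W"
  shows "connected W"
proof -
  have "closed_segment 0 z \<subseteq> W" if z: "z \<in> W" for z
  proof
    fix y assume "y \<in> closed_segment 0 z"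
    then obtain u where u: "0 \<le> u" "u \<le> 1" "y = u *\<^sub>R z" unfolding closed_segment_def by auto
    obtain i s where s: "i < 3" "0 \<le> s" "z = pt i s" using assms(1) z triod_iff by blast
    have "y = pt i (u * s)" using u s by (simp add: pt_def)
    then show "y \<in> W" using assms(3)[OF s(1), of s "u * s"] z s u by (simp add: mult_left_le_one_le)
  qed
  then have "starlike W" unfolding starlike_def using assms(2) by blast
  then show ?thesis by (rule starlike_imp_connected)
qed

text \<open>Here \<open>B = N = 1\<close>, so no radius exceeds the turning point and the whole
  triod is a set of monotonicity.\<close>

lemma laps_K_0:
  assumes "K = 0"
  shows "laps F = {triod}"
proof -
  have B: "B = 1" using assms coprime_BK by simp
  have "real N * rad 0 z \<le> real B" if "z \<in> triod" for z using rad_le_1[of 0 z] that assms B by simp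
  then have "connected (F -` {v} \<inter> triod)" for v
    by (intro convex_connected inner_fibre_convex) auto
  then have tri: "triod \<in> mono_sets F"
    unfolding mono_sets_def connected_fibres_on_def using connected_triod by simp
  then show ?thesis unfolding laps_eq using mono_sets_subset by blast
qed

text \<open>Both sides of the point of radius \<open>B / N\<close> on \<open>b 0\<close> are sets of
  monotonicity, while the point itself is a peak and lies in none. A lap is therefore contained in
  one side and equals it by maximality.\<close>

lemma laps_K_pos:
  assumes K: "1 \<le> K"
  shows "laps F \<subseteq> {{z \<in> triod. real N * rad 0 z < real B}, {z \<in> triod. real B < real N * rad 0 z}}"
proof -
  let ?L1 = "{z \<in> triod. real N * rad 0 z < real B}" and ?L2 = "{z \<in> triod. real B < real N * rad 0 z}"
  define w where "w = real B / real N"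
  have w: "0 < w" "w < 1" "real N * w = real B" using B1 K unfolding w_def by auto
  have open1: "openin (top_of_set triod) ?L1"
  proof -
    have "?L1 = triod \<inter> {z. real N * rad 0 z < real B}" by blast
    moreover have "open {z. real N * rad 0 z < real B}" by (intro open_Collect_less continuous_intros)
    ultimately show ?thesis by (simp add: openin_open_Int)
  qed
  have open2: "openin (top_of_set triod) ?L2"
  proof -
    have "?L2 = triod \<inter> {z. real B < real N * rad 0 z}" by blast
    moreover have "open {z. real B < real N * rad 0 z}" by (intro open_Collect_less continuous_intros)
    ultimately show ?thesis by (simp add: openin_open_Int)
  qed
  have con1: "connected ?L1"
  proof (rule connected_radial)
    show "?L1 \<subseteq> triod" by blast
    show "0 \<in> ?L1" using B1 by simp
    fix i s t assume i: "i < 3" "pt i s \<in> ?L1" "0 \<le> t" "t \<le> s"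
    have "s \<le> 1" using norm_le_1[of "pt i s"] i by simp
    moreover have "rad 0 (pt i t) \<le> rad 0 (pt i s)" using i by (simp add: rad_pt)
    then have "real N * rad 0 (pt i t) < real B"
      using i(2) mult_left_mono[of "rad 0 (pt i t)" "rad 0 (pt i s)" "real N"] by simp
    ultimately show "pt i t \<in> ?L1" using i pt_in_triod by simp
  qed
  have L2_form: "\<exists>s. w < s \<and> s \<le> 1 \<and> z = pt 0 s" if "z \<in> ?L2" for z
  proof -
    have z: "z \<in> triod" "real B < real N * rad 0 z" using that by auto
    then have "real N * w < real N * rad 0 z" using w by simp
    then have "w < rad 0 z" using N_pos by simp
    moreover have "z = pt 0 (rad 0 z)" using eq_pt_of_rad[of 0 z "rad 0 z"] z(1) w \<open>w < rad 0 z\<close> by simp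
    ultimately show ?thesis using rad_le_1[of 0 z] z(1) by auto
  qed
  have L2: "?L2 = {pt 0 s |s. s \<in> {w<..1}}"
  proof (intro equalityI subsetI)
    fix z assume "z \<in> {pt 0 s |s. s \<in> {w<..1}}"
    then obtain s where s: "w < s" "s \<le> 1" "z = pt 0 s" by auto
    have "real N * w < real N * s" using s N_pos by simp
    then show "z \<in> ?L2" using s w by (auto simp: rad_pt intro: pt_in_triod)
  qed (use L2_form in auto)
  have con2: "connected ?L2"
    unfolding L2 by (rule connected_segment_pts) (simp add: is_interval_connected_1)
  have fib1: "connected (F -` {v} \<inter> ?L1)" for v
    by (intro convex_connected inner_fibre_convex) (use B1 in auto)
  \<comment> \<open>Beyond \<open>B\<close> the profile \<open>U\<close> strictly decreases and
    \<open>arm\<close> is injective, so fibres have at most one point.\<close>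
  have fib2: "connected (F -` {v} \<inter> ?L2)" for v
  proof -
    have "x = y" if L: "x \<in> F -` {v} \<inter> ?L2" "y \<in> F -` {v} \<inter> ?L2" for x y
    proof -
      obtain s where s: "w < s" "s \<le> 1" "x = pt 0 s" using L2_form L(1) by blast
      obtain t where t: "w < t" "t \<le> 1" "y = pt 0 t" using L2_form L(2) by blast
      have xy: "x = node 0 (real N * s)" "y = node 0 (real N * t)" using s t by (simp_all add: pt_node)
      have pos: "real B < real N * s" "real B < real N * t" using s t w N_pos by (metis mult_less_cancel_left_pos)+
      then have U: "arm 1 j (U (real N * s)) = arm 1 j (U (real N * t))"
        using L xy F_node_0[of "real N * s"] F_node_0[of "real N * t"] by simp
      have "\<bar>U (real N * s)\<bar> \<le> real N" "\<bar>U (real N * t)\<bar> \<le> real N"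
        using U_le_B[of "real N * s"] U_ge_K[of "real N * s"] U_le_B[of "real N * t"] U_ge_K[of "real N * t"]
          pos s t N_pos by auto
      then have "U (real N * s) = U (real N * t)"
        using triod_dist_arm[of 1 j "U (real N * s)" "U (real N * t)"] triod_dist_arm[of 1 j "U (real N * s)" "U (real N * s)"]
          U j3 j_ne_1 N_pos by simp
      then have "real N * s = real N * t" using U_strict_antimono pos by (metis less_irrefl less_imp_le linorder_neqE)
      then show ?thesis using xy by metis
    qed
    then have "F -` {v} \<inter> ?L2 = {} \<or> (\<exists>x. F -` {v} \<inter> ?L2 = {x})" by blast
    then show ?thesis by (elim disjE exE) (simp_all only: connected_empty connected_sing)
  qed
  have mono: "?L1 \<in> mono_sets F" "?L2 \<in> mono_sets F"
    unfolding mono_sets_def connected_fibres_on_def using open1 open2 con1 con2 fib1 fib2 by blast+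
  have rad1: "rad 1 (F (pt 0 u)) = max 0 (U (real N * u)) / real N" if "0 \<le> u" for u
    using F_node_0[of "real N * u"] that N_pos j3 j_ne_1
    by (cases "0 \<le> U (real N * u)") (auto simp: pt_node arm_nonneg arm_nonpos rad_node)
  have peak: "rad 1 (F (pt 0 u)) < rad 1 (F (pt 0 w))" if "0 \<le> u" "u \<noteq> w" for u
  proof -
    have "real N * u \<noteq> real B" using that w N_pos by (metis mult_left_cancel less_irrefl)
    then have "max 0 (U (real N * u)) < real B" using U_less_B B1 by simp
    moreover have "U (real N * w) = real B" using w U_inner by simp
    ultimately show ?thesis using rad1[OF that(1)] rad1[of w] w N_pos by (simp add: divide_strict_right_mono)
  qed
  have uncovered: "pt 0 w \<notin> W" if W: "W \<in> mono_sets F" for W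
  proof
    assume wW: "pt 0 w \<in> W"
    show False
    proof (rule peak_not_in_mono_set[OF continuous_F F_image _ _ w(1,2) W wW, of 1])
      show "\<exists>u>w - \<epsilon>. u < w \<and> rad 1 (F (pt 0 u)) < rad 1 (F (pt 0 w))" if "\<epsilon> > 0" for \<epsilon>
        using peak[of "max (w - \<epsilon> / 2) (w / 2)"] w that
        by (intro exI[of _ "max (w - \<epsilon> / 2) (w / 2)"]) (auto simp: max_def)
      show "\<exists>u>w. u < w + \<epsilon> \<and> rad 1 (F (pt 0 u)) < rad 1 (F (pt 0 w))" if "\<epsilon> > 0" for \<epsilon>
        using peak[of "w + \<epsilon> / 2"] w that by (intro exI[of _ "w + \<epsilon> / 2"]) auto
    qed auto
  qed
  show ?thesis
  proof
    fix W assume "W \<in> laps F"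
    then have W: "W \<in> mono_sets F" "\<And>V. V \<in> mono_sets F \<Longrightarrow> W \<subseteq> V \<Longrightarrow> W = V" unfolding laps_eq by auto
    note Wt = mono_sets_subset[OF W(1)] and Wc = mono_sets_connected[OF W(1)]
    have ne: "real N * rad 0 z \<noteq> real B" if z: "z \<in> W" for z
    proof
      assume "real N * rad 0 z = real B"
      then have "rad 0 z = w" using N_pos w(3) by (metis mult_left_cancel less_irrefl)
      then have "z = pt 0 w" using eq_pt_of_rad[of 0 z w] z Wt w by auto
      then show False using uncovered[OF W(1)] z by blast
    qed
    have "W \<subseteq> ?L1 \<or> W \<subseteq> ?L2"
    proof (rule ccontr)
      assume "\<not> ?thesis"
      then obtain x y where xy: "x \<in> W" "\<not> real N * rad 0 x < real B" "y \<in> W" "\<not> real B < real N * rad 0 y"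
        using Wt by blast
      then have "real N * rad 0 y \<le> real N * w" "real N * w \<le> real N * rad 0 x" using w by auto
      then have "rad 0 y \<le> w" "w \<le> rad 0 x" using N_pos by simp_all
      then show False using connected_between[OF Wc Wt _ xy(3,1), of 0 w] w uncovered[OF W(1)] by simp
    qed
    then show "W \<in> {?L1, ?L2}" using W(2) mono by blast
  qed
qed

lemma unimodal_P: "unimodal_cycle F P"
proof -
  have "finite (laps F) \<and> card (laps F) \<le> 2"
  proof (cases "K = 0")
    case True
    then show ?thesis using laps_K_0 by simp
  next
    case False
    then have sub: "laps F \<subseteq> {{z \<in> triod. real N * rad 0 z < real B}, {z \<in> triod. real B < real N * rad 0 z}}"
      using laps_K_pos by simp
    have "card {x, y} \<le> 2" for x y :: "complex set" by (simp add: card_insert_if)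
    then show ?thesis using sub finite_subset[OF sub] card_mono[OF _ sub] by (meson finite.intros order_trans)
  qed
  then show ?thesis unfolding unimodal_cycle_def using linear_F by blast
qed

text \<open>The potential lifts the return map on branch \<open>b 0\<close> to a translation: along
  \<^term>\<open>P\<close> it grows by the displacement minus the rotation number (up to scale), elsewhere
  at most by that amount.\<close>

definition pot :: "complex \<Rightarrow> real" where
  "pot z = real N * (rad 0 z + rad 1 z + rad 2 z) +
     (if z \<in> b 1 then real K / 3 else if z \<in> b 2 then - real K / 3 else 0)"

text \<open>Black returns contribute (1, 3) to total displacement and period, green ones (0, 1), red
  ones (1, 2).\<close>

definition rnum :: nat where "rnum = (if j = 0 then B else B + K)"
definition rden :: nat where "rden = (if j = 0 then 3 * B + K else 3 * B + 2 * K)"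

text \<open>The slack in the growth bound. The rotation number is at most 1/3 for
  \<open>j = 0\<close> and at least 1/3 for \<open>j = 2\<close>; the sign makes the scaled
  contribution of a black step \<open>K / 3\<close> in both cases.\<close>

definition excess :: "complex \<Rightarrow> real" where
  "excess z = (if j = 0 then 1 else - 1) *
     (real rden * real_of_rat (displacement b z (F z)) - real rnum) - (pot (F z) - pot z)"

lemma pot_node:
  assumes "i < 3" "0 < x" "x \<le> real N"
  shows "pot (node i x) = x + (if i = 1 then real K / 3 else if i = 2 then - real K / 3 else 0)"
  unfolding pot_def using less_3_cases[OF assms(1)] assms N_pos
  by (elim disjE) (simp_all add: rad_node node_in_b_iff)

lemma displacement_node:
  assumes "i < 3" "k < 3" "0 < x" "x \<le> real N" "0 < y" "y \<le> real N" "l = (i + k) mod 3"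
  shows "real_of_rat (displacement b (node i x) (node l y)) = real k / 3"
proof -
  have "displacement b (node i x) (node l y) = of_nat k / 3"
    using assms by (intro displacement_eq[of i k]) (auto simp: node_in_b_iff)
  then show ?thesis by (simp only: of_rat_divide of_rat_of_nat_eq of_rat_numeral_eq)
qed

text \<open>The excess becomes the gap between a profile and a line of slope 1 or -1: here the
  diagonal, below the line B - x, and for \<open>V\<close> the line x + K.\<close>

lemma excess_black_0:
  assumes "0 < x" "x \<le> real N" "0 < U x"
  shows "excess (node 0 x) = x - U x"
proof -
  have F: "F (node 0 x) = node 1 (U x)" using F_node_0 assms by (simp add: arm_nonneg)
  have U: "U x \<le> real N" using U_le_B[of x] by simp
  have d: "real_of_rat (displacement b (node 0 x) (node 1 (U x))) = real 1 / 3"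
    using assms U by (intro displacement_node) auto
  have p: "pot (node 0 x) = x" "pot (node 1 (U x)) = U x + real K / 3"
    using pot_node[of 0 x] pot_node[of 1 "U x"] assms U by simp_all
  show ?thesis unfolding excess_def F d p using j by (auto simp: rnum_def rden_def field_simps)
qed

lemma excess_nonblack_0:
  assumes "0 < x" "x \<le> real N" "U x < 0"
  shows "excess (node 0 x) = U x - (real B - x)"
proof -
  have F: "F (node 0 x) = node j (- U x)" using F_node_0 assms by (simp add: arm_nonpos)
  have U: "- U x \<le> real N" using U_ge_K[of x] assms by simp
  have d: "real_of_rat (displacement b (node 0 x) (node j (- U x))) = real j / 3"
    using assms U j by (intro displacement_node) auto
  have p: "pot (node 0 x) = x" "pot (node j (- U x)) = - U x - (if j = 0 then 0 else real K / 3)"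
    using pot_node[of 0 x] pot_node[of j "- U x"] assms U j by auto
  show ?thesis unfolding excess_def F d p using j by (auto simp: rnum_def rden_def field_simps)
qed

lemma excess_1:
  assumes "0 < x" "x \<le> real N"
  shows "excess (node 1 x) = x + real K - V x"
proof -
  have F: "F (node 1 x) = node 2 (V x)" using F_node_1 assms by simp
  have V: "0 < V x" "V x \<le> real N" using V_pos V_le_N assms by auto
  have d: "real_of_rat (displacement b (node 1 x) (node 2 (V x))) = real 1 / 3"
    using assms V by (intro displacement_node) auto
  have p: "pot (node 1 x) = x + real K / 3" "pot (node 2 (V x)) = V x - real K / 3"
    using pot_node[of 1 x] pot_node[of 2 "V x"] assms V by simp_all
  show ?thesis unfolding excess_def F d p using j by (auto simp: rnum_def rden_def field_simps)
qed

lemma excess_2: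
  assumes "0 < x" "x \<le> real N"
  shows "excess (node 2 x) = 0"
proof -
  have F: "F (node 2 x) = node 0 x" using F_node_2 assms by simp
  have d: "real_of_rat (displacement b (node 2 x) (node 0 x)) = real 1 / 3"
    using assms by (intro displacement_node) auto
  have p: "pot (node 2 x) = x - real K / 3" "pot (node 0 x) = x"
    using pot_node[of 2 x] pot_node[of 0 x] assms by simp_all
  show ?thesis unfolding excess_def F d p using j by (auto simp: rnum_def rden_def field_simps)
qed

lemma excess_nonneg:
  assumes "z \<in> triod - {0}" "F z \<noteq> 0"
  shows "0 \<le> excess z"
proof -
  obtain i where "i < 3" "z \<in> b i" using in_some_b assms(1) by blast
  then obtain x where x: "i < 3" "0 < x" "x \<le> real N" "z = node i x" using b_node by blast
  show ?thesis
    using less_3_cases[OF x(1)]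
  proof (elim disjE)
    assume i: "i = 0"
    then have "U x \<noteq> 0" using assms(2) x F_node_0[of x] by (auto simp: arm_nonneg)
    then consider "0 < U x" | "U x < 0" by linarith
    then show ?thesis
    proof cases
      case 1
      then show ?thesis using excess_black_0 x i U_le[of x] by simp
    next
      case 2
      then show ?thesis using excess_nonblack_0 x i U_ge[of x] U_neg_imp[of x] by simp
    qed
  next
    assume "i = 1"
    then show ?thesis using excess_1 x V_le[of x] by simp
  next
    assume "i = 2"
    then show ?thesis using excess_2 x by simp
  qed
qed

lemma excess_P: "z \<in> P \<Longrightarrow> excess z = 0"
proof -
  assume "z \<in> P"
  then obtain i n where z: "z = node i (real n)" "in_P i n" unfolding P_def by blast
  have n: "0 < real n" "real n \<le> real N" using in_P_bounds[OF z(2)] by auto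
  consider "i = 0" "n \<le> B" | "i = 0" "B + 1 \<le> n" | "i = 1" "1 \<le> n" "n \<le> B" | "i = 2"
    using z(2) unfolding in_P_def by (cases "n \<le> B") (auto split: if_splits)
  then show ?thesis
  proof cases
    case 1
    then show ?thesis using z(1) n excess_black_0[of "real n"] U_inner[of "real n"] by simp
  next
    case 2
    then show ?thesis using z(1) n excess_nonblack_0[of "real n"] U_outer[of "real n"] by simp
  next
    case 3
    then show ?thesis using z(1) n excess_1[of "real n"] V_ge_1[of "real n"] by simp
  next
    case 4
    then show ?thesis using z(1) n excess_2[of "real n"] by simp
  qed
qed

lemma rden_pos: "0 < rden"
  unfolding rden_def using B1 by auto

text \<open>The increments of \<open>pot\<close> cancel along a cycle; what remains is, up to sign
  and a positive factor, the rotation number of \<open>Q\<close> minus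
  \<open>rnum / rden\<close>.\<close>

lemma sum_excess_eq_0_iff:
  assumes "(F, Q) \<in> cycles"
  shows "(\<Sum>z\<in>Q. excess z) = 0 \<longleftrightarrow> rot F Q = of_nat rnum / of_nat rden"
proof -
  note Q = cyclesD[OF assms]
  define \<epsilon> :: real where "\<epsilon> = (if j = 0 then 1 else - 1)"
  define S where "S = (\<Sum>z\<in>Q. displacement b z (F z))"
  have pos: "0 < card Q" using Q(3,4) by (simp add: card_gt_0_iff)
  have cob: "(\<Sum>z\<in>Q. pot (F z) - pot z) = 0"
    using sum.reindex_bij_betw[OF Q(5), of pot] by (simp add: sum_subtractf)
  have "(\<Sum>z\<in>Q. excess z) = \<epsilon> * (real rden * real_of_rat S - real (card Q) * real rnum)"
    unfolding excess_def sum_subtractf cob[unfolded sum_subtractf] S_def \<epsilon>_def of_rat_sum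
    by (simp add: sum_subtractf sum_distrib_left sum_negf)
  then have "(\<Sum>z\<in>Q. excess z) = 0 \<longleftrightarrow> real rden * real_of_rat S = real (card Q) * real rnum"
    unfolding \<epsilon>_def by simp
  also have "\<dots> \<longleftrightarrow> real_of_rat (of_nat rden * S) = real_of_rat (of_nat (card Q) * of_nat rnum)"
    by (simp add: of_rat_mult)
  also have "\<dots> \<longleftrightarrow> of_nat rden * S = of_nat (card Q) * of_nat rnum"
    by (rule of_rat_eq_iff)
  also have "\<dots> \<longleftrightarrow> rot F Q = of_nat rnum / of_nat rden"
    unfolding rot_def S_def[symmetric] using pos rden_pos by (auto simp: field_simps)
  finally show ?thesis .
qed

lemma rot_P: "rot F P = of_nat rnum / of_nat rden"
  using sum_excess_eq_0_iff[OF cycle_P] excess_P by simp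

text \<open>A cycle with the rotation number of \<^term>\<open>P\<close> has no excess anywhere, so it follows the
  interval exchange; its fractional part is constant and vanishes when the integer part is \<^term>\<open>B\<close>.\<close>

lemma cycle_unique:
  assumes K: "1 \<le> K" and cyc: "(F, Q) \<in> cycles" and rot: "rot F Q = of_nat rnum / of_nat rden"
  shows "Q = P"
proof -
  note Q = cyclesD[OF cyc]
  have F0: "F z \<noteq> 0" if "z \<in> Q" for z using Q(6) Q(7)[OF that] by auto
  have "(\<Sum>z\<in>Q. excess z) = 0" using sum_excess_eq_0_iff[OF cyc] rot by simp
  moreover have "0 \<le> excess z" if "z \<in> Q" for z using excess_nonneg F0[OF that] Q(6) that by blast
  ultimately have ex: "excess z = 0" if "z \<in> Q" for z using sum_nonneg_eq_0_iff[of Q excess] Q(3) that by simp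
  \<comment> \<open>Zero excess excludes the steep pieces of \<open>U\<close> and \<open>V\<close>:
    an orbit point on \<open>b 0\<close> has coordinate between 1 and \<open>B\<close> or at least
    \<open>B + 1\<close>, and its return is a translation.\<close>
  have step: "1 \<le> x \<and> x \<le> real B \<and> node 0 (x + real K) \<in> Q \<or> real B + 1 \<le> x \<and> node 0 (x - real B) \<in> Q"
    if x: "node 0 x \<in> Q" "0 < x" "x \<le> real N" for x
  proof -
    have "U x \<noteq> 0" using F0[OF x(1)] F_node_0[of x] x by (auto simp: arm_nonneg)
    then consider "0 < U x" | "U x < 0" by linarith
    then show ?thesis
    proof cases
      case 1
      then have "U x = x" using ex[OF x(1)] excess_black_0[of x] x by simp
      then have xB: "x \<le> real B" using U_eq_imp x by simp
      have Q1: "node 1 x \<in> Q" using Q(7)[OF x(1)] F_node_0[of x] \<open>U x = x\<close> x by (simp add: arm_nonneg)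
      then have Vx: "V x = x + real K" using ex[OF Q1] excess_1[of x] x by simp
      then have "1 \<le> x" using V_eq_imp K by simp
      moreover have "node 2 (x + real K) \<in> Q" using Q(7)[OF Q1] F_node_1[of x] Vx x by simp
      then have "node 0 (x + real K) \<in> Q" using Q(7)[of "node 2 (x + real K)"] F_node_2[of "x + real K"] x by simp
      ultimately show ?thesis using xB by blast
    next
      case 2
      then have Ux: "U x = real B - x" using ex[OF x(1)] excess_nonblack_0[of x] x by simp
      then have xB: "real B + 1 \<le> x" using U_ge_eq_imp 2 by simp
      have Qj: "node j (x - real B) \<in> Q" using Q(7)[OF x(1)] F_node_0[of x] Ux 2 x by (simp add: arm_nonpos)
      have "node 0 (x - real B) \<in> Q"
      proof (cases "j = 0")
        case False
        then show ?thesis using Q(7)[OF Qj] j F_node_2[of "x - real B"] xB by simp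
      qed (use Qj in simp)
      then show ?thesis using xB by blast
    qed
  qed
  obtain y where y: "y \<in> Q" using Q(4) by blast
  obtain i where "i < 3" "y \<in> b i" using in_some_b Q(6) y by blast
  then obtain r where r: "i < 3" "0 < r" "r \<le> real N" "y = node i r" using b_node by blast
  have two: "node 0 s \<in> Q" if "node 2 s \<in> Q" "0 < s" for s
    using Q(7)[OF that(1)] F_node_2[of s] that(2) by simp
  have "\<exists>x. 0 < x \<and> x \<le> real N \<and> node 0 x \<in> Q"
    using less_3_cases[OF r(1)]
  proof (elim disjE)
    assume "i = 1"
    then have "node 2 (V r) \<in> Q" using Q(7)[OF y] F_node_1[of r] r by simp
    then show ?thesis using two[of "V r"] V_pos[of r] V_le_N[of r] r by blast
  qed (use r y two in blast)+
  then obtain x where x: "0 < x" "x \<le> real N" "node 0 x \<in> Q" by blast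
  define n where "n = nat \<lfloor>x\<rfloor>"
  define \<phi> where "\<phi> = x - real n"
  have \<phi>: "0 \<le> \<phi>" "\<phi> < 1" "x = real n + \<phi>" using x(1) unfolding \<phi>_def n_def by linarith+
  have "1 \<le> x" using step[OF x(3,1,2)] by linarith
  then have n: "1 \<le> n" "n \<le> N" using x(2) unfolding n_def by linarith+
  have pow: "node 0 (real ((exchange B K ^^ m) n) + \<phi>) \<in> Q \<and> real ((exchange B K ^^ m) n) + \<phi> \<le> real N" for m
  proof (induction m)
    case 0
    then show ?case using x \<phi> by simp
  next
    case (Suc m)
    define l where "l = (exchange B K ^^ m) n"
    have l: "1 \<le> l" "l \<le> N" using exchange_pow_range[OF n, of m] unfolding l_def by auto
    have lQ: "node 0 (real l + \<phi>) \<in> Q" "real l + \<phi> \<le> real N" using Suc unfolding l_def by auto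
    have "0 < real l + \<phi>" using l \<phi> by simp
    from step[OF lQ(1) this lQ(2)] show ?case
    proof (elim disjE conjE)
      assume a: "real l + \<phi> \<le> real B" "node 0 (real l + \<phi> + real K) \<in> Q"
      then have "l \<le> B" using \<phi> by linarith
      then have "exchange B K l = l + K" unfolding exchange_def by simp
      then show ?thesis using a unfolding l_def by (simp add: algebra_simps)
    next
      assume a: "real B + 1 \<le> real l + \<phi>" "node 0 (real l + \<phi> - real B) \<in> Q"
      then have "B < l" using \<phi> by linarith
      then have "exchange B K l = l - B" "real (l - B) = real l - real B" unfolding exchange_def by auto
      then show ?thesis using a lQ(2) unfolding l_def by (simp add: algebra_simps)
    qed
  qed
  \<comment> \<open>At integer part \<open>B\<close> the coordinate \<open>B + \<phi>\<close> must
    be at most \<open>B\<close> or at least \<open>B + 1\<close>; since \<open>\<phi>\<close> is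
    below 1, it is 0.\<close>
  obtain m where m: "(exchange B K ^^ m) n = B"
    using exchange_transitive[OF coprime_BK B1 n, of B] B1 by auto
  have "node 0 (real B + \<phi>) \<in> Q" "real B + \<phi> \<le> real N" using pow[of m] m by auto
  then have "\<phi> = 0" using step[of "real B + \<phi>"] \<phi> B1 by force
  then have "node 0 x \<in> P" using P_node[of 0 n] n \<phi> unfolding in_P_def by simp
  then show ?thesis using periodic_orbit_unique[OF Q(2) _ x(3)] cyclesD(2)[OF cycle_P] by blast
qed

section \<open>Regularity and the twist property of the model\<close>

text \<open>Every cycle meets \<open>b 0\<close>. From a black point there the second iterate is on
  \<open>b 2\<close>; a green point has its image on the same branch, against primitivity; from a
  red point the second iterate is on \<open>b 0\<close> but closer to 0.\<close>

lemma no_primitive_2: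
  assumes cyc: "(F, Q) \<in> cycles" and prim: "primitive_cycle Q" and card: "card Q = 2"
  shows False
proof -
  note Q = cyclesD[OF cyc]
  have FF: "F (F z) = z" if "z \<in> Q" for z
    using periodic_orbit_minimal_period(1)[OF Q(2) that] card by (simp add: numeral_2_eq_2)
  obtain y where y: "y \<in> Q" using Q(4) by blast
  have no0: False if x: "node 0 x \<in> Q" "0 < x" "x \<le> real N" for x
  proof -
    have "F (node 0 x) \<noteq> 0" using Q(6) Q(7)[OF x(1)] by auto
    then have "U x \<noteq> 0" using F_node_0[of x] x by (auto simp: arm_nonneg)
    then consider "0 < U x" | "U x < 0" by linarith
    then show False
    proof cases
      case 1
      then have "F (F (node 0 x)) = node 2 (V (U x))" using F_node_0[of x] F_node_1[of "U x"] x by (simp add: arm_nonneg)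
      then show False using FF[OF x(1)] V_nonneg[of "U x"] 1 x by (simp add: node_eq_iff)
    next
      case 2
      have less: "- U x < x" using U_ge[of x] U_neg_imp[OF 2] x B1 by simp
      have Fx: "F (node 0 x) = node j (- U x)" using F_node_0[of x] 2 x by (simp add: arm_nonpos)
      show False
      proof (cases "j = 0")
        case True
        have "node 0 x \<noteq> node 0 (- U x)" using less 2 x by (simp add: node_eq_iff)
        moreover have "node 0 (- U x) \<in> Q" using Fx True Q(7)[OF x(1)] by simp
        moreover have "node 0 x \<in> b 0" "node 0 (- U x) \<in> b 0" using 2 x less by (auto simp: node_in_b_iff)
        then have "same_branch (node 0 x) (node 0 (- U x))" unfolding same_branch_iff by force
        ultimately show False using prim x(1) unfolding primitive_cycle_def by blast
      next
        case False
        then have "F (F (node 0 x)) = node 0 (- U x)" using Fx j F_node_2[of "- U x"] 2 by simp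
        then show False using FF[OF x(1)] less 2 x by (simp add: node_eq_iff)
      qed
    qed
  qed
  obtain i where "i < 3" "y \<in> b i" using in_some_b Q(6) y by blast
  then obtain r where r: "i < 3" "0 < r" "r \<le> real N" "y = node i r" using b_node by blast
  show False
    using less_3_cases[OF r(1)]
  proof (elim disjE)
    assume "i = 0"
    then show False using no0 r y by blast
  next
    assume i: "i = 1"
    have "F y = node 2 (V r)" using i r F_node_1 by simp
    moreover have "F (node 2 (V r)) = node 0 (V r)" using F_node_2 V_nonneg r by simp
    ultimately have "node 0 (V r) \<in> Q" using Q(7) y by metis
    then show False using no0[of "V r"] V_pos[of r] V_le_N[of r] r by blast
  next
    assume i: "i = 2"
    then have "node 0 r \<in> Q" using Q(7)[OF y] r F_node_2[of r] by simp
    then show False using no0 r by blast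
  qed
qed

definition twist :: "((complex \<Rightarrow> complex) \<times> complex set) set" where
  "twist = cycle_equiv `` {(F, P)}"

lemma twist_pattern: "twist \<in> patterns" "(F, P) \<in> twist"
  unfolding twist_def using pattern_class in_own_class cycle_P by auto

lemma K_0_black3:
  assumes "K = 0" "0 < s" "s \<le> 1"
  shows "black3 F (\<lambda>_. s)"
proof -
  have B: "B = 1" using assms(1) coprime_BK by simp
  have nd: "pt i x = node i x" for i x unfolding node_def using assms(1) B by simp
  have "F (pt i s) = pt ((i + 1) mod 3) s" if "i < 3" for i
    using less_3_cases[OF that] assms B F_node_0[of s] F_node_1[of s] F_node_2[of s] U_inner[of s] V_le_1[of s]
      arm_nonneg[of s 1 j]
    unfolding nd by (elim disjE) (simp_all del: One_nat_def)
  then show ?thesis unfolding black3_def using assms F_triod_maps by blast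
qed

text \<open>For \<open>K = 0\<close> the map permutes the branches cyclically and preserves radii.
  There are infinitely many cycles with the same rotation number, but \<open>black3_equiv\<close>
  puts them into one pattern.\<close>

lemma K_0_cycle:
  assumes K: "K = 0" and cyc: "(F, Q) \<in> cycles"
  obtains s where "black3 F (\<lambda>_. s)" "Q = tripod (\<lambda>_. s)"
proof -
  note Q = cyclesD[OF cyc]
  obtain y where y: "y \<in> Q" using Q(4) by blast
  obtain i where i: "i < 3" "y \<in> b i" using in_some_b Q(6) y by blast
  then obtain s where s: "0 < s" "s \<le> 1" "y = pt i s" using b_iff by blast
  have u: "black3 F (\<lambda>_. s)" using K_0_black3[OF K s(1,2)] .
  have "y \<in> tripod (\<lambda>_. s)" unfolding tripod_def using s i by blast
  then have "Q = tripod (\<lambda>_. s)"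
    using periodic_orbit_unique[OF Q(2) cyclesD(2)[OF black3_cycle[OF u]] y] by blast
  then show ?thesis using that u by blast
qed

lemma same_rotation:
  assumes A: "A \<in> patterns" "(F, Q) \<in> A" and rot: "rot F Q = rot F P"
  shows "A = twist"
proof -
  have cyc: "(F, Q) \<in> cycles" using pattern_cycle A by blast
  have "((F, P), (F, Q)) \<in> cycle_equiv"
  proof (cases "K = 0")
    case True
    then show ?thesis using K_0_cycle[OF True cyc] K_0_cycle[OF True cycle_P] black3_equiv by metis
  next
    case False
    then have "Q = P" using cycle_unique[OF _ cyc] rot rot_P by simp
    then show ?thesis using equiv_cycle_equiv cycle_P unfolding equiv_def refl_on_def by blast
  qed
  then have "(F, Q) \<in> twist" using pattern_closed twist_pattern by blast
  then show ?thesis using patterns_eq[OF A(1) twist_pattern(1) A(2)] by blast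
qed

lemma twist_in_twists: "twist \<in> unimodal_triod_twists b (of_nat rnum / of_nat rden)"
proof -
  have forced: "\<exists>Q. (F, Q) \<in> A" if "forces twist A" for A
    using that F_triod_maps twist_pattern unfolding forces_def by blast
  have hr: "has_rotation_number b twist r \<longleftrightarrow> r = rot F P" for r
    using has_rotation_number_iff[OF twist_pattern] .
  have "regular_pattern twist"
    unfolding regular_pattern_def
  proof (intro ballI impI notI)
    fix A assume A: "A \<in> patterns" "primitive_pattern_of_period 2 A" "forces twist A"
    then obtain Q where Q: "(F, Q) \<in> A" using forced by blast
    show False using no_primitive_2 pattern_primitive[OF A(1,2) Q] pattern_cycle[OF A(1) Q] by blast
  qed
  moreover have False if A: "A \<in> patterns" "A \<noteq> twist" "forces twist A"
    "has_rotation_number b twist r" "has_rotation_number b A r" for A r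
  proof -
    obtain Q where Q: "(F, Q) \<in> A" using forced A(3) by blast
    have "rot F Q = rot F P" using has_rotation_number_iff[OF A(1) Q] A(4,5) hr by metis
    then show False using same_rotation[OF A(1) Q] A(2) by blast
  qed
  ultimately have "triod_twist b twist" unfolding triod_twist_def using twist_pattern by blast
  moreover have "canonical_for b twist" unfolding canonical_for_def using canonical_P twist_pattern by blast
  moreover have "unimodal_pattern twist" unfolding unimodal_pattern_def using unimodal_P twist_pattern by blast
  moreover have "has_rotation_number b twist (of_nat rnum / of_nat rden)" using hr rot_P by simp
  ultimately show ?thesis unfolding unimodal_triod_twists_def by blast
qed

text \<open>Recovers the branch of the turning point from the colours in the pattern alone, which is
  how the three shifted models are told apart.\<close>

lemma twist_black_iff:
  assumes "1 \<le> K" "i < 3"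
  shows "(\<forall>(f, Q)\<in>twist. \<forall>x\<in>Q \<inter> b i. black b f x) \<longleftrightarrow> i \<noteq> 0"
proof
  assume "\<forall>(f, Q)\<in>twist. \<forall>x\<in>Q \<inter> b i. black b f x"
  then have bl: "\<forall>x\<in>P \<inter> b i. black b F x" using twist_pattern by blast
  show "i \<noteq> 0"
  proof
    assume "i = 0"
    then have "\<forall>x\<in>P \<inter> b 0. black b F x" using bl by simp
    then show False using nonblack_node_0[OF assms(1)] by blast
  qed
next
  assume "i \<noteq> 0"
  then have "\<forall>x\<in>P \<inter> b i. black b F x" using black_other assms(2) by blast
  then show "\<forall>(f, Q)\<in>twist. \<forall>x\<in>Q \<inter> b i. black b f x"
    using pattern_black[OF twist_pattern _ assms(2)] by blast
qed

end

section \<open>Renumbering the branches\<close>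

context numbered_triod
begin

definition shift :: "nat \<Rightarrow> nat \<Rightarrow> nat" where
  "shift c i = (i + c) mod 3"

lemma shift_less: "shift c i < 3"
  unfolding shift_def by simp

lemma shift_bij: "bij_betw (shift c) {..<3} {..<3}"
proof -
  have "inj_on (shift c) {..<3}"
  proof (rule inj_onI)
    fix i l assume "i \<in> {..<3}" "l \<in> {..<3}" "shift c i = shift c l"
    then show "i = l" using mod_3_add_cancel[of l i c] unfolding shift_def by (simp add: add.commute)
  qed
  moreover have "shift c ` {..<3} \<subseteq> {..<3}" using shift_less by auto
  ultimately show ?thesis by (simp add: bij_betw_def endo_inj_surj)
qed

lemma shift_add: "shift c ((i + k) mod 3) = (shift c i + k) mod 3"
  unfolding shift_def mod_add_left_eq by (simp add: ac_simps)

lemma ex_shift: "(\<exists>i<3. Q (shift c i)) \<longleftrightarrow> (\<exists>i<3. Q i)"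
proof -
  have im: "shift c ` {..<3} = {..<3}" using shift_bij by (simp add: bij_betw_def)
  have "(\<exists>i\<in>{..<3}. Q (shift c i)) \<longleftrightarrow> (\<exists>i\<in>shift c ` {..<3}. Q i)" by blast
  then show ?thesis unfolding im by auto
qed

lemma all_shift: "(\<forall>i<3. Q (shift c i)) \<longleftrightarrow> (\<forall>i<3. Q i)"
  using ex_shift[of "\<lambda>i. \<not> Q i"] by blast

text \<open>A cyclic shift adds the same number to both indices, so their difference modulo 3 is
  unchanged.\<close>

lemma displacement_shift: "displacement (\<lambda>i. b (shift c i)) = displacement b"
proof (intro ext)
  fix u v
  have "(\<exists>i<3. u \<in> b (shift c i) \<and> v \<in> b (shift c ((i + k) mod 3))) \<longleftrightarrow>
      (\<exists>i<3. u \<in> b i \<and> v \<in> b ((i + k) mod 3))" for k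
    unfolding shift_add using ex_shift[of "\<lambda>i. u \<in> b i \<and> v \<in> b ((i + k) mod 3)" c] .
  then show "displacement (\<lambda>i. b (shift c i)) u v = displacement b u v"
    unfolding displacement_def by simp
qed

lemma black_shift: "black (\<lambda>i. b (shift c i)) = black b"
  unfolding black_def[abs_def] displacement_shift ..

lemma twists_shift: "unimodal_triod_twists (\<lambda>i. b (shift c i)) r = unimodal_triod_twists b r"
proof -
  have "canonical_for (\<lambda>i. b (shift c i)) A = canonical_for b A" for A
    unfolding canonical_for_def canonical_for_cycle_def black_shift
    using all_shift[of "\<lambda>i. \<exists>x\<in>_ \<inter> b i. (\<forall>y\<in>_ \<inter> b i. norm x \<le> norm y) \<and> black b _ x" c] by simp
  moreover have "has_rotation_number (\<lambda>i. b (shift c i)) = has_rotation_number b"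
    unfolding has_rotation_number_def[abs_def] rotation_pair_def displacement_shift ..
  ultimately show ?thesis unfolding unimodal_triod_twists_def triod_twist_def by simp
qed

lemma numbered_triod_shift: "numbered_triod (\<lambda>i. b (shift c i)) (\<lambda>i. e (shift c i))"
proof
  show "b (shift c i) = ray (e (shift c i))" "e (shift c i) ^ 3 = 1" if "i < 3" for i
    using b_eq e_cube shift_less by auto
  show "inj_on (\<lambda>i. e (shift c i)) {..<3}"
    using comp_inj_on[of "shift c" "{..<3}" e] shift_bij[of c] e_inj by (simp add: bij_betw_def comp_def)
  have "(\<lambda>i. b (shift c i)) ` {..<3} = b ` shift c ` {..<3}" by auto
  then show "branches = (\<lambda>i. b (shift c i)) ` {..<3}" using branches_eq shift_bij[of c] by (simp add: bij_betw_def)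
qed

text \<open>The model is built over the three cyclic shifts of the numbering. Rotation number and
  canonicity are those for \<open>b\<close>, but the nonblack points sit on branch
  \<open>shift c 0\<close>.\<close>

lemma three_twists:
  fixes B K j :: nat and r :: rat
  assumes "1 \<le> B" "1 \<le> K" "coprime B K" "j = 0 \<or> j = 2"
    and r: "r = (if j = 0 then of_nat B / of_nat (3 * B + K) else of_nat (B + K) / of_nat (3 * B + 2 * K))"
  shows "\<exists>A C D. A \<noteq> C \<and> A \<noteq> D \<and> C \<noteq> D \<and> A \<in> unimodal_triod_twists b r \<and>
    C \<in> unimodal_triod_twists b r \<and> D \<in> unimodal_triod_twists b r"
proof -
  have "\<exists>A. A \<in> unimodal_triod_twists b r \<and> (\<forall>i<3. (\<forall>(f, Q)\<in>A. \<forall>x\<in>Q \<inter> b i. black b f x) \<longleftrightarrow> i \<noteq> shift c 0)" for c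
  proof -
    interpret tw: twist_model "\<lambda>i. b (shift c i)" "\<lambda>i. e (shift c i)" B K j
      by (rule twist_model.intro[OF numbered_triod_shift twist_model_axioms.intro[OF assms(1,3,4)]])
    have "r = of_nat tw.rnum / of_nat tw.rden" unfolding r tw.rnum_def tw.rden_def by simp
    then have "tw.twist \<in> unimodal_triod_twists b r" using tw.twist_in_twists twists_shift by simp
    moreover have "(\<forall>(f, Q)\<in>tw.twist. \<forall>x\<in>Q \<inter> b i. black b f x) \<longleftrightarrow> i \<noteq> shift c 0" if i: "i < 3" for i
    proof -
      obtain k where k: "k < 3" "i = shift c k" using shift_bij[of c] i unfolding bij_betw_def by (metis imageE lessThan_iff)
      have "k \<noteq> 0 \<longleftrightarrow> i \<noteq> shift c 0"
        using shift_bij[of c] k unfolding bij_betw_def inj_on_def by (metis lessThan_iff zero_less_numeral)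
      then show ?thesis using tw.twist_black_iff[OF assms(2) k(1)] k(2) black_shift by simp
    qed
    ultimately show ?thesis by blast
  qed
  then have "\<forall>c. \<exists>A. A \<in> unimodal_triod_twists b r \<and>
      (\<forall>i<3. (\<forall>(f, Q)\<in>A. \<forall>x\<in>Q \<inter> b i. black b f x) \<longleftrightarrow> i \<noteq> shift c 0)" by blast
  from choice[OF this] obtain A where A: "\<And>c. A c \<in> unimodal_triod_twists b r"
    "\<And>c i. i < 3 \<Longrightarrow> (\<forall>(f, Q)\<in>A c. \<forall>x\<in>Q \<inter> b i. black b f x) \<longleftrightarrow> i \<noteq> shift c 0"
    by blast
  have ne: "A c \<noteq> A d" if "shift c 0 \<noteq> shift d 0" for c d
  proof
    assume eq: "A c = A d"
    have "(shift c 0 \<noteq> shift c 0) = (shift c 0 \<noteq> shift d 0)"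
      by (rule trans[OF A(2)[of "shift c 0" c, OF shift_less, symmetric] A(2)[of "shift c 0" d, OF shift_less, folded eq]])
    then show False using that by simp
  qed
  have "A 0 \<noteq> A 1" "A 0 \<noteq> A 2" "A 1 \<noteq> A 2" by (rule ne, simp add: shift_def)+
  then show ?thesis using A(1) by blast
qed

end

theorem theorem3p18:
  fixes b :: "nat \<Rightarrow> complex set"
  assumes "branch_numbering b"
  shows "(\<forall>r::rat. 0 < r \<and> r < 1 / 2 \<and> r \<noteq> 1 / 3 \<longrightarrow>
            (\<exists>A B C. A \<noteq> B \<and> A \<noteq> C \<and> B \<noteq> C \<and>
               A \<in> unimodal_triod_twists b r \<and>
               B \<in> unimodal_triod_twists b r \<and>
               C \<in> unimodal_triod_twists b r))
       \<and> (\<exists>!A. A \<in> unimodal_triod_twists b (1 / 3))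
       \<and> \<not> (\<exists>A. \<exists>r\<ge>1 / 2. A \<in> unimodal_triod_twists b r)"
proof -
  obtain e where "numbered_triod b e" using numbered_triod_exists[OF assms] .
  then interpret numbered_triod b e .
  have 1: "\<exists>A B C. A \<noteq> B \<and> A \<noteq> C \<and> B \<noteq> C \<and> A \<in> unimodal_triod_twists b r \<and>
      B \<in> unimodal_triod_twists b r \<and> C \<in> unimodal_triod_twists b r"
    if r: "0 < r" "r < 1 / 2" "r \<noteq> 1 / 3" for r :: rat
  proof -
    obtain p' q' where pq': "quotient_of r = (p', q')" by force
    have q': "0 < q'" "coprime p' q'" "r = of_int p' / of_int q'"
      using quotient_of_denom_pos[OF pq'] quotient_of_coprime[OF pq'] quotient_of_div[OF pq'] by auto
    define p q where "p = nat p'" and "q = nat q'"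
    have "0 < p'" using r(1) q' by (simp add: zero_less_divide_iff)
    then have pq: "p' = int p" "q' = int q" using q' unfolding p_def q_def by auto
    have cop: "coprime p q" using q'(2) unfolding pq by simp
    have rpq: "r = of_nat p / of_nat q" using q'(3) unfolding pq by simp
    have p0: "0 < p" "0 < q" using \<open>0 < p'\<close> q'(1) pq by auto
    have "(of_nat (2 * p) :: rat) < of_nat q" using r(2) p0 unfolding rpq by (simp add: field_simps)
    then have pq2: "2 * p < q" by (simp only: of_nat_less_iff)
    have "(of_nat (3 * p) :: rat) \<noteq> of_nat q" using r(3) p0 unfolding rpq by (simp add: field_simps)
    then have "3 * p \<noteq> q" by (simp only: of_nat_eq_iff simp_thms)
    then consider "3 * p < q" | "q < 3 * p" by linarith
    then show ?thesis
    proof cases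
      case 1
      \<comment> \<open>Solves p = B and q = 3B + K, the green case.\<close>
      define K where "K = q - 3 * p"
      have q: "q = 3 * p + K" using 1 unfolding K_def by simp
      have "coprime p K"
      proof (rule coprimeI)
        fix d assume "d dvd p" "d dvd K"
        then show "is_unit d" using cop q by (meson coprime_common_divisor dvd_add dvd_mult)
      qed
      then show ?thesis
        using three_twists[of p K 0 r] 1 p0 rpq q by auto
    next
      case 2
      \<comment> \<open>Solves p = B + K and q = 3B + 2K, the red case; \<open>2 * p < q\<close>
        makes \<open>B\<close> positive and \<open>q < 3 * p\<close> makes \<open>K\<close>
        positive.\<close>
      define B K where "B = q - 2 * p" and "K = 3 * p - q"
      have p: "p = B + K" and q: "q = 3 * B + 2 * K" using 2 pq2 unfolding B_def K_def by auto
      have "coprime B K"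
      proof (rule coprimeI)
        fix d assume "d dvd B" "d dvd K"
        then have "d dvd p" "d dvd q" unfolding p q by (auto intro: dvd_add)
        then show "is_unit d" using cop by (meson coprime_common_divisor)
      qed
      then show ?thesis
        using three_twists[of B K 2 r] 2 pq2 rpq p q unfolding B_def K_def by auto
    qed
  qed
  have 2: "\<exists>!A. A \<in> unimodal_triod_twists b (1 / 3)"
  proof -
    \<comment> \<open>The model without nonblack points gives existence, and its black cycle through
      the endpoints of the branches identifies the only candidate.\<close>
    interpret tw: twist_model b e 1 0 0 by unfold_locales auto
    have "tw.twist \<in> unimodal_triod_twists b (1 / 3)"
      using tw.twist_in_twists unfolding tw.rnum_def tw.rden_def by simp
    moreover have "black3 tw.F (\<lambda>_. 1)" by (rule tw.K_0_black3) auto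
    ultimately show ?thesis using twist_third_unique by metis
  qed
  have 3: "\<not> (\<exists>A. \<exists>r\<ge>1 / 2. A \<in> unimodal_triod_twists b r)"
    using twist_less_half by (meson not_le)
  show ?thesis
  proof (intro conjI allI impI)
    fix r :: rat assume "0 < r \<and> r < 1 / 2 \<and> r \<noteq> 1 / 3"
    then show "\<exists>A B C. A \<noteq> B \<and> A \<noteq> C \<and> B \<noteq> C \<and> A \<in> unimodal_triod_twists b r \<and>
      B \<in> unimodal_triod_twists b r \<and> C \<in> unimodal_triod_twists b r"
      by (elim conjE) (rule 1)
  qed (fact 2, fact 3)
qed

end
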